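(* Let $W$ be a finite shuffle closed set of colored words with $\sum_{w\in W}w\in(I^{\mathrm{kron}})^\perp$. For a partition $\nu$, let $CT^\prec_\nu(W)=\{T\in CT^\prec_\nu:\mathrm{sqread}(T)\in W\}$ and $CT^<_\nu(W)=\{T\in CT^<_\nu:\mathrm{sqread}(T)\in W\}$. Then \[ \{\mathrm{conv}_{\prec\to<}(T): T\in CT^\prec_\nu(W)\}=CT^<_\nu(W). \]
   Context: $\mathcal{A}=\{1,\dots,N\}\sqcup\{\bar1,\dots,\bar N\}$ (unbarred/barred letters); colored words are finite words in $\mathcal{A}$. A shuffle order is a total order $\lessdot$ on $\mathcal{A}$ with $1\lessdot\cdots\lessdot N$ and $\bar1\lessdot\cdots\lessdot\bar N$; natural order $<$: $1<\bar1<2<\cdots<N<\bar N$; big bar order $\prec$: $1\prec\cdots\prec N\prec\bar1\prec\cdots\prec\bar N$. $W$ is shuffle closed if swapping any barred letter with an adjacent unbarred letter in a word of $W$ gives a word of $W$. $\mathcal{U}$: free associative $\mathbb{Z}$-algebra on noncommuting $u_x$ ($x\in\mathcal{A}$), monomials = colored words; $\langle\cdot,\cdot\rangle$ makes colored words orthonormal; $\perp$ is orthogonal complement. $a{\Downarrow}=\overline{a-1}$ ($2\le a\le N$), $\bar a{\Downarrow}=a$. $I^{\mathrm{kron}}$ is generated by: $yyx-yxy$ ($y$ unbarred, $x<y$); $zyy-yzy$ ($y$ unbarred, $y<z$); $yyz-yzy$ ($y$ barred, $y<z$); $xyy-yxy$ ($y$ barred, $x<y$); $(xz-zx)y-y(xz-zx)$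 for $x=y{\Downarrow}=z{\Downarrow}{\Downarrow}$; $xz-zx$ for $z{\Downarrow}{\Downarrow}$ defined and $x<z{\Downarrow}{\Downarrow}$. A $\lessdot$-colored tableau of shape $\nu$: filling of the Young diagram (English convention) with rows and columns weakly increasing for $\lessdot$, unbarred letters strictly increasing down columns, barred letters strictly increasing along rows; $CT^\lessdot_\nu$ is the set. $\mathrm{sqread}(T)=w^1\cdots w^k$, with $D^1,\dots,D^k$ the diagonals (constant column minus row) from the southwest and $w^i$ the unbarred entries of $D^i$ read northwestward followed by the barred entries read southeastward. Conversion: suppose shuffle orders $\lessdot,\lessdot'$ agree except that $b\lessdot\bar a$ are consecutive in $\lessdot$ while $\bar a\lessdot' b$. For a $\lessdot$-colored tableau $T$, the boxes containing $b$ or $\bar a$ form a ribbon (skew shape with no $2\times2$ square); each edge-connected component of it can be refilled in a unique way with the same numbers of $b$'s and $\bar a$'s so as to be compatible with $\bar a\lessdot' b$ (explicitly: if the northeast corner of the component contains $b$, each $b$ is moved to the bottom of its column within the component; if it contains $\bar a$, each $b$ is shifted one box to the right within its row). Doing this for all components gives a $\lessdot'$-colored tableau $\mathrm{conv}_{\lessdot\to\lessdot'}(T)$. For arbitrary shuffle orders $\lessdot,\lessdot'$, $\mathrm{conv}_{\lessdot\to\lessdot'}$ is the composite of such elementary conversions along any sequence of swaps of a consecutive unbarred and barred letter transforming $\lessdot$ into $\lessdot'$; it is known to be independent of the chosen sequence. *)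

theory Defs
  imports Main "HOL-Library.FuncSet" "HOL-Library.Multiset" "HOL-Library.Poly_Mapping"
begin

section \<open>Colored words and shuffle orders\<close>

datatype letter = is_unbarred: Unbarred nat | is_barred: Barred nat

definition alphabet :: "nat \<Rightarrow> letter set" where
  "alphabet N = Unbarred ` {1..N} \<union> Barred ` {1..N}"

definition colored_words :: "nat \<Rightarrow> letter list set" where
  "colored_words N = lists (alphabet N)"

text \<open>Total orders are reflexive relations, so a pair in \<open>r\<close> is a weak inequality;
  \<open>lt r\<close> is the associated strict order.\<close>

definition lt :: "letter rel \<Rightarrow> letter \<Rightarrow> letter \<Rightarrow> bool" where
  "lt r x y \<longleftrightarrow> (x, y) \<in> r \<and> x \<noteq> y"

definition shuffle_order :: "nat \<Rightarrow> letter rel \<Rightarrow> bool" where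
  "shuffle_order N r \<longleftrightarrow> linear_order_on (alphabet N) r \<and>
     (\<forall>a\<in>{1..N}. \<forall>b\<in>{1..N}. a < b \<longrightarrow>
        lt r (Unbarred a) (Unbarred b) \<and> lt r (Barred a) (Barred b))"

fun natural_le :: "letter \<Rightarrow> letter \<Rightarrow> bool" where
  "natural_le (Unbarred a) (Unbarred b) \<longleftrightarrow> a \<le> b"
| "natural_le (Barred a) (Barred b) \<longleftrightarrow> a \<le> b"
| "natural_le (Unbarred a) (Barred b) \<longleftrightarrow> a \<le> b"
| "natural_le (Barred a) (Unbarred b) \<longleftrightarrow> a < b"

definition natural_order :: "nat \<Rightarrow> letter rel" where
  "natural_order N = {(x, y). x \<in> alphabet N \<and> y \<in> alphabet N \<and> natural_le x y}"

fun big_bar_le :: "letter \<Rightarrow> letter \<Rightarrow> bool" where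
  "big_bar_le (Unbarred a) (Unbarred b) \<longleftrightarrow> a \<le> b"
| "big_bar_le (Barred a) (Barred b) \<longleftrightarrow> a \<le> b"
| "big_bar_le (Unbarred a) (Barred b) \<longleftrightarrow> True"
| "big_bar_le (Barred a) (Unbarred b) \<longleftrightarrow> False"

definition big_bar_order :: "nat \<Rightarrow> letter rel" where
  "big_bar_order N = {(x, y). x \<in> alphabet N \<and> y \<in> alphabet N \<and> big_bar_le x y}"

definition shuffle_closed :: "letter list set \<Rightarrow> bool" where
  "shuffle_closed W \<longleftrightarrow> (\<forall>u v a b.
     u @ [Unbarred a, Barred b] @ v \<in> W \<longleftrightarrow> u @ [Barred b, Unbarred a] @ v \<in> W)"


section \<open>The free associative algebra and the ideal of Kronecker relations\<close>

text \<open>Lists under concatenation are the free monoid, written additively because the product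
  of \<open>HOL-Library.Poly_Mapping\<close> is convolution over an additive monoid.  Hence the ring
  \<open>letter list \<Rightarrow>\<^sub>0 int\<close> is the free associative ring on all letters, in which
  \<open>Poly_Mapping.single w 1\<close> is the monomial \<open>w\<close>.\<close>

instantiation list :: (type) monoid_add
begin

definition zero_list :: "'a list" where "zero_list = []"

definition plus_list :: "'a list \<Rightarrow> 'a list \<Rightarrow> 'a list" where "plus_list = append"

instance
  by standard (simp_all add: zero_list_def plus_list_def)

end

type_synonym free_alg = "letter list \<Rightarrow>\<^sub>0 int"

definition free_algebra :: "nat \<Rightarrow> free_alg set" where
  "free_algebra N = {p. Poly_Mapping.keys p \<subseteq> colored_words N}"

definition word_monomial :: "letter list \<Rightarrow> free_alg" where
  "word_monomial w = Poly_Mapping.single w 1"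

definition gen :: "letter \<Rightarrow> free_alg" where
  "gen x = word_monomial [x]"

definition pairing :: "free_alg \<Rightarrow> free_alg \<Rightarrow> int" where
  "pairing p q = (\<Sum>w\<in>Poly_Mapping.keys p. Poly_Mapping.lookup p w * Poly_Mapping.lookup q w)"

definition orth_compl :: "nat \<Rightarrow> free_alg set \<Rightarrow> free_alg set" where
  "orth_compl N S = {p \<in> free_algebra N. \<forall>q\<in>S. pairing p q = 0}"

inductive_set two_sided_ideal :: "nat \<Rightarrow> free_alg set \<Rightarrow> free_alg set"
  for N :: nat and G :: "free_alg set" where
  zero: "0 \<in> two_sided_ideal N G"
| generator: "g \<in> G \<Longrightarrow> g \<in> two_sided_ideal N G"
| add: "p \<in> two_sided_ideal N G \<Longrightarrow> q \<in> two_sided_ideal N G \<Longrightarrow> p + q \<in> two_sided_ideal N G"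
| mult_left: "f \<in> free_algebra N \<Longrightarrow> p \<in> two_sided_ideal N G \<Longrightarrow> f * p \<in> two_sided_ideal N G"
| mult_right: "f \<in> free_algebra N \<Longrightarrow> p \<in> two_sided_ideal N G \<Longrightarrow> p * f \<in> two_sided_ideal N G"

text \<open>\<open>down\<close> is the partial map sending a letter to its predecessor in the natural order,
  undefined at the letter \<open>1\<close>.\<close>

fun down :: "letter \<Rightarrow> letter option" where
  "down (Unbarred a) = (if 2 \<le> a then Some (Barred (a - 1)) else None)"
| "down (Barred a) = Some (Unbarred a)"

definition kron_generators :: "nat \<Rightarrow> free_alg set" where
  "kron_generators N =
     {gen y * gen y * gen x - gen y * gen x * gen y | x y.
        is_unbarred y \<and> lt (natural_order N) x y}
   \<union> {gen z * gen y * gen y - gen y * gen z * gen y | y z.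
        is_unbarred y \<and> lt (natural_order N) y z}
   \<union> {gen y * gen y * gen z - gen y * gen z * gen y | y z.
        is_barred y \<and> lt (natural_order N) y z}
   \<union> {gen x * gen y * gen y - gen y * gen x * gen y | x y.
        is_barred y \<and> lt (natural_order N) x y}
   \<union> {(gen x * gen z - gen z * gen x) * gen y - gen y * (gen x * gen z - gen z * gen x) | x y z.
        {x, y, z} \<subseteq> alphabet N \<and> down y = Some x \<and> Option.bind (down z) down = Some x}
   \<union> {gen x * gen z - gen z * gen x | x z.
        z \<in> alphabet N \<and>
        (\<exists>t. Option.bind (down z) down = Some t \<and> lt (natural_order N) x t)}"

definition I_kron :: "nat \<Rightarrow> free_alg set" where
  "I_kron N = two_sided_ideal N (kron_generators N)"


section \<open>Colored tableaux\<close>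

definition is_partition :: "nat list \<Rightarrow> bool" where
  "is_partition \<nu> \<longleftrightarrow> sorted_wrt (\<ge>) \<nu> \<and> 0 \<notin> set \<nu>"

text \<open>The box \<open>(i, j)\<close> lies in row \<open>i\<close> and column \<open>j\<close>, both counted from 0, with rows
  going downwards.\<close>

type_synonym box = "nat \<times> nat"

definition young_diagram :: "nat list \<Rightarrow> box set" where
  "young_diagram \<nu> = {(i, j). i < length \<nu> \<and> j < \<nu> ! i}"

text \<open>Fillings are extensional, so that equal fillings of the diagram are equal functions.\<close>

type_synonym filling = "box \<Rightarrow> letter"

definition CT :: "nat \<Rightarrow> letter rel \<Rightarrow> nat list \<Rightarrow> filling set" where
  "CT N r \<nu> = {T \<in> young_diagram \<nu> \<rightarrow>\<^sub>E alphabet N.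
     (\<forall>i j k. j < k \<and> (i, j) \<in> young_diagram \<nu> \<and> (i, k) \<in> young_diagram \<nu> \<longrightarrow>
        (T (i, j), T (i, k)) \<in> r \<and> (is_barred (T (i, j)) \<longrightarrow> T (i, j) \<noteq> T (i, k))) \<and>
     (\<forall>i k j. i < k \<and> (i, j) \<in> young_diagram \<nu> \<and> (k, j) \<in> young_diagram \<nu> \<longrightarrow>
        (T (i, j), T (k, j)) \<in> r \<and> (is_unbarred (T (i, j)) \<longrightarrow> T (i, j) \<noteq> T (k, j)))}"

text \<open>The boxes of the diagonal with column minus row equal to \<open>d\<close>, read southeastward.\<close>

definition diagonal :: "nat list \<Rightarrow> int \<Rightarrow> box list" where
  "diagonal \<nu> d = [(i, j). i \<leftarrow> [0..<length \<nu>], j \<leftarrow> [0..<\<nu> ! i], int j - int i = d]"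

text \<open>For \<open>\<nu> = []\<close> the value of \<open>hd \<nu>\<close> is irrelevant, as all diagonals are empty.\<close>

definition sqread :: "nat list \<Rightarrow> filling \<Rightarrow> letter list" where
  "sqread \<nu> T = concat (map (\<lambda>d.
       filter is_unbarred (map T (rev (diagonal \<nu> d))) @
       filter is_barred (map T (diagonal \<nu> d)))
     [1 - int (length \<nu>)..int (hd \<nu>) - 1])"

definition CT_in :: "nat \<Rightarrow> letter rel \<Rightarrow> nat list \<Rightarrow> letter list set \<Rightarrow> filling set" where
  "CT_in N r \<nu> W = {T \<in> CT N r \<nu>. sqread \<nu> T \<in> W}"


section \<open>Conversion\<close>

text \<open>The unbarred letter \<open>b\<close> and the barred letter \<open>a\<close> are consecutive in \<open>r\<close>, in this order,
  and \<open>s\<close> is obtained from \<open>r\<close> by exchanging them.\<close>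

definition swap_up :: "nat \<Rightarrow> nat \<Rightarrow> nat \<Rightarrow> letter rel \<Rightarrow> letter rel \<Rightarrow> bool" where
  "swap_up N b a r s \<longleftrightarrow> shuffle_order N r \<and> shuffle_order N s \<and>
     lt r (Unbarred b) (Barred a) \<and>
     (\<nexists>c. lt r (Unbarred b) c \<and> lt r c (Barred a)) \<and>
     s = insert (Barred a, Unbarred b) (r - {(Unbarred b, Barred a)})"

definition letter_swap :: "nat \<Rightarrow> nat \<Rightarrow> nat \<Rightarrow> letter rel \<Rightarrow> letter rel \<Rightarrow> bool" where
  "letter_swap N b a r s \<longleftrightarrow> swap_up N b a r s \<or> swap_up N b a s r"

fun box_adjacent :: "box \<Rightarrow> box \<Rightarrow> bool" where
  "box_adjacent (i, j) (i', j') \<longleftrightarrow>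
     (i = i' \<and> (j' = Suc j \<or> j = Suc j')) \<or> (j = j' \<and> (i' = Suc i \<or> i = Suc i'))"

definition components :: "box set \<Rightarrow> box set set" where
  "components S = S // {(c, d). c \<in> S \<and> d \<in> S \<and>
     (c, d) \<in> {(c, d). c \<in> S \<and> d \<in> S \<and> box_adjacent c d}\<^sup>*}"

text \<open>\<open>T'\<close> arises from \<open>T\<close> by refilling every connected component of the set of boxes
  containing \<open>b\<close> or \<open>a\<close> (barred) with the same letters, counted with multiplicity.\<close>

definition refilling :: "nat list \<Rightarrow> nat \<Rightarrow> nat \<Rightarrow> filling \<Rightarrow> filling \<Rightarrow> bool" where
  "refilling \<nu> b a T T' \<longleftrightarrow>
     (let S = {c \<in> young_diagram \<nu>. T c = Unbarred b \<or> T c = Barred a}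
      in (\<forall>c. c \<notin> S \<longrightarrow> T' c = T c) \<and>
         (\<forall>C\<in>components S. image_mset T' (mset_set C) = image_mset T (mset_set C)))"

text \<open>The letters \<open>a\<close> and \<open>b\<close> below are determined by \<open>r\<close> and \<open>s\<close>.  For \<open>T\<close> in \<open>CT N r \<nu>\<close>
  there is exactly one such \<open>T'\<close>: in each component the order \<open>s\<close> forces every entry except the
  one at the northeast corner (if \<open>b\<close> precedes \<open>a\<close> in \<open>s\<close>) or at the southwest corner
  (otherwise), and that one is then determined by the multiplicities.\<close>

definition elem_conv :: "nat \<Rightarrow> nat list \<Rightarrow> letter rel \<Rightarrow> letter rel \<Rightarrow> filling \<Rightarrow> filling" where
  "elem_conv N \<nu> r s T =
     (THE T'. T' \<in> CT N s \<nu> \<and> (\<exists>b a. letter_swap N b a r s \<and> refilling \<nu> b a T T'))"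

fun conv_along :: "nat \<Rightarrow> nat list \<Rightarrow> letter rel list \<Rightarrow> filling \<Rightarrow> filling" where
  "conv_along N \<nu> (r # s # rs) T = conv_along N \<nu> (s # rs) (elem_conv N \<nu> r s T)"
| "conv_along N \<nu> _ T = T"

definition swap_sequence :: "nat \<Rightarrow> letter rel \<Rightarrow> letter rel \<Rightarrow> letter rel list \<Rightarrow> bool" where
  "swap_sequence N r s rs \<longleftrightarrow> rs \<noteq> [] \<and> hd rs = r \<and> last rs = s \<and>
     successively (\<lambda>p q. \<exists>b a. letter_swap N b a p q) rs"

text \<open>The composite does not depend on the sequence of swaps, so \<open>conv\<close> uses an arbitrary
  one.\<close>

definition conv :: "nat \<Rightarrow> nat list \<Rightarrow> letter rel \<Rightarrow> letter rel \<Rightarrow> filling \<Rightarrow> filling" where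
  "conv N \<nu> r s = conv_along N \<nu> (SOME rs. swap_sequence N r s rs)"

end

theory Submission
  imports Defs
begin

text \<open>On a shuffle closed set \<open>W\<close> all relations of the ideal reduce to the following: unbarred and
  barred letters commute, and within the unbarred letters (dually, the barred ones) words may be
  changed by the local plactic relations. So membership of \<open>sqread T\<close> in \<open>W\<close> only depends on the
  local plactic classes of its unbarred and of its barred part.

  The boxes of \<open>T\<close> with entry \<open>b\<close> or \<open>a\<close> (barred) form a ribbon with at most one box on each
  diagonal, and an elementary conversion rotates the entries of each of its components cyclically by
  one step towards the northeast. If at most one barred letter lies between any two consecutive
  unbarred ones, and none between \<open>b - 1\<close> and \<open>b\<close>, this does not change the class of the unbarred
  part; an arbitrary swap may change it. Therefore two different sequences of swaps are used: moving
  the barred letters down one after the other keeps the unbarred class, moving the unbarred letters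
  up one after the other keeps (by transposition) the barred class. Both give the same conversion:
  the shapes filled by the letters up to \<open>i\<close> (unbarred) and up to \<open>j\<close> (barred) form a growth
  diagram, whose local rule at every unit square is a bijection, so that the final tableau does not
  depend on the sequence of swaps.\<close>


section \<open>Local plactic equivalence of words\<close>

text \<open>A conversion changes the unbarred word only by deciding anew which diagonals contain
  \<open>b\<close>; every diagonal is a decreasing word with a switch for \<open>b\<close>. In
  effect one bit, the entry at the northeast end of a component, is carried through its diagonals to
  the southwest end. At a horizontal step of the ribbon \<open>b\<close> can cross two neighbouring
  words, because tameness forces the runs of consecutive letters next to \<open>b\<close> to recur
  on the neighbouring diagonal. At a vertical step there is no such crossing; \<open>b\<close> is
  released to the left of its own word and absorbed by the word before it. The barred half needs no
  second computation: transposing and exchanging bars reverses the reading, and the barred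
  generators are the unbarred ones read backwards. This also turns the conversion round, so that
  there the dual of the order after the swap has to be tame. Finally, \<open>conv\<close> follows an
  unspecified sequence of swaps, which may go back and forth. The growth diagram must therefore
  survive inverse swaps as well, and this is where injectivity of the rotation enters.\<close>

inductive lpe :: "nat list \<Rightarrow> nat list \<Rightarrow> bool" (infix "\<approx>" 50) where
  lpe_refl: "u \<approx> u"
| lpe_sym: "u \<approx> v \<Longrightarrow> v \<approx> u"
| lpe_trans: "u \<approx> v \<Longrightarrow> v \<approx> w \<Longrightarrow> u \<approx> w"
| lpe_far: "x + 2 \<le> y \<Longrightarrow> u @ [x, y] @ v \<approx> u @ [y, x] @ v"
| lpe_knuth1: "u @ [Suc x, Suc x, x] @ v \<approx> u @ [Suc x, x, Suc x] @ v"
| lpe_knuth2: "u @ [Suc x, x, x] @ v \<approx> u @ [x, Suc x, x] @ v"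

declare lpe_refl [simp, intro]
declare lpe_trans [trans]

lemma lpe_context: "u \<approx> v \<Longrightarrow> p @ u @ q \<approx> p @ v @ q"
proof (induction rule: lpe.induct)
  case (lpe_far x y u v)
  from lpe.lpe_far[OF this, of "p @ u" "v @ q"] show ?case by simp
next
  case (lpe_knuth1 u x v)
  from lpe.lpe_knuth1[of "p @ u" x "v @ q"] show ?case by simp
next
  case (lpe_knuth2 u x v)
  from lpe.lpe_knuth2[of "p @ u" x "v @ q"] show ?case by simp
qed (blast intro: lpe.intros)+

lemma lpe_append: "u \<approx> u' \<Longrightarrow> v \<approx> v' \<Longrightarrow> u @ v \<approx> u' @ v'"
  using lpe_context[of u u' "[]" v] lpe_context[of v v' u' "[]"] by (auto intro: lpe_trans)

lemma lpe_commute: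
  assumes "\<And>x. x \<in> set xs \<Longrightarrow> x + 2 \<le> b \<or> b + 2 \<le> x"
  shows "b # xs \<approx> xs @ [b]"
  using assms
proof (induction xs)
  case (Cons x xs)
  have "b # x # xs \<approx> x # b # xs"
    using Cons.prems[of x] lpe_far[of b x "[]" xs] lpe_far[of x b "[]" xs, THEN lpe_sym] by auto
  also have "x # b # xs \<approx> x # xs @ [b]"
    using lpe_context[OF Cons.IH, of "[x]" "[]"] Cons.prems by simp
  finally show ?case by simp
qed auto

lemma lpe_commute_lists:
  assumes "\<And>x y. x \<in> set xs \<Longrightarrow> y \<in> set ys \<Longrightarrow> x + 2 \<le> y \<or> y + 2 \<le> x"
  shows "xs @ ys \<approx> ys @ xs"
  using assms
proof (induction xs)
  case (Cons x xs)
  have "(x # xs) @ ys \<approx> x # ys @ xs"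
    using lpe_context[OF Cons.IH, of "[x]" "[]"] Cons.prems by simp
  also have "x # ys @ xs \<approx> ys @ x # xs"
    using lpe_context[OF lpe_commute[of ys x], of "[]" xs] Cons.prems by fastforce
  finally show ?case .
qed auto

section \<open>Decreasing words of sets and the passage of one letter through them\<close>

definition desc :: "nat set \<Rightarrow> nat list" where
  "desc A = rev (sorted_list_of_set A)"

lemma desc_unique:
  assumes "sorted_wrt (>) xs"
  shows "desc (set xs) = xs"
proof -
  have "sorted_wrt (<) (rev xs)"
    using assms by (simp add: sorted_wrt_rev)
  then have "sorted_list_of_set (set (rev xs)) = rev xs"
    using sorted_list_of_set.idem_if_sorted_distinct strict_sorted_iff by blast
  then show ?thesis by (simp add: desc_def)
qed

lemma set_desc [simp]: "finite A \<Longrightarrow> set (desc A) = A"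
  by (simp add: desc_def)

lemma sorted_desc: "sorted_wrt (>) (desc A)"
  by (simp add: desc_def sorted_wrt_rev)

lemma desc_split:
  assumes "finite A"
  shows "desc A = desc {x\<in>A. b < x} @ (if b \<in> A then [b] else []) @ desc {x\<in>A. x < b}"
    (is "_ = ?r")
proof -
  have "set ?r = A"
    using assms by auto
  moreover have "sorted_wrt (>) ?r"
    using assms sorted_desc by (fastforce simp: sorted_wrt_append)
  ultimately show ?thesis
    using desc_unique[of ?r] by metis
qed

lemma desc_max:
  assumes "finite A" "c \<in> A" "\<And>x. x \<in> A \<Longrightarrow> x \<le> c"
  shows "desc A = c # desc (A - {c})"
proof -
  have 1: "{x\<in>A. c < x} = {}" using assms leD by auto
  have 2: "{x\<in>A. x < c} = A - {c}" using assms(2,3) by (auto simp: order.strict_iff_order)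
  show ?thesis using desc_split[OF assms(1), of c] assms(2) unfolding 1 2 by (simp add: desc_def)
qed

lemma desc_min:
  assumes "finite A" "c \<in> A" "\<And>x. x \<in> A \<Longrightarrow> c \<le> x"
  shows "desc A = desc (A - {c}) @ [c]"
proof -
  have 1: "{x\<in>A. x < c} = {}" using assms leD by auto
  have 2: "{x\<in>A. c < x} = A - {c}" using assms(2,3) by (auto simp: order.strict_iff_order)
  show ?thesis using desc_split[OF assms(1), of c] assms(2) unfolding 1 2 by (simp add: desc_def)
qed

text \<open>Only the run of \<open>L\<close> ending at \<open>b - 1\<close> obstructs
  \<open>b\<close>, and the last hypothesis provides a copy of this run in \<open>L'\<close>. The
  letter \<open>c = b - 1\<close> of \<open>L'\<close> is fetched to stand beside its twin, so that
  the Knuth relation for \<open>b c c\<close> applies; transporting \<open>c\<close> is the same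
  problem one letter lower.\<close>

lemma lpe_move_below:
  assumes "finite L" "finite L'" "\<And>x. x \<in> L \<Longrightarrow> x < b" "\<And>x. x \<in> L' \<Longrightarrow> x < b"
    and "\<And>x. x < b \<Longrightarrow> {x..<b} \<subseteq> L \<Longrightarrow> x \<in> L'"
  shows "b # desc L @ desc L' \<approx> desc L @ b # desc L'"
  using assms
proof (induction b arbitrary: L L')
  case 0
  then have "L = {}" by auto
  then show ?case by (simp add: desc_def)
next
  case (Suc c)
  show ?case
  proof (cases "c \<in> L")
    case False
    have "Suc c # desc L \<approx> desc L @ [Suc c]"
    proof (rule lpe_commute)
      fix x assume "x \<in> set (desc L)"
      then have "x < Suc c" "x \<noteq> c" using Suc.prems False by auto
      then show "x + 2 \<le> Suc c \<or> Suc c + 2 \<le> x" by auto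
    qed
    from lpe_context[OF this, of "[]" "desc L'"] show ?thesis by simp
  next
    case True
    let ?L = "L - {c}" and ?L' = "L' - {c}"
    have "{c..<Suc c} \<subseteq> L" using True by auto
    then have "c \<in> L'" using Suc.prems by blast
    have e: "desc L = c # desc ?L" "desc L' = c # desc ?L'"
      using desc_max[of L c] desc_max[of L' c] True \<open>c \<in> L'\<close> Suc.prems less_Suc_eq_le by auto
    have IH: "c # desc ?L @ desc ?L' \<approx> desc ?L @ c # desc ?L'"
    proof (rule Suc.IH)
      fix x assume *: "x < c" "{x..<c} \<subseteq> ?L"
      have "{x..<Suc c} \<subseteq> L" using * True by (auto simp: less_Suc_eq)
      then show "x \<in> ?L'" using Suc.prems(5)[of x] * by auto
    qed (use Suc.prems in \<open>force+\<close>)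
    have far: "Suc c # desc ?L \<approx> desc ?L @ [Suc c]"
    proof (rule lpe_commute)
      fix x assume "x \<in> set (desc ?L)"
      then have "x < Suc c" "x \<noteq> c" using Suc.prems by auto
      then show "x + 2 \<le> Suc c \<or> Suc c + 2 \<le> x" by auto
    qed
    have "Suc c # desc L @ desc L' = [Suc c, c] @ (desc ?L @ c # desc ?L') @ []"
      by (simp add: e)
    also have "\<dots> \<approx> [Suc c, c] @ (c # desc ?L @ desc ?L') @ []"
      by (rule lpe_context[OF lpe_sym[OF IH]])
    also have "\<dots> \<approx> [c, Suc c] @ (c # desc ?L @ desc ?L') @ []"
      using lpe_knuth2[of "[]" c "desc ?L @ desc ?L'"] by simp
    also have "\<dots> \<approx> [c, Suc c] @ (desc ?L @ c # desc ?L') @ []"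
      by (intro lpe_context IH)
    also have "\<dots> \<approx> [c] @ (desc ?L @ [Suc c]) @ (c # desc ?L')"
      using lpe_context[OF far, of "[c]" "c # desc ?L'"] by simp
    finally show ?thesis by (simp add: e)
  qed
qed

text \<open>Mirror image of \<open>lpe_move_below\<close>: the run of \<open>H'\<close> starting at
  \<open>b + 1\<close> is in the way, and its twin lies to the left, in \<open>H\<close>. The
  induction climbs with \<open>b\<close>, hence the bound \<open>m\<close> in its measure.\<close>

lemma lpe_move_above:
  assumes "finite H" "finite H'" "\<And>x. x \<in> H \<Longrightarrow> b < x" "\<And>x. x \<in> H' \<Longrightarrow> b < x"
    and "\<And>x. b < x \<Longrightarrow> {b<..x} \<subseteq> H' \<Longrightarrow> x \<in> H"
  shows "desc H @ b # desc H' \<approx> desc H @ desc H' @ [b]"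
proof -
  obtain m where "\<And>x. x \<in> H' \<Longrightarrow> x \<le> m"
    using assms(2) finite_nat_set_iff_bounded_le by metis
  then show ?thesis using assms
  proof (induction "m - b" arbitrary: b H H' rule: less_induct)
    case less
    show ?case
    proof (cases "Suc b \<in> H'")
      case False
      have "b # desc H' \<approx> desc H' @ [b]"
      proof (rule lpe_commute)
        fix x assume "x \<in> set (desc H')"
        then have "b < x" "x \<noteq> Suc b" using less.prems False by auto
        then show "x + 2 \<le> b \<or> b + 2 \<le> x" by auto
      qed
      from lpe_context[OF this, of "desc H" "[]"] show ?thesis by simp
    next
      case True
      let ?c = "Suc b"
      let ?H = "H - {?c}" and ?H' = "H' - {?c}"
      have "{b<..?c} = {?c}" by auto
      then have "{b<..?c} \<subseteq> H'" using True by simp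
      then have "?c \<in> H" using less.prems by blast
      have e: "desc H = desc ?H @ [?c]" "desc H' = desc ?H' @ [?c]"
        using desc_min[of H ?c] desc_min[of H' ?c] True \<open>?c \<in> H\<close> less.prems Suc_leI by auto
      have IH: "desc ?H @ ?c # desc ?H' \<approx> desc ?H @ desc ?H' @ [?c]"
      proof (rule less.hyps)
        show "m - ?c < m - b" using True less.prems(1)[of ?c] by auto
        fix x assume *: "?c < x" "{?c<..x} \<subseteq> ?H'"
        have "{b<..x} \<subseteq> H'"
        proof
          fix z assume "z \<in> {b<..x}"
          then have "z = ?c \<or> z \<in> {?c<..x}" by auto
          then show "z \<in> H'" using * True by auto
        qed
        then show "x \<in> ?H" using less.prems(6)[of x] * by auto
      next
        show "\<And>x. x \<in> ?H' \<Longrightarrow> ?c < x" "\<And>x. x \<in> ?H \<Longrightarrow> ?c < x"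
          using less.prems by (force simp: Suc_lessI)+
      qed (use less.prems in auto)
      have far: "b # desc ?H' \<approx> desc ?H' @ [b]"
      proof (rule lpe_commute)
        fix x assume "x \<in> set (desc ?H')"
        then have "b < x" "x \<noteq> Suc b" using less.prems by auto
        then show "x + 2 \<le> b \<or> b + 2 \<le> x" by auto
      qed
      have "desc H @ b # desc H' = (desc ?H @ [?c]) @ (b # desc ?H') @ [?c]"
        by (simp add: e)
      also have "\<dots> \<approx> (desc ?H @ [?c]) @ (desc ?H' @ [b]) @ [?c]"
        by (intro lpe_context far)
      also have "\<dots> = [] @ (desc ?H @ ?c # desc ?H') @ [b, ?c]" by simp
      also have "\<dots> \<approx> [] @ (desc ?H @ desc ?H' @ [?c]) @ [b, ?c]"
        by (intro lpe_context IH)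
      also have "\<dots> \<approx> [] @ (desc ?H @ desc ?H' @ [?c]) @ [?c, b]"
        using lpe_knuth1[of "desc ?H @ desc ?H'" b "[]", THEN lpe_sym] by simp
      also have "\<dots> \<approx> [] @ (desc ?H @ ?c # desc ?H') @ [?c, b]"
        by (rule lpe_context[OF lpe_sym[OF IH]])
      finally show ?thesis by (simp add: e)
    qed
  qed
qed

text \<open>The switch \<open>p\<close> overrides whether \<open>b\<close> belongs to
  \<open>A\<close>, so that a diagonal before, during and after a conversion is written with one
  fixed set.\<close>

definition block :: "nat \<Rightarrow> nat set \<Rightarrow> bool \<Rightarrow> nat list" where
  "block b A p = desc {x\<in>A. b < x} @ (if p then [b] else []) @ desc {x\<in>A. x < b}"

lemma desc_eq_block: "finite A \<Longrightarrow> desc A = block b A (b \<in> A)"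
  using desc_split[of A b] by (simp add: block_def)

text \<open>The low part of the first word commutes with the high part of the second, since their
  letters differ by at least 2. After this exchange \<open>b\<close> first meets only high letters
  and then only low ones.\<close>

lemma block_move:
  assumes fin: "finite A" "finite A'"
    and below: "\<And>x. x < b \<Longrightarrow> {x..<b} \<subseteq> A \<Longrightarrow> x \<in> A'"
    and above: "\<And>x. b < x \<Longrightarrow> {b<..x} \<subseteq> A' \<Longrightarrow> x \<in> A"
  shows "block b A True @ block b A' False \<approx> block b A False @ block b A' True"
proof -
  define H where "H = {x\<in>A. b < x}"
  define H' where "H' = {x\<in>A'. b < x}"
  define L where "L = {x\<in>A. x < b}"
  define L' where "L' = {x\<in>A'. x < b}"
  note defs = H_def H'_def L_def L'_def
  have fin': "finite H" "finite H'" "finite L" "finite L'" using fin by (auto simp: defs)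
  have c: "desc L @ desc H' \<approx> desc H' @ desc L"
    by (rule lpe_commute_lists) (use fin' in \<open>auto simp: defs\<close>)
  have mb: "b # desc L @ desc L' \<approx> desc L @ b # desc L'"
  proof (rule lpe_move_below)
    fix x assume "x < b" "{x..<b} \<subseteq> L"
    then show "x \<in> L'" using below[of x] by (auto simp: defs)
  qed (use fin' in \<open>auto simp: defs\<close>)
  have ma: "desc H @ b # desc H' \<approx> desc H @ desc H' @ [b]"
  proof (rule lpe_move_above)
    fix x assume "b < x" "{b<..x} \<subseteq> H'"
    then show "x \<in> H" using above[of x] by (auto simp: defs)
  qed (use fin' in \<open>auto simp: defs\<close>)
  have "block b A True @ block b A' False = (desc H @ [b]) @ (desc L @ desc H') @ desc L'"
    by (simp add: block_def defs)
  also have "\<dots> \<approx> (desc H @ [b]) @ (desc H' @ desc L) @ desc L'"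
    by (rule lpe_context[OF c])
  also have "\<dots> = [] @ (desc H @ b # desc H') @ (desc L @ desc L')" by simp
  also have "\<dots> \<approx> [] @ (desc H @ desc H' @ [b]) @ (desc L @ desc L')"
    by (intro lpe_context ma)
  also have "\<dots> = (desc H @ desc H') @ (b # desc L @ desc L') @ []" by simp
  also have "\<dots> \<approx> (desc H @ desc H') @ (desc L @ b # desc L') @ []"
    by (intro lpe_context mb)
  also have "\<dots> = desc H @ (desc H' @ desc L) @ b # desc L'" by simp
  also have "\<dots> \<approx> desc H @ (desc L @ desc H') @ b # desc L'"
    by (rule lpe_context[OF lpe_sym[OF c]])
  finally show ?thesis by (simp add: block_def defs)
qed


lemma block_False_append:
  assumes "finite A" "\<And>x. Suc x = b \<Longrightarrow> x \<notin> A"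
  shows "block b A False @ [b] \<approx> block b A True"
proof -
  have "b # desc {x\<in>A. x < b} \<approx> desc {x\<in>A. x < b} @ [b]"
  proof (rule lpe_commute)
    fix y assume "y \<in> set (desc {x\<in>A. x < b})"
    then have "y \<in> A" "y < b" using assms by auto
    then show "y + 2 \<le> b \<or> b + 2 \<le> y" using assms(2)[of y] by (cases "Suc y = b") auto
  qed
  from lpe_context[OF this, of "desc {x\<in>A. b < x}" "[]", THEN lpe_sym]
  show ?thesis by (simp add: block_def)
qed

lemma block_False_Cons:
  assumes "finite A" "Suc b \<notin> A"
  shows "b # block b A False \<approx> block b A True"
proof -
  have "b # desc {x\<in>A. b < x} \<approx> desc {x\<in>A. b < x} @ [b]"
  proof (rule lpe_commute)
    fix y assume "y \<in> set (desc {x\<in>A. b < x})"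
    then have "y \<in> A" "b < y" using assms by auto
    then show "y + 2 \<le> b \<or> b + 2 \<le> y" using assms(2) by (cases "Suc b = y") auto
  qed
  from lpe_context[OF this, of "[]" "desc {x\<in>A. x < b}"]
  show ?thesis by (simp add: block_def)
qed

text \<open>The \<open>b\<close> inside the word acts as a catalyst: next to it, the second
  \<open>b\<close> passes \<open>b - 1\<close> and \<open>b + 1\<close> by the two Knuth relations.
  All other letters commute with \<open>b\<close>.\<close>

lemma block_True_commute:
  assumes "finite A"
  shows "block b A True @ [b] \<approx> b # block b A True"
proof -
  let ?H = "{x\<in>A. b < x}" and ?L = "{x\<in>A. x < b}"
  have 1: "b # desc ?L @ [b] \<approx> b # b # desc ?L"
  proof (cases "\<exists>x\<in>A. Suc x = b")
    case True
    then obtain x where x: "x \<in> A" "b = Suc x" by blast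
    have e: "desc ?L = x # desc (?L - {x})"
      by (rule desc_max) (use x assms in auto)
    have "b # desc (?L - {x}) \<approx> desc (?L - {x}) @ [b]"
      by (rule lpe_commute) (use x assms in auto)
    from lpe_context[OF this, of "[b, x]" "[]", THEN lpe_sym]
    have "b # desc ?L @ [b] \<approx> b # x # b # desc (?L - {x})" by (simp add: e)
    also have "\<dots> \<approx> b # b # x # desc (?L - {x})"
      using lpe_knuth1[of "[]" x "desc (?L - {x})", THEN lpe_sym] x by simp
    finally show ?thesis by (simp add: e)
  next
    case False
    have "b # desc ?L \<approx> desc ?L @ [b]"
    proof (rule lpe_commute)
      fix y assume "y \<in> set (desc ?L)"
      then have "y \<in> A" "y < b" using assms by auto
      then show "y + 2 \<le> b \<or> b + 2 \<le> y" using False by (cases "Suc y = b") auto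
    qed
    from lpe_context[OF this, of "[b]" "[]", THEN lpe_sym] show ?thesis by simp
  qed
  have 2: "desc ?H @ [b, b] \<approx> b # desc ?H @ [b]"
  proof (cases "Suc b \<in> A")
    case True
    let ?H' = "?H - {Suc b}"
    have e: "desc ?H = desc ?H' @ [Suc b]"
      by (rule desc_min) (use True assms in auto)
    have "b # desc ?H' \<approx> desc ?H' @ [b]"
    proof (rule lpe_commute)
      fix y assume "y \<in> set (desc ?H')"
      then have "b < y" "y \<noteq> Suc b" using assms by auto
      then show "y + 2 \<le> b \<or> b + 2 \<le> y" by auto
    qed
    from lpe_context[OF this, of "[]" "[Suc b, b]", THEN lpe_sym]
    have 3: "desc ?H' @ [b, Suc b, b] \<approx> b # desc ?H @ [b]" by (simp add: e)
    have "desc ?H @ [b, b] = desc ?H' @ [Suc b, b, b] @ []" by (simp add: e)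
    also have "\<dots> \<approx> desc ?H' @ [b, Suc b, b] @ []"
      by (rule lpe_knuth2)
    also have "\<dots> \<approx> b # desc ?H @ [b]" using 3 by simp
    finally show ?thesis .
  next
    case False
    have "b # desc ?H \<approx> desc ?H @ [b]"
    proof (rule lpe_commute)
      fix y assume "y \<in> set (desc ?H)"
      then have "y \<in> A" "b < y" using assms by auto
      then show "y + 2 \<le> b \<or> b + 2 \<le> y" using False by (cases "Suc b = y") auto
    qed
    from lpe_context[OF this, of "[]" "[b]", THEN lpe_sym] show ?thesis by simp
  qed
  have "block b A True @ [b] = desc ?H @ (b # desc ?L @ [b]) @ []" by (simp add: block_def)
  also have "\<dots> \<approx> desc ?H @ (b # b # desc ?L) @ []" by (rule lpe_context[OF 1])
  also have "\<dots> = [] @ (desc ?H @ [b, b]) @ desc ?L" by simp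
  also have "\<dots> \<approx> [] @ (b # desc ?H @ [b]) @ desc ?L" by (rule lpe_context[OF 2])
  finally show ?thesis by (simp add: block_def)
qed

text \<open>The entries \<open>b\<close> of a tableau before and after an elementary conversion, diagonal by diagonal:
  \<open>X\<close> and \<open>X'\<close> tell which diagonals contain \<open>b\<close>, \<open>K\<close> which diagonals meet the ribbon, \<open>R\<close> and \<open>U\<close>
  whether the ribbon continues from diagonal \<open>d\<close> to \<open>d + 1\<close> by a step to the right or upwards, and \<open>y\<close>
  whether the northeast end of the component meeting diagonal \<open>d\<close> contains \<open>b\<close>.\<close>

locale block_rotation =
  fixes b :: nat and lo hi :: int and A :: "int \<Rightarrow> nat set"
    and K R U X X' y :: "int \<Rightarrow> bool"
  assumes fin: "\<And>d. finite (A d)"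
    and K_range: "\<And>d. K d \<Longrightarrow> lo \<le> d \<and> d \<le> hi"
    and R_K: "\<And>d. R d \<Longrightarrow> K d \<and> K (d + 1)"
    and U_K: "\<And>d. U d \<Longrightarrow> K d \<and> K (d + 1)"
    and R_X: "\<And>d. R d \<Longrightarrow> X d \<and> X' (d + 1)"
    and U_X: "\<And>d. U d \<Longrightarrow> \<not> X d \<and> \<not> X' (d + 1)"
    and R_below: "\<And>d x. R d \<Longrightarrow> x < b \<Longrightarrow> {x..<b} \<subseteq> A d \<Longrightarrow> x \<in> A (d + 1)"
    and R_above: "\<And>d x. R d \<Longrightarrow> b < x \<Longrightarrow> {b<..x} \<subseteq> A (d + 1) \<Longrightarrow> x \<in> A d"
    and K_below: "\<And>d x. K d \<Longrightarrow> Suc x = b \<Longrightarrow> x \<in> A d \<Longrightarrow> R (d - 1)"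
    and K_above: "\<And>d. K d \<Longrightarrow> Suc b \<in> A d \<Longrightarrow> R d"
    and y_step: "\<And>d. R d \<or> U d \<Longrightarrow> y d = y (d + 1)"
    and y_end: "\<And>d. \<not> R d \<Longrightarrow> \<not> U d \<Longrightarrow> y d = X d \<and> X' (d + 1) = y (d + 1)"
begin

abbreviation word :: "(int \<Rightarrow> bool) \<Rightarrow> int \<Rightarrow> int \<Rightarrow> nat list" where
  "word f i j \<equiv> concat (map (\<lambda>d. block b (A d) (f d)) [i..j])"

lemma word_snoc: "i \<le> j \<Longrightarrow> word f i j = word f i (j - 1) @ block b (A j) (f j)"
  by (simp add: upto_rec2)

lemma word_Cons: "i \<le> j \<Longrightarrow> word f i j = block b (A i) (f i) @ word f (i + 1) j"
  by (simp add: upto_rec1)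

lemma R_move:
  "R d \<Longrightarrow> block b (A d) True @ block b (A (d + 1)) False
    \<approx> block b (A d) False @ block b (A (d + 1)) True"
  by (rule block_move) (use fin R_below R_above in auto)

text \<open>Only \<open>b - 1\<close> blocks the absorption of \<open>b\<close> from the right. If
  it is present, the ribbon enters \<open>d\<close> horizontally, and diagonal \<open>d - 1\<close>
  holds a \<open>b\<close> that \<open>R_move\<close> shifts into \<open>d\<close>. The free
  \<open>b\<close> then passes the completed word and is absorbed one diagonal further
  southwest.\<close>

lemma insert_left:
  "K d \<Longrightarrow> word X lo (d - 1) @ block b (A d) False @ [b] \<approx> word X lo (d - 1) @ block b (A d) True"
proof (induction "nat (d - lo)" arbitrary: d rule: less_induct)
  case less
  show ?case
  proof (cases "\<exists>x\<in>A d. Suc x = b")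
    case False
    then show ?thesis
      using lpe_append[OF lpe_refl block_False_append[OF fin]] by metis
  next
    case True
    then have R: "R (d - 1)" using K_below[OF less.prems] by blast
    then have K: "K (d - 1)" and "X (d - 1)" using R_K R_X by auto
    note bounds = K_range[OF K] K_range[OF less.prems]
    let ?u = "word X lo (d - 1 - 1)" and ?C = "block b (A (d - 1))" and ?D = "block b (A d)"
    have u: "word X lo (d - 1) = ?u @ ?C True"
      using word_snoc[of lo "d - 1" X] bounds \<open>X (d - 1)\<close> by simp
    have mv: "?C True @ ?D False \<approx> ?C False @ ?D True"
      using R_move[OF R] by simp
    have IH: "?u @ ?C False @ [b] \<approx> ?u @ ?C True"
      by (rule less.hyps) (use bounds K in auto)
    have "word X lo (d - 1) @ ?D False @ [b] = ?u @ (?C True @ ?D False) @ [b]"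
      by (simp add: u)
    also have "\<dots> \<approx> ?u @ (?C False @ ?D True) @ [b]"
      by (rule lpe_context[OF mv])
    also have "\<dots> = (?u @ ?C False) @ (?D True @ [b]) @ []" by simp
    also have "\<dots> \<approx> (?u @ ?C False) @ (b # ?D True) @ []"
      by (rule lpe_context[OF block_True_commute[OF fin]])
    also have "\<dots> = [] @ (?u @ ?C False @ [b]) @ ?D True" by simp
    also have "\<dots> \<approx> [] @ (?u @ ?C True) @ ?D True"
      by (rule lpe_context[OF IH])
    finally show ?thesis by (simp add: u)
  qed
qed

text \<open>Mirror image of \<open>insert_left\<close>: the obstruction is \<open>b + 1\<close>, and
  the letter is borrowed from diagonal \<open>d + 1\<close>, which is already new.\<close>

lemma insert_right:
  "K d \<Longrightarrow> b # block b (A d) False @ word X' (d + 1) hi \<approx> block b (A d) True @ word X' (d + 1) hi"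
proof (induction "nat (hi - d)" arbitrary: d rule: less_induct)
  case less
  show ?case
  proof (cases "Suc b \<in> A d")
    case False
    from lpe_append[OF block_False_Cons[OF fin this] lpe_refl] show ?thesis by simp
  next
    case True
    then have R: "R d" using K_above[OF less.prems] by blast
    then have K: "K (d + 1)" and "X' (d + 1)" using R_K R_X by auto
    note bounds = K_range[OF K] K_range[OF less.prems]
    let ?v = "word X' (d + 1 + 1) hi" and ?C = "block b (A (d + 1))" and ?D = "block b (A d)"
    have v: "word X' (d + 1) hi = ?C True @ ?v"
      using word_Cons[of "d + 1" hi X'] bounds \<open>X' (d + 1)\<close> by simp
    have mv: "?D True @ ?C False \<approx> ?D False @ ?C True"
      using R_move[OF R] by simp
    have IH: "b # ?C False @ ?v \<approx> ?C True @ ?v"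
      by (rule less.hyps) (use bounds K in auto)
    have "b # ?D False @ word X' (d + 1) hi = [b] @ (?D False @ ?C True) @ ?v"
      by (simp add: v)
    also have "\<dots> \<approx> [b] @ (?D True @ ?C False) @ ?v"
      by (rule lpe_context[OF lpe_sym[OF mv]])
    also have "\<dots> = [] @ (b # ?D True) @ (?C False @ ?v)" by simp
    also have "\<dots> \<approx> [] @ (?D True @ [b]) @ (?C False @ ?v)"
      by (rule lpe_context[OF lpe_sym[OF block_True_commute[OF fin]]])
    also have "\<dots> = ?D True @ (b # ?C False @ ?v) @ []" by simp
    also have "\<dots> \<approx> ?D True @ (?C True @ ?v) @ []"
      by (rule lpe_context[OF IH])
    finally show ?thesis by (simp add: v)
  qed
qed

text \<open>The word while the entry of the northeast end travels through its component to the southwest end: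
  diagonals before \<open>d\<close> are still old, those after \<open>d\<close> are already new.\<close>

abbreviation carry :: "int \<Rightarrow> nat list" where
  "carry d \<equiv> word X lo (d - 1) @ block b (A d) (y d) @ word X' (d + 1) hi"

lemma carry_step:
  assumes "lo \<le> d" "d < hi"
  shows "carry (d + 1) \<approx> carry d"
proof -
  let ?u = "word X lo (d - 1)" and ?v = "word X' (d + 1 + 1) hi"
  let ?C = "block b (A d)" and ?D = "block b (A (d + 1))"
  have l: "carry (d + 1) = ?u @ (?C (X d) @ ?D (y (d + 1))) @ ?v"
    using word_snoc[of lo d X] assms by simp
  have r: "carry d = ?u @ (?C (y d) @ ?D (X' (d + 1))) @ ?v"
    using word_Cons[of "d + 1" hi X'] assms by simp
  consider "R d" | "U d" "y d" "y (d + 1)" | "U d" "\<not> y d" "\<not> y (d + 1)" | "\<not> R d" "\<not> U d"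
    using y_step by blast
  then show ?thesis
  proof cases
    case 1
    then have "?C (X d) @ ?D (y (d + 1)) \<approx> ?C (y d) @ ?D (X' (d + 1))"
      using R_X[OF 1] y_step[of d] R_move[OF 1] by (cases "y d") auto
    then show ?thesis unfolding l r by (rule lpe_context)
  next
    \<comment> \<open>A vertical step gives no direct crossing: \<open>b\<close> is released in
      front of its word by \<open>insert_right\<close> read backwards and absorbed by the preceding
      word through \<open>insert_left\<close>.\<close>
    case 2
    then have K: "K d" "K (d + 1)" and X: "\<not> X d" "\<not> X' (d + 1)" using U_K U_X by auto
    have "carry (d + 1) = (?u @ ?C False) @ (?D True @ ?v) @ []"
      unfolding l using 2 X by simp
    also have "\<dots> \<approx> (?u @ ?C False) @ (b # ?D False @ ?v) @ []"
      by (rule lpe_context[OF lpe_sym[OF insert_right[OF K(2)]]])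
    also have "\<dots> = [] @ (?u @ ?C False @ [b]) @ (?D False @ ?v)" by simp
    also have "\<dots> \<approx> [] @ (?u @ ?C True) @ (?D False @ ?v)"
      by (rule lpe_context[OF insert_left[OF K(1)]])
    finally show ?thesis unfolding r using 2 X by simp
  next
    case 3
    then show ?thesis unfolding l r using U_X[of d] by simp
  next
    case 4
    then show ?thesis unfolding l r using y_end[of d] by simp
  qed
qed

lemma word_rotation:
  shows "word X lo hi \<approx> word X' lo hi"
proof (cases "lo \<le> hi")
  case True
  have "carry (lo + int n) \<approx> carry lo" if "lo + int n \<le> hi" for n
    using that
  proof (induction n)
    case (Suc n)
    have "carry (lo + int n + 1) \<approx> carry (lo + int n)"
      by (rule carry_step) (use Suc.prems in auto)
    also have "\<dots> \<approx> carry lo"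
      using Suc by simp
    finally show ?case by (simp add: ac_simps)
  qed simp
  from this[of "nat (hi - lo)"] True have "carry hi \<approx> carry lo" by simp
  \<comment> \<open>No ribbon crosses the borders, so the journey starts with the old entry of
    diagonal \<open>hi\<close> and ends with the new entry of diagonal \<open>lo\<close>.\<close>
  moreover have "\<not> R hi" "\<not> U hi" "\<not> R (lo - 1)" "\<not> U (lo - 1)"
    using R_K[of hi] U_K[of hi] R_K[of "lo - 1"] U_K[of "lo - 1"]
      K_range[of "hi + 1"] K_range[of "lo - 1"] by auto
  then have "y hi = X hi" "X' lo = y lo"
    using y_end[of hi] y_end[of "lo - 1"] by auto
  ultimately show ?thesis
    using word_snoc[of lo hi X] word_Cons[of lo hi X'] True by simp
qed simp

end


section \<open>Words of a shuffle closed set orthogonal to the ideal\<close>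

lemma word_monomial_times: "word_monomial u * word_monomial v = word_monomial (u @ v)"
  by (simp add: word_monomial_def mult_single plus_list_def)

lemma word_monomial_in_free_algebra: "w \<in> colored_words N \<Longrightarrow> word_monomial w \<in> free_algebra N"
  by (simp add: free_algebra_def word_monomial_def)

lemma alphabet_iff [simp]:
  "Unbarred x \<in> alphabet N \<longleftrightarrow> 1 \<le> x \<and> x \<le> N"
  "Barred x \<in> alphabet N \<longleftrightarrow> 1 \<le> x \<and> x \<le> N"
  by (auto simp: alphabet_def)

lemma lookup_word_monomial: "Poly_Mapping.lookup (word_monomial u) v = (if u = v then 1 else 0)"
  by (simp add: word_monomial_def lookup_single when_def)

lemma lookup_sum_word_monomial:
  "finite W \<Longrightarrow> Poly_Mapping.lookup (\<Sum>w\<in>W. word_monomial w) v = (if v \<in> W then 1 else 0)"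
  by (simp add: lookup_sum lookup_word_monomial)

text \<open>Orthogonality to a difference of two words thus means that both lie in \<open>W\<close>
  or neither does.\<close>

lemma pairing_sum_word_monomial:
  assumes "finite W"
  shows "pairing (\<Sum>w\<in>W. word_monomial w) (word_monomial u - word_monomial v)
    = (if u \<in> W then 1 else 0) - (if v \<in> W then 1 else 0)"
proof -
  let ?s = "\<Sum>w\<in>W. word_monomial w"
  have k: "Poly_Mapping.keys ?s = W"
    by (auto simp: in_keys_iff lookup_sum_word_monomial[OF assms] split: if_splits)
  have "pairing ?s (word_monomial u - word_monomial v)
      = (\<Sum>w\<in>W. (if u = w then 1 else 0) - (if v = w then 1 else 0))"
    unfolding pairing_def k
    by (rule sum.cong)
       (auto simp: lookup_sum_word_monomial[OF assms] lookup_minus lookup_word_monomial)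
  also have "\<dots> = (if u \<in> W then 1 else 0) - (if v \<in> W then 1 else 0)"
    using assms by (simp add: sum_subtractf)
  finally show ?thesis .
qed

text \<open>Two steps down from \<open>y\<close> in the natural order is \<open>y - 1\<close> with
  the same bar, and this letter exceeds \<open>x\<close> because of the distance 2.\<close>

lemma kron_generators_far:
  assumes "x + 2 \<le> y"
  shows "{Unbarred x, Unbarred y} \<subseteq> alphabet N \<Longrightarrow>
      word_monomial [Unbarred x, Unbarred y] - word_monomial [Unbarred y, Unbarred x] \<in> kron_generators N"
    and "{Barred x, Barred y} \<subseteq> alphabet N \<Longrightarrow>
      word_monomial [Barred x, Barred y] - word_monomial [Barred y, Barred x] \<in> kron_generators N"
proof -
  have *: "word_monomial [p, q] - word_monomial [q, p] \<in> kron_generators N"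
    if "q \<in> alphabet N" "Option.bind (down q) down = Some t" "lt (natural_order N) p t" for p q t
  proof -
    have "gen p * gen q - gen q * gen p \<in> kron_generators N"
      unfolding kron_generators_def using that by (intro UnI2) blast
    then show ?thesis by (simp add: gen_def word_monomial_times)
  qed
  show "word_monomial [Unbarred x, Unbarred y] - word_monomial [Unbarred y, Unbarred x] \<in> kron_generators N"
    if "{Unbarred x, Unbarred y} \<subseteq> alphabet N"
    by (rule *[of _ "Unbarred (y - 1)"])
       (use that assms in \<open>auto simp: lt_def natural_order_def\<close>)
  show "word_monomial [Barred x, Barred y] - word_monomial [Barred y, Barred x] \<in> kron_generators N"
    if "{Barred x, Barred y} \<subseteq> alphabet N"
    by (rule *[of _ "Barred (y - 1)"])
       (use that assms in \<open>auto simp: lt_def natural_order_def\<close>)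
qed

lemma kron_generators_unbarred:
  assumes "lt (natural_order N) x y"
  shows "is_unbarred y \<Longrightarrow> word_monomial [y, y, x] - word_monomial [y, x, y] \<in> kron_generators N"
    and "is_unbarred x \<Longrightarrow> word_monomial [y, x, x] - word_monomial [x, y, x] \<in> kron_generators N"
proof -
  assume "is_unbarred y"
  then have "gen y * gen y * gen x - gen y * gen x * gen y \<in> kron_generators N"
    unfolding kron_generators_def using assms by blast
  then show "word_monomial [y, y, x] - word_monomial [y, x, y] \<in> kron_generators N"
    by (simp add: gen_def word_monomial_times)
next
  assume "is_unbarred x"
  then have "gen y * gen x * gen x - gen x * gen y * gen x \<in> kron_generators N"
    unfolding kron_generators_def using assms by blast
  then show "word_monomial [y, x, x] - word_monomial [x, y, x] \<in> kron_generators N"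
    by (simp add: gen_def word_monomial_times)
qed

lemma kron_generators_barred:
  assumes "lt (natural_order N) x y"
  shows "is_barred y \<Longrightarrow> word_monomial [x, y, y] - word_monomial [y, x, y] \<in> kron_generators N"
    and "is_barred x \<Longrightarrow> word_monomial [x, x, y] - word_monomial [x, y, x] \<in> kron_generators N"
proof -
  assume "is_barred y"
  then have "gen x * gen y * gen y - gen y * gen x * gen y \<in> kron_generators N"
    unfolding kron_generators_def using assms by blast
  then show "word_monomial [x, y, y] - word_monomial [y, x, y] \<in> kron_generators N"
    by (simp add: gen_def word_monomial_times)
next
  assume "is_barred x"
  then have "gen x * gen x * gen y - gen x * gen y * gen x \<in> kron_generators N"
    unfolding kron_generators_def using assms by blast
  then show "word_monomial [x, x, y] - word_monomial [x, y, x] \<in> kron_generators N"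
    by (simp add: gen_def word_monomial_times)
qed

locale kron_set =
  fixes N :: nat and W :: "letter list set"
  assumes finite_W: "finite W" and W_words: "W \<subseteq> colored_words N"
    and closed: "shuffle_closed W"
    and orth: "(\<Sum>w\<in>W. word_monomial w) \<in> orth_compl N (I_kron N)"
begin

lemma generator_swap:
  assumes "set u \<subseteq> alphabet N \<Longrightarrow> word_monomial u - word_monomial v \<in> kron_generators N"
    and "set u = set v"
  shows "p @ u @ q \<in> W \<longleftrightarrow> p @ v @ q \<in> W"
proof (cases "p \<in> colored_words N \<and> q \<in> colored_words N \<and> set u \<subseteq> alphabet N")
  case True
  have "word_monomial p * (word_monomial u - word_monomial v) * word_monomial q \<in> I_kron N"
    unfolding I_kron_def
    using True assms by (intro two_sided_ideal.intros word_monomial_in_free_algebra) auto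
  then have "word_monomial (p @ u @ q) - word_monomial (p @ v @ q) \<in> I_kron N"
    by (simp add: algebra_simps word_monomial_times)
  then have "pairing (\<Sum>w\<in>W. word_monomial w)
      (word_monomial (p @ u @ q) - word_monomial (p @ v @ q)) = 0"
    using orth by (simp add: orth_compl_def)
  then show ?thesis
    by (simp add: pairing_sum_word_monomial[OF finite_W] split: if_splits)
next
  \<comment> \<open>A word with a letter outside the alphabet is not in \<open>W\<close>; this is
    why \<open>lpe\<close> can do without bounds on its letters.\<close>
  case False
  have "w \<notin> W" if "set w = set p \<union> set u \<union> set q" for w
    using W_words False that by (auto simp: colored_words_def)
  from this[of "p @ u @ q"] this[of "p @ v @ q"]
  have "p @ u @ q \<notin> W" "p @ v @ q \<notin> W" by (simp_all add: assms(2) Un_assoc)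
  then show ?thesis by simp
qed

lemma lt_natural_Suc:
  "{Unbarred x, Unbarred (Suc x)} \<subseteq> alphabet N \<Longrightarrow> lt (natural_order N) (Unbarred x) (Unbarred (Suc x))"
  "{Barred x, Barred (Suc x)} \<subseteq> alphabet N \<Longrightarrow> lt (natural_order N) (Barred x) (Barred (Suc x))"
  by (auto simp: lt_def natural_order_def)

lemma unbarred_swap:
  assumes "u \<approx> v"
  shows "p @ map Unbarred u @ q \<in> W \<longleftrightarrow> p @ map Unbarred v @ q \<in> W"
  using assms
proof (induction arbitrary: p q rule: lpe.induct)
  case (lpe_far x y u v)
  have "(p @ map Unbarred u) @ [Unbarred x, Unbarred y] @ map Unbarred v @ q \<in> W
    \<longleftrightarrow> (p @ map Unbarred u) @ [Unbarred y, Unbarred x] @ map Unbarred v @ q \<in> W"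
    by (rule generator_swap) (use kron_generators_far(1)[OF lpe_far] in auto)
  then show ?case by simp
next
  case (lpe_knuth1 u x v)
  have "(p @ map Unbarred u) @ [Unbarred (Suc x), Unbarred (Suc x), Unbarred x] @ map Unbarred v @ q \<in> W
    \<longleftrightarrow> (p @ map Unbarred u) @ [Unbarred (Suc x), Unbarred x, Unbarred (Suc x)] @ map Unbarred v @ q \<in> W"
    by (rule generator_swap) (use kron_generators_unbarred(1)[OF lt_natural_Suc(1)] in auto)
  then show ?case by simp
next
  case (lpe_knuth2 u x v)
  have "(p @ map Unbarred u) @ [Unbarred (Suc x), Unbarred x, Unbarred x] @ map Unbarred v @ q \<in> W
    \<longleftrightarrow> (p @ map Unbarred u) @ [Unbarred x, Unbarred (Suc x), Unbarred x] @ map Unbarred v @ q \<in> W"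
    by (rule generator_swap) (use kron_generators_unbarred(2)[OF lt_natural_Suc(1)] in auto)
  then show ?case by simp
qed auto

text \<open>The generators for barred letters are those for unbarred letters read from right to
  left, which the reversal compensates.\<close>

lemma barred_swap:
  assumes "u \<approx> v"
  shows "p @ map Barred (rev u) @ q \<in> W \<longleftrightarrow> p @ map Barred (rev v) @ q \<in> W"
  using assms
proof (induction arbitrary: p q rule: lpe.induct)
  case (lpe_far x y u v)
  have "(p @ map Barred (rev v)) @ [Barred x, Barred y] @ map Barred (rev u) @ q \<in> W
    \<longleftrightarrow> (p @ map Barred (rev v)) @ [Barred y, Barred x] @ map Barred (rev u) @ q \<in> W"
    by (rule generator_swap) (use kron_generators_far(2)[OF lpe_far] in auto)
  then show ?case by simp
next
  case (lpe_knuth1 u x v)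
  have "(p @ map Barred (rev v)) @ [Barred x, Barred (Suc x), Barred (Suc x)] @ map Barred (rev u) @ q \<in> W
    \<longleftrightarrow> (p @ map Barred (rev v)) @ [Barred (Suc x), Barred x, Barred (Suc x)] @ map Barred (rev u) @ q \<in> W"
    by (rule generator_swap) (use kron_generators_barred(1)[OF lt_natural_Suc(2)] in auto)
  then show ?case by simp
next
  case (lpe_knuth2 u x v)
  have "(p @ map Barred (rev v)) @ [Barred x, Barred x, Barred (Suc x)] @ map Barred (rev u) @ q \<in> W
    \<longleftrightarrow> (p @ map Barred (rev v)) @ [Barred x, Barred (Suc x), Barred x] @ map Barred (rev u) @ q \<in> W"
    by (rule generator_swap) (use kron_generators_barred(2)[OF lt_natural_Suc(2)] in auto)
  then show ?case by simp
qed auto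

lemma barred_past_unbarred:
  "\<forall>x\<in>set u. is_unbarred x \<Longrightarrow> p @ Barred a # u @ q \<in> W \<longleftrightarrow> p @ u @ Barred a # q \<in> W"
proof (induction u arbitrary: p)
  case (Cons x u)
  then obtain c where "x = Unbarred c" by (cases x) auto
  then have "p @ Barred a # (x # u) @ q \<in> W \<longleftrightarrow> (p @ [x]) @ Barred a # u @ q \<in> W"
    using closed unfolding shuffle_closed_def
    by (metis append_Cons append_Nil append_assoc)
  also have "\<dots> \<longleftrightarrow> (p @ [x]) @ u @ Barred a # q \<in> W"
    by (rule Cons.IH) (use Cons.prems in auto)
  finally show ?case by simp
qed simp

text \<open>Barred letters may drift to the right past unbarred ones, so membership in
  \<open>W\<close> is decided by the two subwords separately.\<close>

lemma mem_W_sorted: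
  "p @ w \<in> W \<longleftrightarrow> p @ filter is_unbarred w @ filter is_barred w \<in> W"
proof (induction w arbitrary: p)
  case (Cons x w)
  have "p @ x # w \<in> W \<longleftrightarrow> (p @ [x]) @ filter is_unbarred w @ filter is_barred w \<in> W"
    using Cons.IH[of "p @ [x]"] by simp
  then show ?case
    using barred_past_unbarred[of "filter is_unbarred w" p _ "filter is_barred w"]
    by (cases x) auto
qed simp

lemma mem_W_cong:
  assumes "filter is_unbarred w = map Unbarred u" "filter is_unbarred w' = map Unbarred u'" "u \<approx> u'"
    and "filter is_barred w = map Barred (rev v)" "filter is_barred w' = map Barred (rev v')" "v \<approx> v'"
  shows "w \<in> W \<longleftrightarrow> w' \<in> W"
  using mem_W_sorted[of "[]" w] mem_W_sorted[of "[]" w'] assms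
    unbarred_swap[OF assms(3), of "[]" "map Barred (rev v)"]
    barred_swap[OF assms(6), of "map Unbarred u'" "[]"]
  by simp

end


section \<open>Chains\<close>

text \<open>The chains of \<open>R\<close> are the components of a ribbon. Each element receives the mark of its
  predecessor, and the first element of a chain receives the mark of the last one.\<close>

definition rotated :: "'a rel \<Rightarrow> 'a set \<Rightarrow> 'a set \<Rightarrow> 'a set" where
  "rotated R S B = {c\<in>S. (\<exists>d\<in>B. (d, c) \<in> R) \<or>
     c \<notin> Range R \<and> (\<exists>e\<in>B. (c, e) \<in> R\<^sup>* \<and> e \<notin> Domain R)}"

lemma rotated_subset: "rotated R S B \<subseteq> S"
  by (auto simp: rotated_def)

text \<open>Since \<open>content\<close> is injective on \<open>S\<close> and rises by one along
  \<open>R\<close>, the relation \<open>R\<close> is a disjoint union of finite directed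
  paths.\<close>

locale chains =
  fixes S :: "'a set" and R :: "'a rel" and content :: "'a \<Rightarrow> int"
  assumes finite_S: "finite S" and inj_content: "inj_on content S"
    and R_in: "(c, d) \<in> R \<Longrightarrow> c \<in> S \<and> d \<in> S"
    and R_content: "(c, d) \<in> R \<Longrightarrow> content d = content c + 1"
begin

lemma rtrancl_in: "(c, c') \<in> R\<^sup>* \<Longrightarrow> c \<in> S \<Longrightarrow> c' \<in> S"
  by (induction rule: rtrancl_induct) (auto dest: R_in)

lemma rtrancl_in': "(c, c') \<in> R\<^sup>* \<Longrightarrow> c' \<in> S \<Longrightarrow> c \<in> S"
  by (induction rule: converse_rtrancl_induct) (auto dest: R_in)

lemma R_right_unique: "(c, d) \<in> R \<Longrightarrow> (c, d') \<in> R \<Longrightarrow> d = d'"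
  by (metis R_content R_in inj_content inj_onD)

lemma R_left_unique: "(c, d) \<in> R \<Longrightarrow> (c', d) \<in> R \<Longrightarrow> c = c'"
  by (metis R_content R_in add_right_cancel inj_content inj_onD)

lemma end_exists:
  assumes "c \<in> S"
  obtains e where "(c, e) \<in> R\<^sup>*" "e \<notin> Domain R" "e \<in> S"
proof -
  let ?R = "R\<^sup>* `` {c}"
  have sub: "?R \<subseteq> S" using assms rtrancl_in by auto
  then have fin: "finite ?R" using finite_S finite_subset by blast
  have "c \<in> ?R" by simp
  then have "Max (content ` ?R) \<in> content ` ?R" using fin by (intro Max_in) blast+
  then obtain e where "e \<in> ?R" "content e = Max (content ` ?R)"
    by (elim imageE) simp
  then have e: "e \<in> ?R" "\<forall>x\<in>?R. content x \<le> content e" using fin by simp_all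
  have "e \<notin> Domain R"
  proof
    assume "e \<in> Domain R"
    then obtain d where d: "(e, d) \<in> R" by blast
    then have "d \<in> ?R" using e(1) by (auto intro: rtrancl_into_rtrancl)
    then show False using e(2) R_content[OF d] by force
  qed
  then show ?thesis using that e(1) sub by blast
qed

lemma start_exists:
  assumes "c \<in> S"
  obtains p where "(p, c) \<in> R\<^sup>*" "p \<notin> Range R" "p \<in> S"
proof -
  let ?R = "{p. (p, c) \<in> R\<^sup>*}"
  have sub: "?R \<subseteq> S" using assms rtrancl_in' by auto
  then have fin: "finite ?R" using finite_S finite_subset by blast
  have "c \<in> ?R" by simp
  then have "Min (content ` ?R) \<in> content ` ?R" using fin by (intro Min_in) blast+
  then obtain e where "e \<in> ?R" "content e = Min (content ` ?R)"
    by (elim imageE) simp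
  then have e: "e \<in> ?R" "\<forall>x\<in>?R. content e \<le> content x" using fin by simp_all
  have "e \<notin> Range R"
  proof
    assume "e \<in> Range R"
    then obtain d where d: "(d, e) \<in> R" by blast
    then have "d \<in> ?R" using e(1) by (auto intro: converse_rtrancl_into_rtrancl)
    then show False using e(2) R_content[OF d] by force
  qed
  then show ?thesis using that e(1) sub by blast
qed

lemma end_unique:
  assumes "(c, e) \<in> R\<^sup>*" "(c, e') \<in> R\<^sup>*" "e \<notin> Domain R" "e' \<notin> Domain R"
  shows "e = e'"
proof -
  have "single_valued R" using R_right_unique by (auto simp: single_valued_def)
  then have "(e, e') \<in> R\<^sup>* \<or> (e', e) \<in> R\<^sup>*"
    using assms single_valued_confluent by metis
  then show ?thesis using assms by (metis Domain.DomainI converse_rtranclE)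
qed

lemma rotated_step: "(c, d) \<in> R \<Longrightarrow> d \<in> rotated R S B \<longleftrightarrow> c \<in> B"
  using R_left_unique R_in by (auto simp: rotated_def)

lemma rotated_start:
  assumes "p \<in> S" "p \<notin> Range R" "(p, e) \<in> R\<^sup>*" "e \<notin> Domain R"
  shows "p \<in> rotated R S B \<longleftrightarrow> e \<in> B"
  unfolding rotated_def using assms end_unique[OF assms(3) _ assms(4)] by blast

text \<open>The marks can be read off again: an element with a successor had the mark now on that
  successor, and the last element of a chain had the mark now on the first.\<close>

lemma rotated_inj:
  assumes "B \<subseteq> S" "B' \<subseteq> S" "rotated R S B = rotated R S B'"
  shows "B = B'"
proof -
  have "c \<in> B \<longleftrightarrow> c \<in> B'" if "c \<in> S" for c
  proof (cases "c \<in> Domain R")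
    case True
    then show ?thesis using rotated_step assms(3) by blast
  next
    case False
    obtain p where "(p, c) \<in> R\<^sup>*" "p \<notin> Range R" "p \<in> S"
      using start_exists[OF \<open>c \<in> S\<close>] .
    then show ?thesis
      using rotated_start[of p c B] rotated_start[of p c B'] False assms(3) by blast
  qed
  then show ?thesis using assms by blast
qed

text \<open>An undirected walk from a starting point cannot leave its directed path, because
  predecessors are unique. Hence connected components are directed paths.\<close>

lemma chain_from_start:
  assumes "p \<notin> Range R" "(p, c) \<in> (R \<union> R\<inverse>)\<^sup>*"
  shows "(p, c) \<in> R\<^sup>*"
  using assms(2)
proof (induction rule: rtrancl_induct)
  case (step c d)
  then consider "(c, d) \<in> R" | "(d, c) \<in> R" by auto
  then show ?case
  proof cases
    case 1
    then show ?thesis using step.IH by (auto intro: rtrancl_into_rtrancl)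
  next
    case 2
    then have "c \<noteq> p" using assms(1) by auto
    then obtain d' where "(p, d') \<in> R\<^sup>*" "(d', c) \<in> R"
      using step.IH by (auto elim: rtranclE)
    then show ?thesis using R_left_unique[OF 2] by metis
  qed
qed simp

lemma rtrancl_sym_closure:
  "(c, d) \<in> R\<^sup>* \<Longrightarrow> (c, d) \<in> (R \<union> R\<inverse>)\<^sup>*
    \<and> (d, c) \<in> (R \<union> R\<inverse>)\<^sup>*"
proof (induction rule: rtrancl_induct)
  case (step y z)
  have "(y, z) \<in> R \<union> R\<inverse>" "(z, y) \<in> R \<union> R\<inverse>" using step(2) by auto
  then show ?case using step.IH
    by (meson converse_rtrancl_into_rtrancl rtrancl.rtrancl_into_rtrancl)
qed simp

lemma quotient_sym_closure:
  "S // {(c, d). c \<in> S \<and> d \<in> S \<and> (c, d) \<in> (R \<union> R\<inverse>)\<^sup>*} = {R\<^sup>* `` {p} | p. p \<in> S \<and> p \<notin> Range R}"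
proof -
  let ?adj = "(R \<union> R\<inverse>)"
  let ?Q = "S // {(c, d). c \<in> S \<and> d \<in> S \<and> (c, d) \<in> ?adj\<^sup>*}"
  have cls: "{d. d \<in> S \<and> (c, d) \<in> ?adj\<^sup>*} = R\<^sup>* `` {p}"
    if "(p, c) \<in> R\<^sup>*" "p \<notin> Range R" "p \<in> S" for p c
  proof (intro subset_antisym subsetI)
    fix d assume "d \<in> {d. d \<in> S \<and> (c, d) \<in> ?adj\<^sup>*}"
    then have "(p, d) \<in> ?adj\<^sup>*" using rtrancl_sym_closure[OF that(1)] by (auto intro: rtrancl_trans)
    then show "d \<in> R\<^sup>* `` {p}" using chain_from_start[OF that(2)] by simp
  next
    fix d assume "d \<in> R\<^sup>* `` {p}"
    then have "(p, d) \<in> ?adj\<^sup>*" "d \<in> S" using rtrancl_sym_closure that(3) rtrancl_in by auto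
    then show "d \<in> {d. d \<in> S \<and> (c, d) \<in> ?adj\<^sup>*}"
      using rtrancl_sym_closure[OF that(1)] by (auto intro: rtrancl_trans)
  qed
  have comp: "?Q = (\<lambda>c. {d. d \<in> S \<and> (c, d) \<in> ?adj\<^sup>*}) ` S"
    unfolding quotient_def by auto
  show ?thesis
  proof (intro subset_antisym subsetI)
    fix C assume "C \<in> ?Q"
    then obtain c where c: "c \<in> S" "C = {d. d \<in> S \<and> (c, d) \<in> ?adj\<^sup>*}" unfolding comp by auto
    obtain p where "(p, c) \<in> R\<^sup>*" "p \<notin> Range R" "p \<in> S"
      using start_exists[OF c(1)] .
    then show "C \<in> {R\<^sup>* `` {p} | p. p \<in> S \<and> p \<notin> Range R}"
      using cls c(2) by blast
  next
    fix C assume "C \<in> {R\<^sup>* `` {p} | p. p \<in> S \<and> p \<notin> Range R}"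
    then obtain p where "C = R\<^sup>* `` {p}" "p \<in> S" "p \<notin> Range R" by blast
    then show "C \<in> ?Q" unfolding comp using cls[of p p] by auto
  qed
qed

text \<open>Shifting along \<open>R\<close> is a bijection from the chain without its last element
  onto the chain without its first, so the two multisets can differ only in \<open>T' p\<close> and
  \<open>T e\<close>.\<close>

lemma component_mset:
  assumes p: "p \<in> S" "p \<notin> Range R" "(p, e) \<in> R\<^sup>*" "e \<notin> Domain R"
    and step: "\<And>c d. (c, d) \<in> R \<Longrightarrow> T' d = T c"
  shows "image_mset T' (mset_set (R\<^sup>* `` {p})) = image_mset T (mset_set (R\<^sup>* `` {p}))
    \<longleftrightarrow> T' p = T e"
proof -
  let ?C = "R\<^sup>* `` {p}"
  define f where "f c = (THE d. (c, d) \<in> R)" for c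
  have f: "f c = d" if "(c, d) \<in> R" for c d
    unfolding f_def using that R_right_unique by blast
  have ex: "\<exists>d. (c, d) \<in> R" if "c \<in> ?C - {e}" for c
  proof (rule ccontr)
    assume "\<nexists>d. (c, d) \<in> R"
    then have "c \<notin> Domain R" by auto
    then show False using end_unique[of p c e] that p by auto
  qed
  have fin: "finite ?C"
    using finite_S rtrancl_in[of p] p(1) by (auto intro: finite_subset)
  have img: "f ` (?C - {e}) = ?C - {p}"
  proof (intro subset_antisym subsetI)
    fix d assume "d \<in> f ` (?C - {e})"
    then obtain c where c: "c \<in> ?C - {e}" "d = f c" by blast
    then have "(c, d) \<in> R" using ex f by metis
    then show "d \<in> ?C - {p}" using c p by (auto intro: rtrancl_into_rtrancl)
  next
    fix d assume "d \<in> ?C - {p}"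
    then obtain c where c: "(p, c) \<in> R\<^sup>*" "(c, d) \<in> R" by (auto elim: rtranclE)
    then show "d \<in> f ` (?C - {e})" using f[OF c(2)] p(4) by (auto intro!: image_eqI[of d f c])
  qed
  have inj: "inj_on f (?C - {e})"
  proof (rule inj_onI)
    fix c d assume "c \<in> ?C - {e}" "d \<in> ?C - {e}" "f c = f d"
    then show "c = d" using ex[of c] ex[of d] f R_left_unique by metis
  qed
  have "image_mset T' (mset_set (?C - {p})) = image_mset T' (image_mset f (mset_set (?C - {e})))"
    using image_mset_mset_set[OF inj] img by simp
  also have "\<dots> = image_mset T (mset_set (?C - {e}))"
    unfolding multiset.map_comp
    by (rule image_mset_cong) (use ex f step fin in \<open>force\<close>)
  finally have *: "image_mset T' (mset_set (?C - {p})) = image_mset T (mset_set (?C - {e}))" .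
  have "mset_set ?C = add_mset p (mset_set (?C - {p}))"
    by (rule mset_set.remove[OF fin]) simp
  moreover have "mset_set ?C = add_mset e (mset_set (?C - {e}))"
    by (rule mset_set.remove[OF fin]) (use p(3) in simp)
  ultimately have "image_mset T' (mset_set ?C) = add_mset (T' p) (image_mset T' (mset_set (?C - {p})))"
    "image_mset T (mset_set ?C) = add_mset (T e) (image_mset T (mset_set (?C - {e})))"
    by (metis image_mset_add_mset)+
  then show ?thesis using * by simp
qed

end

definition content :: "box \<Rightarrow> int" where
  "content c = int (snd c) - int (fst c)"

text \<open>The step of a ribbon towards the northeast.\<close>

definition nx :: "box set \<Rightarrow> box rel" where
  "nx S = {(c, c'). c \<in> S \<and> c' \<in> S \<and>
     (fst c' = fst c \<and> snd c' = Suc (snd c) \<or> snd c' = snd c \<and> fst c = Suc (fst c'))}"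

lemma nx_content: "(c, c') \<in> nx S \<Longrightarrow> content c' = content c + 1"
  by (auto simp: nx_def content_def)

lemma nx_in: "(c, c') \<in> nx S \<Longrightarrow> c \<in> S \<and> c' \<in> S"
  by (auto simp: nx_def)

lemma box_adjacent_eq_nx:
  "{(c, d). c \<in> S \<and> d \<in> S \<and> box_adjacent c d} = nx S \<union> (nx S)\<inverse>"
  by (auto simp: nx_def)


section \<open>Elementary conversions\<close>

lemma mset_set_image_eq:
  assumes "finite C" "image_mset f (mset_set C) = image_mset g (mset_set C)"
  shows "f ` C = g ` C"
  using arg_cong[OF assms(2), of set_mset] assms(1) by simp

lemma nx_cases [consumes 1, case_names right up]:
  assumes "(c, d) \<in> nx S"
  obtains i j where "c = (i, j)" "d = (i, Suc j)" | i j where "c = (Suc i, j)" "d = (i, j)"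
proof -
  obtain i j k l where cd: "c = (i, j)" "d = (k, l)" by (cases c; cases d)
  then have "k = i \<and> l = Suc j \<or> l = j \<and> i = Suc k" using assms by (simp add: nx_def)
  then show ?thesis using cd that by blast
qed

definition downset :: "box set \<Rightarrow> bool" where
  "downset Y \<longleftrightarrow> finite Y \<and> (\<forall>i j i' j'. (i, j) \<in> Y \<longrightarrow> i' \<le> i \<longrightarrow> j' \<le> j \<longrightarrow> (i', j') \<in> Y)"

text \<open>The conditions of \<open>CT\<close> on an arbitrary set of boxes; transposition then is
  an image under \<open>prod.swap\<close>, and no partition has to be conjugated.\<close>

definition tableau :: "nat \<Rightarrow> box set \<Rightarrow> letter rel \<Rightarrow> filling \<Rightarrow> bool" where
  "tableau N Y r T \<longleftrightarrow> (\<forall>c\<in>Y. T c \<in> alphabet N) \<and>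
     (\<forall>i j k. j < k \<longrightarrow> (i, j) \<in> Y \<longrightarrow> (i, k) \<in> Y \<longrightarrow>
        (T (i, j), T (i, k)) \<in> r \<and> (is_barred (T (i, j)) \<longrightarrow> T (i, j) \<noteq> T (i, k))) \<and>
     (\<forall>i k j. i < k \<longrightarrow> (i, j) \<in> Y \<longrightarrow> (k, j) \<in> Y \<longrightarrow>
        (T (i, j), T (k, j)) \<in> r \<and> (is_unbarred (T (i, j)) \<longrightarrow> T (i, j) \<noteq> T (k, j)))"

lemma CT_iff: "T \<in> CT N r \<nu> \<longleftrightarrow> T \<in> extensional (young_diagram \<nu>) \<and> tableau N (young_diagram \<nu>) r T"
  unfolding CT_def tableau_def PiE_def Pi_def by blast

definition mixed :: "box set \<Rightarrow> nat \<Rightarrow> nat \<Rightarrow> filling \<Rightarrow> box set" where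
  "mixed Y b a T = {c\<in>Y. T c = Unbarred b \<or> T c = Barred a}"

definition ubox :: "box set \<Rightarrow> nat \<Rightarrow> filling \<Rightarrow> box set" where
  "ubox Y b T = {c\<in>Y. T c = Unbarred b}"

text \<open>Closed form of the conversion that moves \<open>b\<close> up past \<open>a\<close>
  (barred); \<open>refilling_iff\<close> shows that it is the only admissible refilling.\<close>

definition rot :: "box set \<Rightarrow> nat \<Rightarrow> nat \<Rightarrow> filling \<Rightarrow> filling" where
  "rot Y b a T = (let S = mixed Y b a T; B = rotated (nx S) S (ubox Y b T) in
     (\<lambda>c. if c \<in> B then Unbarred b else if c \<in> S then Barred a else T c))"

lemma shuffle_order_linear:
  assumes "shuffle_order N r"
  shows "(x, y) \<in> r \<Longrightarrow> x \<in> alphabet N \<and> y \<in> alphabet N"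
    and "x \<in> alphabet N \<Longrightarrow> (x, x) \<in> r"
    and "(x, y) \<in> r \<Longrightarrow> (y, z) \<in> r \<Longrightarrow> (x, z) \<in> r"
    and "(x, y) \<in> r \<Longrightarrow> (y, x) \<in> r \<Longrightarrow> x = y"
    and "x \<in> alphabet N \<Longrightarrow> y \<in> alphabet N \<Longrightarrow> (x, y) \<in> r \<or> (y, x) \<in> r"
proof -
  have l: "linear_order_on (alphabet N) r" using assms by (simp add: shuffle_order_def)
  then have r: "refl_on (alphabet N) r" "trans r" "antisym r" "total_on (alphabet N) r"
      "r \<subseteq> alphabet N \<times> alphabet N"
    by (auto simp: linear_order_on_def partial_order_on_def preorder_on_def)
  show "(x, y) \<in> r \<Longrightarrow> x \<in> alphabet N \<and> y \<in> alphabet N" using r(5) by blast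
  show refl: "x \<in> alphabet N \<Longrightarrow> (x, x) \<in> r" using r(1) by (simp add: refl_on_def)
  show "(x, y) \<in> r \<Longrightarrow> (y, z) \<in> r \<Longrightarrow> (x, z) \<in> r" using r(2) by (rule transD)
  show "(x, y) \<in> r \<Longrightarrow> (y, x) \<in> r \<Longrightarrow> x = y" using r(3) by (rule antisymD)
  show "x \<in> alphabet N \<Longrightarrow> y \<in> alphabet N \<Longrightarrow> (x, y) \<in> r \<or> (y, x) \<in> r"
    using r(4) refl by (cases "x = y") (auto simp: total_on_def)
qed

lemma shuffle_orderI:
  assumes "\<And>x y. (x, y) \<in> r \<Longrightarrow> x \<in> alphabet N \<and> y \<in> alphabet N"
    and "\<And>x. x \<in> alphabet N \<Longrightarrow> (x, x) \<in> r"
    and "\<And>x y z. (x, y) \<in> r \<Longrightarrow> (y, z) \<in> r \<Longrightarrow> (x, z) \<in> r"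
    and "\<And>x y. (x, y) \<in> r \<Longrightarrow> (y, x) \<in> r \<Longrightarrow> x = y"
    and "\<And>x y. x \<in> alphabet N \<Longrightarrow> y \<in> alphabet N \<Longrightarrow> (x, y) \<in> r \<or> (y, x) \<in> r"
    and "\<And>x y. x < y \<Longrightarrow> 1 \<le> x \<Longrightarrow> y \<le> N \<Longrightarrow> (Unbarred x, Unbarred y) \<in> r \<and> (Barred x, Barred y) \<in> r"
  shows "shuffle_order N r"
proof -
  have "refl_on (alphabet N) r" "trans r" "antisym r" "total_on (alphabet N) r"
      "r \<subseteq> alphabet N \<times> alphabet N"
    using assms(1,2,5) by (auto simp: refl_on_def total_on_def intro: transI antisymI assms(3,4))
  then show ?thesis
    using assms(6) by (auto simp: shuffle_order_def linear_order_on_def partial_order_on_def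
        preorder_on_def lt_def)
qed

lemma shuffle_order_letters:
  assumes "shuffle_order N r" "x < y" "1 \<le> x" "y \<le> N"
  shows "(Unbarred x, Unbarred y) \<in> r" "(Barred x, Barred y) \<in> r"
  using assms by (auto simp: shuffle_order_def lt_def)

lemma tableau_mono:
  assumes "shuffle_order N r" "tableau N Y r T" "downset Y" "(i, j) \<in> Y" "(k, l) \<in> Y" "i \<le> k" "j \<le> l"
  shows "(T (i, j), T (k, l)) \<in> r"
proof -
  have il: "(i, l) \<in> Y" using assms unfolding downset_def by blast
  have "(T (i, j), T (i, l)) \<in> r"
  proof (cases "j = l")
    case True
    then show ?thesis using assms shuffle_order_linear(2)[OF assms(1)] by (auto simp: tableau_def)
  next
    case False
    then have "j < l" using assms by simp
    then show ?thesis using assms(2,4) il unfolding tableau_def by blast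
  qed
  moreover have "(T (i, l), T (k, l)) \<in> r"
  proof (cases "i = k")
    case True
    then show ?thesis using assms shuffle_order_linear(2)[OF assms(1)] by (auto simp: tableau_def)
  next
    case False
    then have "i < k" using assms by simp
    then show ?thesis using assms(2,5) il unfolding tableau_def by blast
  qed
  ultimately show ?thesis using shuffle_order_linear(3)[OF assms(1)] by blast
qed

lemma tableau_row:
  "tableau N Y r T \<Longrightarrow> j < k \<Longrightarrow> (i, j) \<in> Y \<Longrightarrow> (i, k) \<in> Y \<Longrightarrow> is_barred (T (i, j)) \<Longrightarrow> T (i, j) \<noteq> T (i, k)"
  unfolding tableau_def by blast

lemma tableau_col:
  "tableau N Y r T \<Longrightarrow> i < k \<Longrightarrow> (i, j) \<in> Y \<Longrightarrow> (k, j) \<in> Y \<Longrightarrow> is_unbarred (T (i, j)) \<Longrightarrow> T (i, j) \<noteq> T (k, j)"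
  unfolding tableau_def by blast

lemma tableau_alphabet: "tableau N Y r T \<Longrightarrow> c \<in> Y \<Longrightarrow> T c \<in> alphabet N"
  unfolding tableau_def by blast

section \<open>The ribbon of two consecutive letters and its rotation\<close>

locale letter_pair =
  fixes N :: nat and r s :: "letter rel" and b a :: nat
  assumes swap_up: "swap_up N b a r s"
begin

lemma orders: "shuffle_order N r" "shuffle_order N s"
  using swap_up by (auto simp: swap_up_def)

lemma UV: "(Unbarred b, Barred a) \<in> r" "(Barred a, Unbarred b) \<in> s"
  "(Barred a, Unbarred b) \<notin> r" "(Unbarred b, Barred a) \<notin> s"
proof -
  show "(Unbarred b, Barred a) \<in> r" "(Barred a, Unbarred b) \<in> s" "(Unbarred b, Barred a) \<notin> s"
    using swap_up by (auto simp: swap_up_def lt_def)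
  then show "(Barred a, Unbarred b) \<notin> r" using shuffle_order_linear(4)[OF orders(1)] by blast
qed

lemma UV_alphabet: "Unbarred b \<in> alphabet N" "Barred a \<in> alphabet N"
  using UV(1) shuffle_order_linear(1)[OF orders(1)] by blast+

lemma s_iff_r:
  "(x, y) \<noteq> (Unbarred b, Barred a) \<Longrightarrow> (x, y) \<noteq> (Barred a, Unbarred b) \<Longrightarrow> (x, y) \<in> s \<longleftrightarrow> (x, y) \<in> r"
  using swap_up by (auto simp: swap_up_def)

lemma between_r: "(Unbarred b, x) \<in> r \<Longrightarrow> (x, Barred a) \<in> r \<Longrightarrow> x = Unbarred b \<or> x = Barred a"
  using swap_up by (auto simp: swap_up_def lt_def)

text \<open>Consecutive letters compare alike with any third letter, so a swap affects only
  comparisons inside the ribbon.\<close>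

lemma r_iff:
  assumes "x \<noteq> Unbarred b" "x \<noteq> Barred a"
  shows "(x, Unbarred b) \<in> r \<longleftrightarrow> (x, Barred a) \<in> r" "(Unbarred b, x) \<in> r \<longleftrightarrow> (Barred a, x) \<in> r"
  using assms between_r[of x] UV(1) UV_alphabet shuffle_order_linear(1,3,5)[OF orders(1)] by metis+

lemma between_s: "(Barred a, x) \<in> s \<Longrightarrow> (x, Unbarred b) \<in> s \<Longrightarrow> x = Unbarred b \<or> x = Barred a"
  using r_iff[of x] s_iff_r between_r by (metis letter.distinct(1) prod.inject)

lemma mixed_range:
  assumes "z \<in> {Unbarred b, Barred a}" "w \<in> {Unbarred b, Barred a}" "(z, x) \<in> r" "(x, w) \<in> r"
  shows "x \<in> {Unbarred b, Barred a}"
proof (rule ccontr)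
  assume "x \<notin> {Unbarred b, Barred a}"
  then have "(Unbarred b, x) \<in> r" "(x, Barred a) \<in> r" using assms r_iff[of x] by auto
  then show False using between_r[of x] \<open>x \<notin> _\<close> by simp
qed

text \<open>In \<open>s\<close> the barred letter comes first and may not repeat in a row. Together
  with \<open>tableau_s_up\<close>, \<open>T_right\<close> and \<open>T_up\<close> this shows that
  every step of the ribbon copies the old entry of its first box into its second.\<close>

lemma tableau_s_right:
  assumes "downset Y" "tableau N Y s T" "(i, j) \<in> mixed Y b a T" "(i, Suc j) \<in> mixed Y b a T"
  shows "T (i, Suc j) = Unbarred b"
  using tableau_row[OF assms(2), of j "Suc j" i] tableau_mono[OF orders(2) assms(2,1), of i j i "Suc j"]
    assms(3,4) UV(4) by (auto simp: mixed_def)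

lemma tableau_s_up:
  assumes "downset Y" "tableau N Y s T" "(i, j) \<in> mixed Y b a T" "(Suc i, j) \<in> mixed Y b a T"
  shows "T (i, j) = Barred a"
  using tableau_col[OF assms(2), of i "Suc i" j] tableau_mono[OF orders(2) assms(2,1), of i j "Suc i" j]
    assms(3,4) UV(4) by (auto simp: mixed_def)

context
  fixes Y T
  assumes Y: "downset Y" and T: "tableau N Y r T"
begin

abbreviation S where "S \<equiv> mixed Y b a T"

lemma S_values: "c \<in> S \<Longrightarrow> T c \<in> {Unbarred b, Barred a}"
  by (auto simp: mixed_def)

lemma S_Y: "c \<in> S \<Longrightarrow> c \<in> Y"
  by (auto simp: mixed_def)

lemma S_convex:
  assumes "(i, j) \<in> S" "(i', j') \<in> S" "i \<le> k" "k \<le> i'" "j \<le> l" "l \<le> j'"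
  shows "(k, l) \<in> S"
proof -
  have kl: "(k, l) \<in> Y" using S_Y[OF assms(2)] assms Y unfolding downset_def by blast
  have "(T (i, j), T (k, l)) \<in> r" "(T (k, l), T (i', j')) \<in> r"
    using tableau_mono[OF orders(1) T Y] S_Y assms kl by auto
  then show ?thesis using mixed_range[OF S_values[OF assms(1)] S_values[OF assms(2)]] kl
    by (auto simp: mixed_def)
qed

lemma T_right: "(i, j) \<in> S \<Longrightarrow> (i, Suc j) \<in> S \<Longrightarrow> T (i, j) = Unbarred b"
  using tableau_row[OF T, of j "Suc j" i] tableau_mono[OF orders(1) T Y, of i j i "Suc j"] UV(3)
  by (auto simp: mixed_def)

lemma T_up: "(i, j) \<in> S \<Longrightarrow> (Suc i, j) \<in> S \<Longrightarrow> T (Suc i, j) = Barred a"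
  using tableau_col[OF T, of i "Suc i" j] tableau_mono[OF orders(1) T Y, of i j "Suc i" j] UV(3)
  by (auto simp: mixed_def)

text \<open>The lower left box of a square would contain \<open>b\<close> because of its right
  neighbour and be barred because of its upper neighbour.\<close>

lemma no_square: "(i, j) \<in> S \<Longrightarrow> (Suc i, Suc j) \<in> S \<Longrightarrow> False"
  using S_convex[of i j "Suc i" "Suc j" "Suc i" j] S_convex[of i j "Suc i" "Suc j" i "Suc j"]
    T_right[of "Suc i" j] T_up[of i j] by auto

lemma S_inj_content: "inj_on content S"
proof (rule inj_onI)
  have *: "i = i'" if "(i, j) \<in> S" "(i', j') \<in> S" "content (i, j) = content (i', j')" "i \<le> i'" for i j i' j'
  proof (rule ccontr)
    assume "i \<noteq> i'"
    then have "Suc i \<le> i'" "Suc j \<le> j'" using that by (auto simp: content_def)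
    then show False using no_square[of i j] S_convex[OF that(1,2), of "Suc i" "Suc j"] that by auto
  qed
  fix c d assume "c \<in> S" "d \<in> S" "content c = content d"
  then show "c = d" using *[of "fst c" "snd c" "fst d" "snd d"] *[of "fst d" "snd d" "fst c" "snd c"]
    by (cases c; cases d; cases "fst c \<le> fst d") (auto simp: content_def)
qed

lemma S_chains: "chains S (nx S) content"
proof
  show "finite S" using Y by (auto simp: mixed_def downset_def)
qed (use S_inj_content nx_in nx_content in auto)

interpretation chains S "nx S" content by (rule S_chains)

lemma rot_S: "c \<in> S \<Longrightarrow> rot Y b a T c = (if c \<in> rotated (nx S) S (ubox Y b T) then Unbarred b else Barred a)"
  by (simp add: rot_def Let_def)

lemma rot_off: "c \<notin> S \<Longrightarrow> rot Y b a T c = T c"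
  using subsetD[OF rotated_subset, of c "nx S" S "ubox Y b T"] by (auto simp: rot_def Let_def)

lemma ubox_iff: "c \<in> S \<Longrightarrow> c \<in> ubox Y b T \<longleftrightarrow> T c = Unbarred b"
  by (simp add: ubox_def mixed_def)

lemma rot_step:
  assumes "(c, d) \<in> nx S"
  shows "rot Y b a T d = T c"
proof -
  have cd: "c \<in> S" "d \<in> S" using nx_in[OF assms] by auto
  show ?thesis
    unfolding rot_S[OF cd(2)] rotated_step[OF assms] ubox_iff[OF cd(1)]
    using S_values[OF cd(1)] by auto
qed

lemma rot_start:
  assumes "p \<in> S" "p \<notin> Range (nx S)" "(p, e) \<in> (nx S)\<^sup>*" "e \<notin> Domain (nx S)"
  shows "rot Y b a T p = T e"
  unfolding rot_S[OF assms(1)] rotated_start[OF assms] ubox_iff[OF rtrancl_in[OF assms(3,1)]]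
  using S_values[OF rtrancl_in[OF assms(3,1)]] by auto

text \<open>Row and column conditions leave no choice in a component except at its southwest end,
  which has no predecessor. There the multiset of the component decides.\<close>

lemma refilling_iff:
  assumes T': "tableau N Y s T'"
  shows "(\<forall>c. c \<notin> S \<longrightarrow> T' c = T c) \<and> (\<forall>C\<in>components S. image_mset T' (mset_set C) = image_mset T (mset_set C))
    \<longleftrightarrow> T' = rot Y b a T" (is "?L \<longleftrightarrow> ?R")
proof -
  have comps: "components S = {(nx S)\<^sup>* `` {p} | p. p \<in> S \<and> p \<notin> Range (nx S)}"
    using quotient_sym_closure unfolding components_def box_adjacent_eq_nx .
  show ?thesis
  proof
    assume L: ?L
    have vals: "T' c \<in> {Unbarred b, Barred a}" if "c \<in> S" for c
    proof -
      obtain p where p: "(p, c) \<in> (nx S)\<^sup>*" "p \<notin> Range (nx S)" "p \<in> S"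
        using start_exists[OF \<open>c \<in> S\<close>] .
      let ?C = "(nx S)\<^sup>* `` {p}"
      have "?C \<subseteq> S" using p(3) rtrancl_in by blast
      then have fin: "finite ?C" using finite_S finite_subset by blast
      have "image_mset T' (mset_set ?C) = image_mset T (mset_set ?C)"
        using L p comps by blast
      then have "T' ` ?C = T ` ?C" by (rule mset_set_image_eq[OF fin])
      then have "T' c \<in> T ` ?C" using p(1) by blast
      then obtain d where "d \<in> ?C" "T' c = T d" by blast
      then show ?thesis using \<open>?C \<subseteq> S\<close> S_values[of d] by auto
    qed
    have S': "mixed Y b a T' = S"
    proof (rule set_eqI)
      fix c
      have m: "c \<in> mixed Y b a T' \<longleftrightarrow> c \<in> Y \<and> T' c \<in> {Unbarred b, Barred a}"
        by (simp add: mixed_def)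
      show "c \<in> mixed Y b a T' \<longleftrightarrow> c \<in> S"
      proof (cases "c \<in> S")
        case True
        then show ?thesis using m vals S_Y by blast
      next
        case False
        then have "T' c = T c" using L by blast
        then show ?thesis using False unfolding m by (simp add: mixed_def)
      qed
    qed
    have step: "T' d = T c" if "(c, d) \<in> nx S" for c d
      using that
    proof (cases rule: nx_cases)
      case (right i j)
      then show ?thesis
        using T_right[of i j] tableau_s_right[OF Y T', of i j, unfolded S'] nx_in[OF \<open>(c, d) \<in> nx S\<close>] by simp
    next
      case (up i j)
      then show ?thesis
        using T_up[of i j] tableau_s_up[OF Y T', of i j, unfolded S'] nx_in[OF \<open>(c, d) \<in> nx S\<close>] by simp
    qed
    have "T' c = rot Y b a T c" for c
    proof (cases "c \<in> S")
      case True
      have "T' c = Unbarred b \<longleftrightarrow> c \<in> rotated (nx S) S (ubox Y b T)"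
      proof (cases "c \<in> Range (nx S)")
        case True
        then obtain d where "(d, c) \<in> nx S" by blast
        then show ?thesis using step rotated_step nx_in S_Y by (simp add: ubox_def)
      next
        case False
        obtain e where e: "(c, e) \<in> (nx S)\<^sup>*" "e \<notin> Domain (nx S)" "e \<in> S"
          using end_exists[OF True] .
        have "image_mset T' (mset_set ((nx S)\<^sup>* `` {c})) = image_mset T (mset_set ((nx S)\<^sup>* `` {c}))"
          using L comps True False by blast
        then have "T' c = T e"
          using component_mset[OF True False e(1,2), of T' T] step by blast
        then show ?thesis
          using rotated_start[OF True False e(1,2)] e(3) S_Y by (simp add: ubox_def)
      qed
      then show ?thesis using vals[OF True] True by (auto simp: rot_def Let_def)
    next
      case False
      then have "T' c = T c" using L by blast
      then show ?thesis using rot_off[OF False] by simp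
    qed
    then show ?R by blast
  next
    assume R: ?R
    have step: "T' d = T c" if "(c, d) \<in> nx S" for c d
      using rot_step[OF that] R by simp
    have "image_mset T' (mset_set C) = image_mset T (mset_set C)" if C: "C \<in> components S" for C
    proof -
      obtain p where p: "C = (nx S)\<^sup>* `` {p}" "p \<in> S" "p \<notin> Range (nx S)"
        using C unfolding comps by blast
      obtain e where e: "(p, e) \<in> (nx S)\<^sup>*" "e \<notin> Domain (nx S)" "e \<in> S"
        using end_exists[OF p(2)] .
      have "T' p = T e"
        using rot_start[OF p(2,3) e(1,2)] R by simp
      then show ?thesis
        unfolding p(1) using component_mset[OF p(2,3) e(1,2), of T' T] step by blast
    qed
    then show ?L using rot_off R by simp
  qed
qed

lemma rot_extensional: "rot Y b a T \<in> extensional Y \<longleftrightarrow> T \<in> extensional Y"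
proof -
  have "rot Y b a T c = T c" if "c \<notin> Y" for c
    using that S_Y rot_off by blast
  then show ?thesis unfolding extensional_def by simp
qed

lemma mixed_rot: "mixed Y b a (rot Y b a T) = S"
proof (rule set_eqI)
  fix c
  have m: "c \<in> mixed Y b a (rot Y b a T) \<longleftrightarrow> c \<in> Y \<and> rot Y b a T c \<in> {Unbarred b, Barred a}"
    by (simp add: mixed_def)
  show "c \<in> mixed Y b a (rot Y b a T) \<longleftrightarrow> c \<in> S"
  proof (cases "c \<in> S")
    case True
    then show ?thesis unfolding m rot_S[OF True] using S_Y by simp
  next
    case False
    then show ?thesis unfolding m rot_off[OF False] by (simp add: mixed_def)
  qed
qed

lemma ubox_rot: "ubox Y b (rot Y b a T) = rotated (nx S) S (ubox Y b T)"
proof (rule set_eqI)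
  fix c
  have m: "c \<in> ubox Y b (rot Y b a T) \<longleftrightarrow> c \<in> Y \<and> rot Y b a T c = Unbarred b"
    by (simp add: ubox_def)
  show "c \<in> ubox Y b (rot Y b a T) \<longleftrightarrow> c \<in> rotated (nx S) S (ubox Y b T)"
  proof (cases "c \<in> S")
    case True
    then show ?thesis unfolding m rot_S[OF True] using S_Y by simp
  next
    case False
    then have "c \<notin> rotated (nx S) S (ubox Y b T)"
      using subsetD[OF rotated_subset, of c "nx S" S "ubox Y b T"] by metis
    moreover have "\<not> (c \<in> Y \<and> T c = Unbarred b)" using False by (simp add: mixed_def)
    ultimately show ?thesis unfolding m rot_off[OF False] by metis
  qed
qed

text \<open>Pairs of boxes not both in the ribbon keep their comparison by \<open>r_iff\<close>.
  Within the ribbon, a box entered from the left now holds \<open>b\<close> and one entered from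
  below is now barred, as \<open>s\<close> demands.\<close>

lemma rot_tableau: "tableau N Y s (rot Y b a T)"
proof -
  let ?T = "rot Y b a T"
  have vals: "?T c \<in> {Unbarred b, Barred a}" if "c \<in> S" for c
    using rot_S[OF that] by auto
  have nS: "T c \<noteq> Unbarred b" "T c \<noteq> Barred a" if "c \<notin> S" "c \<in> Y" for c
    using that by (auto simp: mixed_def)
  have right: "?T (i, Suc j) = Unbarred b" if "(i, j) \<in> S" "(i, Suc j) \<in> S" for i j
    using rot_step[of "(i, j)" "(i, Suc j)"] T_right[OF that] that by (simp add: nx_def)
  have up: "?T (i, j) = Barred a" if "(i, j) \<in> S" "(Suc i, j) \<in> S" for i j
    using rot_step[of "(Suc i, j)" "(i, j)"] T_up[OF that] that by (simp add: nx_def)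
  have pair: "(?T c, ?T d) \<in> s" "?T c \<noteq> ?T d \<or> T c = T d \<and> c \<notin> S"
    if "(T c, T d) \<in> r" "c \<in> Y" "d \<in> Y" "\<not> (c \<in> S \<and> d \<in> S)" for c d
  proof -
    consider "c \<in> S" "d \<notin> S" | "c \<notin> S" "d \<in> S" | "c \<notin> S" "d \<notin> S"
      using \<open>\<not> (c \<in> S \<and> d \<in> S)\<close> by blast
    then have "(?T c, ?T d) \<in> s \<and> (?T c \<noteq> ?T d \<or> T c = T d \<and> c \<notin> S)"
    proof cases
      case 1
      have "(?T c, T d) \<in> r"
        using r_iff(2)[OF nS[OF 1(2) that(3)]] vals[OF 1(1)] S_values[OF 1(1)] that(1) by auto
      then show ?thesis
        using s_iff_r[of "?T c" "T d"] vals[OF 1(1)] nS[OF 1(2) that(3)] rot_off[OF 1(2)] by auto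
    next
      case 2
      have "(T c, ?T d) \<in> r"
        using r_iff(1)[OF nS[OF 2(1) that(2)]] vals[OF 2(2)] S_values[OF 2(2)] that(1) by auto
      then show ?thesis
        using s_iff_r[of "T c" "?T d"] vals[OF 2(2)] nS[OF 2(1) that(2)] rot_off[OF 2(1)] by auto
    next
      case 3
      then show ?thesis using s_iff_r[of "T c" "T d"] nS[OF 3(1) that(2)] that(1) rot_off by auto
    qed
    then show "(?T c, ?T d) \<in> s" "?T c \<noteq> ?T d \<or> T c = T d \<and> c \<notin> S" by auto
  qed
  have refl: "(x, x) \<in> s" if "x \<in> {Unbarred b, Barred a}" for x
    using that UV_alphabet shuffle_order_linear(2)[OF orders(2)] by auto
  have row: "(?T (i, j), ?T (i, k)) \<in> s \<and> (is_barred (?T (i, j)) \<longrightarrow> ?T (i, j) \<noteq> ?T (i, k))"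
    if "j < k" "(i, j) \<in> Y" "(i, k) \<in> Y" for i j k
  proof (cases "(i, j) \<in> S \<and> (i, k) \<in> S")
    case True
    then have "(i, k - 1) \<in> S" using S_convex[of i j i k i "k - 1"] that by auto
    then have "?T (i, k) = Unbarred b" using right[of i "k - 1"] True that by simp
    moreover have "?T (i, j) = Unbarred b \<or> ?T (i, j) = Barred a" using vals[of "(i, j)"] True by blast
    ultimately show ?thesis using refl UV(2) by (elim disjE) simp_all
  next
    case False
    have "(T (i, j), T (i, k)) \<in> r" "is_barred (T (i, j)) \<Longrightarrow> T (i, j) \<noteq> T (i, k)"
      using T that unfolding tableau_def by blast+
    then show ?thesis using pair[of "(i, j)" "(i, k)"] that False rot_off[of "(i, j)"] by auto
  qed
  have col: "(?T (i, j), ?T (k, j)) \<in> s \<and> (is_unbarred (?T (i, j)) \<longrightarrow> ?T (i, j) \<noteq> ?T (k, j))"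
    if "i < k" "(i, j) \<in> Y" "(k, j) \<in> Y" for i j k
  proof (cases "(i, j) \<in> S \<and> (k, j) \<in> S")
    case True
    then have "(Suc i, j) \<in> S" using S_convex[of i j k j "Suc i" j] that by auto
    then have "?T (i, j) = Barred a" using up[of i j] True by simp
    moreover have "?T (k, j) = Unbarred b \<or> ?T (k, j) = Barred a" using vals[of "(k, j)"] True by blast
    ultimately show ?thesis using refl UV(2) by (elim disjE) simp_all
  next
    case False
    have "(T (i, j), T (k, j)) \<in> r" "is_unbarred (T (i, j)) \<Longrightarrow> T (i, j) \<noteq> T (k, j)"
      using T that unfolding tableau_def by blast+
    then show ?thesis using pair[of "(i, j)" "(k, j)"] that False rot_off[of "(i, j)"] by auto
  qed
  have "?T c \<in> alphabet N" if "c \<in> Y" for c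
    using vals[of c] rot_off[of c] UV_alphabet tableau_alphabet[OF T that] by (cases "c \<in> S") auto
  then show ?thesis unfolding tableau_def using row col by blast
qed

end

lemma rot_inj:
  assumes "downset Y" "tableau N Y r T" "tableau N Y r T'" "rot Y b a T = rot Y b a T'"
  shows "T = T'"
proof -
  let ?S = "mixed Y b a T"
  have S: "mixed Y b a T' = ?S"
    using mixed_rot[OF assms(1,2)] mixed_rot[OF assms(1,3)] assms(4) by simp
  interpret chains ?S "nx ?S" content by (rule S_chains[OF assms(1,2)])
  have "ubox Y b T = ubox Y b T'"
    by (rule rotated_inj)
       (use ubox_rot[OF assms(1,2)] ubox_rot[OF assms(1,3)] assms(4) S in \<open>auto simp: ubox_def mixed_def\<close>)
  then have u: "T c = Unbarred b \<longleftrightarrow> T' c = Unbarred b" if "c \<in> ?S" for c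
    using that by (auto simp: ubox_def mixed_def)
  show ?thesis
  proof
    fix c show "T c = T' c"
    proof (cases "c \<in> ?S")
      case True
      then have "c \<in> mixed Y b a T'" using S by simp
      then show ?thesis using u[OF True] True by (auto simp: mixed_def)
    next
      case False
      then show ?thesis using rot_off[OF assms(1,2) False] rot_off[OF assms(1,3), of c] assms(4) S by metis
    qed
  qed
qed

end

section \<open>Transposition duality\<close>

fun flip :: "letter \<Rightarrow> letter" where
  "flip (Unbarred x) = Barred x"
| "flip (Barred x) = Unbarred x"

lemma flip_flip [simp]: "flip (flip x) = x"
  by (cases x) auto

lemma flip_eq_iff [simp]: "flip x = flip y \<longleftrightarrow> x = y"
  by (metis flip_flip)

lemma flip_eq [simp]: "flip x = Unbarred n \<longleftrightarrow> x = Barred n" "flip x = Barred n \<longleftrightarrow> x = Unbarred n"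
  by (cases x; auto)+

lemma is_barred_flip [simp]: "is_barred (flip x) \<longleftrightarrow> is_unbarred x" "is_unbarred (flip x) \<longleftrightarrow> is_barred x"
  by (cases x; auto)+

lemma flip_alphabet [simp]: "flip x \<in> alphabet N \<longleftrightarrow> x \<in> alphabet N"
  by (cases x) auto

definition dual_order :: "letter rel \<Rightarrow> letter rel" where
  "dual_order r = {(x, y). (flip x, flip y) \<in> r}"

definition dual_filling :: "filling \<Rightarrow> filling" where
  "dual_filling T = (\<lambda>c. flip (T (prod.swap c)))"

lemma dual_order_iff [simp]: "(x, y) \<in> dual_order r \<longleftrightarrow> (flip x, flip y) \<in> r"
  by (simp add: dual_order_def)

lemma dual_dual [simp]: "dual_order (dual_order r) = r" "dual_filling (dual_filling T) = T"
  by (auto simp: dual_order_def dual_filling_def)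

lemma swap_mem [simp]: "(i, j) \<in> prod.swap ` Y \<longleftrightarrow> (j, i) \<in> Y"
  by (force simp: image_iff)

lemma swap_swap_image [simp]: "prod.swap ` prod.swap ` Y = Y"
  by (simp add: image_image)

lemma downset_swap: "downset Y \<Longrightarrow> downset (prod.swap ` Y)"
  unfolding downset_def by auto

text \<open>Exchanging bars interchanges the strictness conditions of rows and columns, and
  transposition restores them.\<close>

lemma tableau_dual: "tableau N Y r T \<Longrightarrow> tableau N (prod.swap ` Y) (dual_order r) (dual_filling T)"
  unfolding tableau_def by (auto simp: dual_filling_def)

lemma lt_dual [simp]: "lt (dual_order r) x y \<longleftrightarrow> lt r (flip x) (flip y)"
  by (simp add: lt_def)

lemma shuffle_order_dual:
  assumes "shuffle_order N r"
  shows "shuffle_order N (dual_order r)"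
proof (rule shuffle_orderI)
  note r = shuffle_order_linear[OF assms]
  show "x \<in> alphabet N \<and> y \<in> alphabet N" if "(x, y) \<in> dual_order r" for x y
    using r(1)[of "flip x" "flip y"] that by simp
  show "(x, x) \<in> dual_order r" if "x \<in> alphabet N" for x
    using r(2)[of "flip x"] that by simp
  show "(x, z) \<in> dual_order r" if "(x, y) \<in> dual_order r" "(y, z) \<in> dual_order r" for x y z
    using r(3)[of "flip x" "flip y" "flip z"] that by simp
  show "x = y" if "(x, y) \<in> dual_order r" "(y, x) \<in> dual_order r" for x y
    using r(4)[of "flip x" "flip y"] that by simp
  show "(x, y) \<in> dual_order r \<or> (y, x) \<in> dual_order r" if "x \<in> alphabet N" "y \<in> alphabet N" for x y
    using r(5)[of "flip x" "flip y"] that by simp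
qed (use shuffle_order_letters[OF assms] in auto)

text \<open>The direction turns round: as \<open>a\<close> (barred) precedes \<open>b\<close> in
  \<open>s\<close>, the unbarred \<open>a\<close> precedes the barred \<open>b\<close> in
  \<open>dual_order s\<close>, which is therefore the order before the swap.\<close>

lemma swap_up_dual:
  assumes "swap_up N b a r s"
  shows "swap_up N a b (dual_order s) (dual_order r)"
proof -
  interpret letter_pair N r s b a using assms by unfold_locales
  have "\<not> (lt (dual_order s) (Unbarred a) c \<and> lt (dual_order s) c (Barred b))" for c
    using between_s[of "flip c"] by (auto simp: lt_def)
  moreover have "dual_order r = insert (Barred b, Unbarred a) (dual_order s - {(Unbarred a, Barred b)})"
  proof (rule set_eqI)
    fix p :: "letter \<times> letter"
    obtain x y where p: "p = (x, y)" by force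
    show "p \<in> dual_order r \<longleftrightarrow> p \<in> insert (Barred b, Unbarred a) (dual_order s - {(Unbarred a, Barred b)})"
    proof (cases "(x, y) = (Unbarred a, Barred b) \<or> (x, y) = (Barred b, Unbarred a)")
      case True
      then show ?thesis using UV by (auto simp: p)
    next
      case False
      then have "(flip x, flip y) \<noteq> (Unbarred b, Barred a)" "(flip x, flip y) \<noteq> (Barred a, Unbarred b)"
        by auto
      from s_iff_r[OF this] show ?thesis using False by (auto simp: p)
    qed
  qed
  moreover have "lt (dual_order s) (Unbarred a) (Barred b)" using UV by (simp add: lt_def)
  ultimately show ?thesis
    unfolding swap_up_def using shuffle_order_dual[OF orders(1)] shuffle_order_dual[OF orders(2)] by blast
qed

lemma nx_swap: "(prod.swap d, prod.swap c) \<in> nx (prod.swap ` S) \<longleftrightarrow> (c, d) \<in> nx S"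
  by (cases c; cases d) (auto simp: nx_def)

lemma nx_rtrancl_swap: "(c, d) \<in> (nx S)\<^sup>* \<Longrightarrow> (prod.swap d, prod.swap c) \<in> (nx (prod.swap ` S))\<^sup>*"
proof (induction rule: rtrancl_induct)
  case (step y z)
  then show ?case using nx_swap[of z y S] by (auto intro: converse_rtrancl_into_rtrancl)
qed simp

context letter_pair
begin

lemma dual_pair: "letter_pair N (dual_order s) (dual_order r) a b"
  using swap_up_dual[OF swap_up] by unfold_locales

lemma mixed_dual: "mixed (prod.swap ` Y) a b (dual_filling T) = prod.swap ` mixed Y b a T"
  by (auto simp: mixed_def dual_filling_def)

text \<open>Transposition reverses the steps of a ribbon, so rotating the dual tableau undoes the
  rotation. Surjectivity of \<open>rot\<close> follows.\<close>

lemma rot_dual: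
  assumes Y: "downset Y" and T: "tableau N Y r T"
  shows "rot (prod.swap ` Y) a b (dual_filling (rot Y b a T)) = dual_filling T"
proof -
  let ?T' = "rot Y b a T"
  interpret d: letter_pair N "dual_order s" "dual_order r" a b by (rule dual_pair)
  let ?S = "mixed Y b a T"
  note Y' = downset_swap[OF Y]
  note T' = tableau_dual[OF rot_tableau[OF Y T]]
  have S': "mixed (prod.swap ` Y) a b (dual_filling ?T') = prod.swap ` ?S"
    unfolding mixed_dual mixed_rot[OF Y T] ..
  interpret chains ?S "nx ?S" content by (rule S_chains[OF Y T])
  have "rot (prod.swap ` Y) a b (dual_filling ?T') (prod.swap c) = dual_filling T (prod.swap c)" for c
  proof (cases "c \<in> ?S")
    case False
    then have "prod.swap c \<notin> prod.swap ` ?S" by (cases c) auto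
    then show ?thesis
      using d.rot_off[OF Y' T', of "prod.swap c"] rot_off[OF Y T False] unfolding S'
      by (simp add: dual_filling_def)
  next
    case True
    show ?thesis
    proof (cases "c \<in> Domain (nx ?S)")
      case True
      then obtain e where e: "(c, e) \<in> nx ?S" by blast
      then have "(prod.swap e, prod.swap c) \<in> nx (prod.swap ` ?S)" by (simp add: nx_swap)
      from d.rot_step[OF Y' T', unfolded S', OF this] rot_step[OF Y T e]
      show ?thesis by (simp add: dual_filling_def)
    next
      case False
      obtain p where p: "(p, c) \<in> (nx ?S)\<^sup>*" "p \<notin> Range (nx ?S)" "p \<in> ?S"
        using start_exists[OF True] .
      have 1: "prod.swap c \<in> prod.swap ` ?S" using True by blast
      have 2: "prod.swap c \<notin> Range (nx (prod.swap ` ?S))"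
      proof
        assume "prod.swap c \<in> Range (nx (prod.swap ` ?S))"
        then obtain e where "(prod.swap (prod.swap e), prod.swap c) \<in> nx (prod.swap ` ?S)" by auto
        then have "(c, prod.swap e) \<in> nx ?S" unfolding nx_swap .
        then show False using False by blast
      qed
      have 3: "prod.swap p \<notin> Domain (nx (prod.swap ` ?S))"
      proof
        assume "prod.swap p \<in> Domain (nx (prod.swap ` ?S))"
        then obtain e where "(prod.swap p, prod.swap (prod.swap e)) \<in> nx (prod.swap ` ?S)" by auto
        then have "(prod.swap e, p) \<in> nx ?S" unfolding nx_swap .
        then show False using p(2) by blast
      qed
      from d.rot_start[OF Y' T', unfolded S', OF 1 2 nx_rtrancl_swap[OF p(1)] 3]
        rot_start[OF Y T p(3,2,1) False]
      show ?thesis by (simp add: dual_filling_def)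
    qed
  qed
  from this[of "prod.swap _"] show ?thesis by auto
qed

lemma rot_surj:
  assumes Y: "downset Y" and T: "tableau N Y s T"
  obtains T' where "tableau N Y r T'" "rot Y b a T' = T"
proof -
  interpret d: letter_pair N "dual_order s" "dual_order r" a b by (rule dual_pair)
  let ?R = "rot (prod.swap ` Y) a b (dual_filling T)"
  note Y' = downset_swap[OF Y] and T' = tableau_dual[OF T]
  have "tableau N Y r (dual_filling ?R)"
    using tableau_dual[OF d.rot_tableau[OF Y' T']] by simp
  moreover have "rot Y b a (dual_filling ?R) = T"
    using d.rot_dual[OF Y' T'] by simp
  ultimately show ?thesis using that by blast
qed

end

text \<open>A conversion from \<open>s\<close> to \<open>r\<close> refills components of the
  \<open>s\<close>-tableau; symmetry expresses it through the rotation from \<open>r\<close> to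
  \<open>s\<close>. The reason is that both fillings have the same ribbon.\<close>

lemma refilling_sym:
  assumes "refilling \<nu> b a T T'" "finite (young_diagram \<nu>)"
  shows "refilling \<nu> b a T' T"
proof -
  let ?S = "mixed (young_diagram \<nu>) b a T"
  have R: "\<And>c. c \<notin> ?S \<Longrightarrow> T' c = T c"
    "\<And>C. C \<in> components ?S \<Longrightarrow> image_mset T' (mset_set C) = image_mset T (mset_set C)"
    using assms(1) by (auto simp: refilling_def mixed_def Let_def)
  have vals: "T' c \<in> {Unbarred b, Barred a}" if c: "c \<in> ?S" for c
  proof -
    let ?E = "{(c, d). c \<in> ?S \<and> d \<in> ?S \<and> (c, d) \<in> {(c, d). c \<in> ?S \<and> d \<in> ?S \<and> box_adjacent c d}\<^sup>*}"
    let ?C = "?E `` {c}"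
    have "?C \<in> components ?S" unfolding components_def using c by (rule quotientI)
    note m = R(2)[OF this]
    have C: "?C \<subseteq> ?S" "c \<in> ?C" using c by auto
    have "finite ?S" using assms(2) by (simp add: mixed_def)
    then have fin: "finite ?C" using C finite_subset by blast
    have "T' ` ?C = T ` ?C"
      by (rule mset_set_image_eq[OF fin m])
    then have "T' c \<in> T ` ?C" using imageI[OF C(2), of T'] by simp
    then obtain d where "d \<in> ?C" "T' c = T d" by (elim imageE)
    then show ?thesis using subsetD[OF C(1), of d] by (simp add: mixed_def)
  qed
  have "mixed (young_diagram \<nu>) b a T' = ?S"
  proof (rule set_eqI)
    fix c show "c \<in> mixed (young_diagram \<nu>) b a T' \<longleftrightarrow> c \<in> ?S"
      using vals[of c] R(1)[of c] by (cases "c \<in> ?S") (auto simp: mixed_def)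
  qed
  then show ?thesis using R unfolding refilling_def mixed_def Let_def by auto
qed

lemma downset_young_diagram:
  assumes "is_partition \<nu>"
  shows "downset (young_diagram \<nu>)"
proof -
  have "young_diagram \<nu> = (SIGMA i:{..<length \<nu>}. {..<\<nu> ! i})"
    by (auto simp: young_diagram_def)
  then have "finite (young_diagram \<nu>)" by simp
  moreover have "(i', j') \<in> young_diagram \<nu>" if "(i, j) \<in> young_diagram \<nu>" "i' \<le> i" "j' \<le> j" for i j i' j'
  proof -
    have "\<nu> ! i \<le> \<nu> ! i'"
    proof (cases "i' = i")
      case False
      then show ?thesis
        using sorted_wrt_nth_less[of "(\<ge>)" \<nu> i' i] assms that
        by (auto simp: is_partition_def young_diagram_def)
    qed simp
    then show ?thesis using that by (auto simp: young_diagram_def)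
  qed
  ultimately show ?thesis unfolding downset_def by blast
qed

lemma letter_swap_unique:
  assumes "swap_up N b a r s"
  shows "letter_swap N b' a' r s \<Longrightarrow> b' = b \<and> a' = a" "letter_swap N b' a' s r \<Longrightarrow> b' = b \<and> a' = a"
proof -
  interpret letter_pair N r s b a using assms by unfold_locales
  have *: "b' = b \<and> a' = a" if "swap_up N b' a' r s"
  proof -
    interpret p: letter_pair N r s b' a' using that by unfold_locales
    show ?thesis using p.UV s_iff_r[of "Unbarred b'" "Barred a'"] by auto
  qed
  have **: False if "swap_up N b' a' s r"
  proof -
    interpret p: letter_pair N s r b' a' using that by unfold_locales
    show ?thesis using p.UV s_iff_r[of "Unbarred b'" "Barred a'"] UV by auto
  qed
  show "letter_swap N b' a' r s \<Longrightarrow> b' = b \<and> a' = a" "letter_swap N b' a' s r \<Longrightarrow> b' = b \<and> a' = a"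
    using * ** by (auto simp: letter_swap_def)
qed

context letter_pair
begin

lemma elem_conv_up:
  assumes \<nu>: "is_partition \<nu>" and T: "T \<in> CT N r \<nu>"
  shows "elem_conv N \<nu> r s T = rot (young_diagram \<nu>) b a T" "elem_conv N \<nu> r s T \<in> CT N s \<nu>"
proof -
  let ?Y = "young_diagram \<nu>"
  note Y = downset_young_diagram[OF \<nu>]
  have T': "T \<in> extensional ?Y" "tableau N ?Y r T" using T by (auto simp: CT_iff)
  have ref: "refilling \<nu> b a T T1 \<longleftrightarrow> T1 = rot ?Y b a T" if "tableau N ?Y s T1" for T1
    using refilling_iff[OF Y T'(2) that] unfolding refilling_def mixed_def Let_def .
  have "rot ?Y b a T \<in> extensional ?Y"
    by (rule rot_extensional[OF Y T'(2), THEN iffD2, OF T'(1)])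
  then have R: "rot ?Y b a T \<in> CT N s \<nu>" using rot_tableau[OF Y T'(2)] by (simp add: CT_iff)
  have sw: "letter_swap N b a r s" using swap_up by (simp add: letter_swap_def)
  show "elem_conv N \<nu> r s T = rot ?Y b a T" unfolding elem_conv_def
  proof (rule the_equality)
    show "rot ?Y b a T \<in> CT N s \<nu> \<and> (\<exists>b' a'. letter_swap N b' a' r s \<and> refilling \<nu> b' a' T (rot ?Y b a T))"
      using R sw ref rot_tableau[OF Y T'(2)] by blast
  next
    fix T1 assume "T1 \<in> CT N s \<nu> \<and> (\<exists>b' a'. letter_swap N b' a' r s \<and> refilling \<nu> b' a' T T1)"
    then obtain b' a' where T1: "T1 \<in> CT N s \<nu>" "letter_swap N b' a' r s" "refilling \<nu> b' a' T T1"
      by blast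
    then show "T1 = rot ?Y b a T"
      using ref[of T1] letter_swap_unique(1)[OF swap_up T1(2)] by (simp add: CT_iff)
  qed
  then show "elem_conv N \<nu> r s T \<in> CT N s \<nu>" using R by simp
qed

text \<open>The downward conversion is the preimage under \<open>rot\<close>, which exists by
  \<open>rot_surj\<close> and is unique by \<open>rot_inj\<close>.\<close>

lemma elem_conv_down:
  assumes \<nu>: "is_partition \<nu>" and T: "T \<in> CT N s \<nu>"
  shows "rot (young_diagram \<nu>) b a (elem_conv N \<nu> s r T) = T" "elem_conv N \<nu> s r T \<in> CT N r \<nu>"
proof -
  let ?Y = "young_diagram \<nu>"
  note Y = downset_young_diagram[OF \<nu>]
  have fin: "finite ?Y" using Y by (simp add: downset_def)
  have T': "T \<in> extensional ?Y" "tableau N ?Y s T" using T by (auto simp: CT_iff)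
  obtain T1 where T1: "tableau N ?Y r T1" "rot ?Y b a T1 = T" using rot_surj[OF Y T'(2)] .
  have ref: "refilling \<nu> b a T T2 \<longleftrightarrow> T = rot ?Y b a T2" if "tableau N ?Y r T2" for T2
  proof -
    have "refilling \<nu> b a T2 T \<longleftrightarrow> T = rot ?Y b a T2"
      using refilling_iff[OF Y that T'(2)] unfolding refilling_def mixed_def Let_def .
    then show ?thesis using refilling_sym[OF _ fin] by blast
  qed
  have "T1 \<in> extensional ?Y"
    using rot_extensional[OF Y T1(1)] T'(1) unfolding T1(2) by blast
  then have R: "T1 \<in> CT N r \<nu>" using T1 by (simp add: CT_iff)
  have sw: "letter_swap N b a s r" using swap_up by (simp add: letter_swap_def)
  have "elem_conv N \<nu> s r T = T1" unfolding elem_conv_def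
  proof (rule the_equality)
    show "T1 \<in> CT N r \<nu> \<and> (\<exists>b' a'. letter_swap N b' a' s r \<and> refilling \<nu> b' a' T T1)"
      using R sw ref T1 by blast
  next
    fix T2 assume "T2 \<in> CT N r \<nu> \<and> (\<exists>b' a'. letter_swap N b' a' s r \<and> refilling \<nu> b' a' T T2)"
    then obtain b' a' where T2: "T2 \<in> CT N r \<nu>" "letter_swap N b' a' s r" "refilling \<nu> b' a' T T2"
      by blast
    have "tableau N ?Y r T2" using T2(1) by (simp add: CT_iff)
    moreover have "refilling \<nu> b a T T2" using letter_swap_unique(2)[OF swap_up T2(2)] T2(3) by simp
    ultimately have "rot ?Y b a T2 = rot ?Y b a T1" using ref T1(2) by simp
    then show "T2 = T1" using rot_inj[OF Y \<open>tableau N ?Y r T2\<close> T1(1)] by simp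
  qed
  then show "rot ?Y b a (elem_conv N \<nu> s r T) = T" "elem_conv N \<nu> s r T \<in> CT N r \<nu>"
    using T1 R by auto
qed

end


section \<open>Independence of the sequence of swaps\<close>

definition low :: "nat \<Rightarrow> nat \<Rightarrow> letter set" where
  "low i j = Unbarred ` {..i} \<union> Barred ` {..j}"

definition region :: "box set \<Rightarrow> filling \<Rightarrow> nat \<Rightarrow> nat \<Rightarrow> box set" where
  "region Y T i j = {c\<in>Y. T c \<in> low i j}"

text \<open>A shuffle order is a lattice path; \<open>passes r i j\<close> says that it visits the vertex \<open>(i, j)\<close>.\<close>

definition passes :: "letter rel \<Rightarrow> nat \<Rightarrow> nat \<Rightarrow> bool" where
  "passes r i j \<longleftrightarrow> (\<forall>x y. (x, y) \<in> r \<longrightarrow> y \<in> low i j \<longrightarrow> x \<in> low i j)"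

lemma low_iff [simp]: "Unbarred k \<in> low i j \<longleftrightarrow> k \<le> i" "Barred k \<in> low i j \<longleftrightarrow> k \<le> j"
  by (auto simp: low_def)

lemma low_mono: "i \<le> i' \<Longrightarrow> j \<le> j' \<Longrightarrow> low i j \<subseteq> low i' j'"
  by (auto simp: low_def)

lemma region_mono: "i \<le> i' \<Longrightarrow> j \<le> j' \<Longrightarrow> region Y T i j \<subseteq> region Y T i' j'"
  using low_mono[of i i' j j'] unfolding region_def by blast

text \<open>The shape at the vertex \<open>(N - k, j)\<close> of the growth diagram starting from a tableau \<open>T\<close> for the big
  bar order; the last equation is its local rule.\<close>

fun growth :: "nat \<Rightarrow> box set \<Rightarrow> filling \<Rightarrow> nat \<Rightarrow> nat \<Rightarrow> box set" where
  "growth N Y T 0 j = region Y T N j"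
| "growth N Y T (Suc k) 0 = region Y T (N - Suc k) 0"
| "growth N Y T (Suc k) (Suc j) = (let S = growth N Y T k (Suc j) - growth N Y T (Suc k) j in
     growth N Y T k (Suc j) - rotated (nx S) S (growth N Y T k j \<inter> S))"

lemma growth_mono1: "growth N Y T (Suc k) j \<subseteq> growth N Y T k j"
proof (cases j)
  case 0
  then show ?thesis using region_mono[of "N - Suc k" "N - k" 0 0] by (cases k) simp_all
next
  case (Suc j')
  then show ?thesis by (auto simp: Let_def)
qed

lemma growth_mono2: "growth N Y T k j \<subseteq> growth N Y T k (Suc j)"
proof (induction k)
  case 0
  then show ?case by (simp add: region_mono)
next
  case (Suc k)
  let ?S = "growth N Y T k (Suc j) - growth N Y T (Suc k) j"
  have "growth N Y T (Suc k) j \<subseteq> growth N Y T k (Suc j)"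
    using growth_mono1 Suc by blast
  then show ?case
    using rotated_subset[of "nx ?S" ?S "growth N Y T k j \<inter> ?S"] by (auto simp: Let_def)
qed

text \<open>The path of the big bar order consists of the vertices with \<open>j = 0\<close> or
  \<open>i = N\<close>. The recursion of \<open>growth\<close> starts there and therefore counts
  \<open>i\<close> down from \<open>N\<close>.\<close>

definition grows :: "nat \<Rightarrow> box set \<Rightarrow> filling \<Rightarrow> letter rel \<Rightarrow> filling \<Rightarrow> bool" where
  "grows N Y T0 r T \<longleftrightarrow>
     (\<forall>i\<le>N. \<forall>j\<le>N. passes r i j \<longrightarrow> region Y T i j = growth N Y T0 (N - i) j)"

lemma shuffle_order_iff:
  assumes "shuffle_order N r"
  shows "Unbarred x \<in> alphabet N \<Longrightarrow> Unbarred y \<in> alphabet N \<Longrightarrow> (Unbarred x, Unbarred y) \<in> r \<longleftrightarrow> x \<le> y"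
    and "Barred x \<in> alphabet N \<Longrightarrow> Barred y \<in> alphabet N \<Longrightarrow> (Barred x, Barred y) \<in> r \<longleftrightarrow> x \<le> y"
proof -
  note r = shuffle_order_linear[OF assms]
  show "(Unbarred x, Unbarred y) \<in> r \<longleftrightarrow> x \<le> y"
    if "Unbarred x \<in> alphabet N" "Unbarred y \<in> alphabet N"
    using that shuffle_order_letters(1)[OF assms, of x y] shuffle_order_letters(1)[OF assms, of y x]
      r(2)[of "Unbarred x"] r(4)[of "Unbarred x" "Unbarred y"]
    by (cases x y rule: linorder_cases) auto
  show "(Barred x, Barred y) \<in> r \<longleftrightarrow> x \<le> y"
    if "Barred x \<in> alphabet N" "Barred y \<in> alphabet N"
    using that shuffle_order_letters(2)[OF assms, of x y] shuffle_order_letters(2)[OF assms, of y x]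
      r(2)[of "Barred x"] r(4)[of "Barred x" "Barred y"]
    by (cases x y rule: linorder_cases) auto
qed

section \<open>Two lattice paths that differ at one unit square\<close>

context letter_pair
begin

lemma ab_range: "1 \<le> b" "b \<le> N" "1 \<le> a" "a \<le> N"
  using UV_alphabet by auto

text \<open>The initial segments of \<open>r\<close> ending at \<open>a\<close> (barred) and at
  \<open>b\<close> are the vertices \<open>(b, a)\<close> and \<open>(b, a - 1)\<close> of its
  path.\<close>

lemma low_r:
  assumes "x \<in> alphabet N"
  shows "x \<in> low b a \<longleftrightarrow> (x, Barred a) \<in> r" (is ?A)
    and "x \<in> low b (a - 1) \<longleftrightarrow> (x, Unbarred b) \<in> r" (is ?B)
proof -
  note uu = shuffle_order_iff(1)[OF orders(1)] and bb = shuffle_order_iff(2)[OF orders(1)]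
  have "?A \<and> ?B"
  proof (cases x)
    case (Unbarred k)
    then have "(x, Unbarred b) \<in> r \<longleftrightarrow> k \<le> b" using uu[of k b] assms UV_alphabet by simp
    moreover have "(x, Barred a) \<in> r \<longleftrightarrow> (x, Unbarred b) \<in> r"
      using r_iff(1)[of x] UV shuffle_order_linear(2)[OF orders(1)] UV_alphabet Unbarred by (cases "k = b") auto
    ultimately show ?thesis using Unbarred by simp
  next
    case (Barred k)
    then have "(x, Barred a) \<in> r \<longleftrightarrow> k \<le> a" using bb[of k a] assms UV_alphabet by simp
    moreover have "(x, Unbarred b) \<in> r \<longleftrightarrow> (x, Barred a) \<in> r \<and> k \<noteq> a"
      using r_iff(1)[of x] UV Barred by (cases "k = a") auto
    ultimately show ?thesis using Barred ab_range by auto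
  qed
  then show ?A ?B by auto
qed

lemma passes_r: "passes r b a" "passes r b (a - 1)" "passes r (b - 1) (a - 1)"
proof -
  note r = shuffle_order_linear[OF orders(1)]
  show "passes r b a" unfolding passes_def
  proof (intro allI impI)
    fix x y assume xy: "(x, y) \<in> r" "y \<in> low b a"
    then have "(y, Barred a) \<in> r" using low_r(1) r(1) by blast
    with xy(1) have "(x, Barred a) \<in> r" by (rule r(3))
    then show "x \<in> low b a" using low_r(1) r(1) by blast
  qed
  show "passes r b (a - 1)" unfolding passes_def
  proof (intro allI impI)
    fix x y assume xy: "(x, y) \<in> r" "y \<in> low b (a - 1)"
    then have "(y, Unbarred b) \<in> r" using low_r(2) r(1) by blast
    with xy(1) have "(x, Unbarred b) \<in> r" by (rule r(3))
    then show "x \<in> low b (a - 1)" using low_r(2) r(1) by blast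
  qed
  have *: "x \<in> low (b - 1) (a - 1) \<longleftrightarrow> (x, Unbarred b) \<in> r \<and> x \<noteq> Unbarred b" if "x \<in> alphabet N" for x
  proof -
    have "x \<in> low (b - 1) (a - 1) \<longleftrightarrow> x \<in> low b (a - 1) \<and> x \<noteq> Unbarred b"
      using ab_range by (cases x) auto
    then show ?thesis using low_r(2)[OF that] by simp
  qed
  show "passes r (b - 1) (a - 1)"
    unfolding passes_def
  proof (intro allI impI)
    fix x y assume xy: "(x, y) \<in> r" "y \<in> low (b - 1) (a - 1)"
    then have y: "(y, Unbarred b) \<in> r" "y \<noteq> Unbarred b" using * r(1)[OF xy(1)] by auto
    then have "(x, Unbarred b) \<in> r" "x \<noteq> Unbarred b" using xy(1) r(3,4) by blast+
    then show "x \<in> low (b - 1) (a - 1)" using * r(1)[OF xy(1)] by blast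
  qed
qed

text \<open>Together with \<open>passes_r_cases\<close>: the paths differ only in the corner
  \<open>(b, a - 1)\<close> of \<open>r\<close> and the corner \<open>(b - 1, a)\<close> of
  \<open>s\<close>. At a common vertex both swapped letters count as small or neither does, so that
  \<open>region_rot\<close> applies.\<close>

lemma passes_s_cases:
  assumes "passes s i j" "i \<le> N" "j \<le> N"
  shows "i = b - 1 \<and> j = a \<or> passes r i j \<and> (b \<le> i \<longleftrightarrow> a \<le> j)"
proof -
  have ba: "a \<le> j" if "b \<le> i"
    using assms(1) UV(2) that unfolding passes_def by (metis low_iff)
  show ?thesis
  proof (cases "b \<le> i \<longleftrightarrow> a \<le> j")
    case True
    have "passes r i j" unfolding passes_def
    proof (intro allI impI)
      fix x y assume xy: "(x, y) \<in> r" "y \<in> low i j"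
      show "x \<in> low i j"
      proof (cases "(x, y) = (Unbarred b, Barred a)")
        case eq: True
        then show ?thesis using True xy by simp
      next
        case False
        moreover have "(x, y) \<noteq> (Barred a, Unbarred b)" using xy UV by blast
        ultimately have "(x, y) \<in> s" using s_iff_r xy by blast
        then show ?thesis using assms(1) xy unfolding passes_def by blast
      qed
    qed
    then show ?thesis using True by blast
  next
    case False
    then have ij: "i < b" "a \<le> j" using ba by auto
    have "i = b - 1"
    proof (rule ccontr)
      assume "i \<noteq> b - 1"
      then have "Suc i < b" using ij by auto
      then have i: "Unbarred (Suc i) \<in> alphabet N" "Suc i \<noteq> b"
        "Unbarred (Suc i) \<in> low b a" using ab_range by auto
      then have "(Unbarred (Suc i), Barred a) \<in> r" using low_r(1) by blast
      then have "(Unbarred (Suc i), Barred a) \<in> s"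
        using s_iff_r[of "Unbarred (Suc i)" "Barred a"] i(2) by simp
      then have "Unbarred (Suc i) \<in> low i j"
        using assms(1) ij unfolding passes_def by (metis low_iff(2))
      then show False by simp
    qed
    moreover have "j = a"
    proof (rule ccontr)
      assume "j \<noteq> a"
      then have j: "a < j" using ij by auto
      then have "(Barred a, Barred j) \<in> r" "Barred j \<noteq> Unbarred b" "Barred j \<noteq> Barred a"
        using shuffle_order_letters(2)[OF orders(1), of a j] assms ab_range by auto
      then have "(Unbarred b, Barred j) \<in> s"
        using r_iff(2)[of "Barred j"] s_iff_r[of "Unbarred b" "Barred j"] by auto
      then have "Unbarred b \<in> low i j"
        using assms(1) unfolding passes_def by (metis low_iff(2) order_refl)
      then show False using ij by simp
    qed
    ultimately show ?thesis by blast
  qed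
qed

lemma passes_r_cases:
  assumes "passes r i j" "i \<le> N" "j \<le> N"
  shows "i = b \<and> j = a - 1 \<or> passes s i j \<and> (b \<le> i \<longleftrightarrow> a \<le> j)"
proof -
  have ba: "b \<le> i" if "a \<le> j"
    using assms(1) UV(1) that unfolding passes_def by (metis low_iff)
  show ?thesis
  proof (cases "b \<le> i \<longleftrightarrow> a \<le> j")
    case True
    have "passes s i j" unfolding passes_def
    proof (intro allI impI)
      fix x y assume xy: "(x, y) \<in> s" "y \<in> low i j"
      show "x \<in> low i j"
      proof (cases "(x, y) = (Barred a, Unbarred b)")
        case eq: True
        then show ?thesis using True xy by simp
      next
        case False
        moreover have "(x, y) \<noteq> (Unbarred b, Barred a)" using xy UV by blast
        ultimately have "(x, y) \<in> r" using s_iff_r xy by blast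
        then show ?thesis using assms(1) xy unfolding passes_def by blast
      qed
    qed
    then show ?thesis using True by blast
  next
    case False
    then have ij: "b \<le> i" "j < a" using ba by auto
    have "j = a - 1"
    proof (rule ccontr)
      assume "j \<noteq> a - 1"
      then have "Suc j < a" using ij by auto
      then have "Barred (Suc j) \<in> alphabet N" "Barred (Suc j) \<in> low b (a - 1)"
        using ab_range by auto
      then have "(Barred (Suc j), Unbarred b) \<in> r" using low_r(2) by blast
      then have "Barred (Suc j) \<in> low i j"
        using assms(1) ij unfolding passes_def by (metis low_iff(1))
      then show False by simp
    qed
    moreover have "i = b"
    proof (rule ccontr)
      assume "i \<noteq> b"
      then have i: "b < i" using ij by auto
      then have "(Unbarred b, Unbarred i) \<in> r" "Unbarred i \<noteq> Unbarred b" "Unbarred i \<noteq> Barred a"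
        using shuffle_order_letters(1)[OF orders(1), of b i] assms ab_range by auto
      then have "(Barred a, Unbarred i) \<in> r"
        using r_iff(2)[of "Unbarred i"] by auto
      then have "Barred a \<in> low i j"
        using assms(1) unfolding passes_def by (metis low_iff(1) order_refl)
      then show False using ij by simp
    qed
    ultimately show ?thesis by blast
  qed
qed

lemma passes_s: "passes s b a" "passes s (b - 1) (a - 1)"
proof -
  have "b - 1 \<noteq> b" "a - 1 \<noteq> a" "b - 1 \<le> N" "a - 1 \<le> N" using ab_range by auto
  then show "passes s b a" "passes s (b - 1) (a - 1)"
    using passes_r_cases[OF passes_r(1)] passes_r_cases[OF passes_r(3)] ab_range by metis+
qed

lemma passes_s': "passes s (b - 1) a"
  unfolding passes_def
proof (intro allI impI)
  fix x y assume xy: "(x, y) \<in> s" "y \<in> low (b - 1) a"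
  have al: "x \<in> alphabet N" "y \<in> alphabet N" using shuffle_order_linear(1)[OF orders(2) xy(1)] by auto
  have "y \<in> low b a" using xy(2) low_mono[of "b - 1" b a a] by auto
  then have x: "x \<in> low b a" using passes_s(1) xy(1) unfolding passes_def by blast
  have "x \<noteq> Unbarred b"
  proof
    assume x: "x = Unbarred b"
    have y: "y \<noteq> Unbarred b" "y \<noteq> Barred a" using xy(1,2) ab_range UV x by auto
    then have "(Unbarred b, y) \<in> r" using s_iff_r[of x y] xy(1) x by auto
    moreover have "(y, Barred a) \<in> r" using low_r(1)[OF al(2)] \<open>y \<in> low b a\<close> by simp
    ultimately show False using between_r y by blast
  qed
  then show "x \<in> low (b - 1) a" using x by (cases x) auto
qed

context
  fixes Y T
  assumes Y: "downset Y" and T: "tableau N Y r T"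
begin

lemma region_rot:
  assumes "b \<le> i \<longleftrightarrow> a \<le> j"
  shows "region Y (rot Y b a T) i j = region Y T i j"
proof -
  have "rot Y b a T c \<in> low i j \<longleftrightarrow> T c \<in> low i j" for c
  proof (cases "c \<in> mixed Y b a T")
    case True
    then show ?thesis using rot_S[OF Y T True] S_values[OF Y T True] assms by auto
  next
    case False
    then show ?thesis using rot_off[OF Y T False] by simp
  qed
  then show ?thesis by (simp add: region_def)
qed

lemma mixed_eq_region: "mixed Y b a T = region Y T b a - region Y T (b - 1) (a - 1)"
proof -
  have "x = Unbarred b \<or> x = Barred a \<longleftrightarrow> x \<in> low b a \<and> x \<notin> low (b - 1) (a - 1)" for x
    using ab_range by (cases x) auto
  then show ?thesis by (auto simp: mixed_def region_def)
qed

lemma ubox_eq_region: "ubox Y b T = region Y T b (a - 1) \<inter> mixed Y b a T"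
  using ab_range by (auto simp: mixed_def region_def ubox_def)

lemma region_ubox: "region Y T b (a - 1) = region Y T (b - 1) (a - 1) \<union> ubox Y b T"
proof -
  have "x \<in> low b (a - 1) \<longleftrightarrow> x \<in> low (b - 1) (a - 1) \<or> x = Unbarred b" for x
    using ab_range by (cases x) auto
  then show ?thesis by (auto simp: ubox_def region_def)
qed

lemma region_rot_new:
  "region Y (rot Y b a T) (b - 1) a
    = region Y T b a - rotated (nx (mixed Y b a T)) (mixed Y b a T) (ubox Y b T)"
proof -
  have "x \<in> low (b - 1) a \<longleftrightarrow> x \<in> low b a \<and> x \<noteq> Unbarred b" for x
    using ab_range by (cases x) auto
  then have "region Y (rot Y b a T) (b - 1) a = region Y (rot Y b a T) b a - ubox Y b (rot Y b a T)"
    by (auto simp: region_def ubox_def)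
  then show ?thesis using region_rot[of b a] ubox_rot[OF Y T] by simp
qed

lemma growth_square:
  "growth N Y T0 (N - (b - 1)) a = (let S = growth N Y T0 (N - b) a - growth N Y T0 (N - (b - 1)) (a - 1) in
     growth N Y T0 (N - b) a - rotated (nx S) S (growth N Y T0 (N - b) (a - 1) \<inter> S))"
proof -
  have "N - (b - 1) = Suc (N - b)" "a = Suc (a - 1)" using ab_range by auto
  then show ?thesis by (metis growth.simps(3))
qed

lemma grows_up:
  assumes "grows N Y T0 r T"
  shows "grows N Y T0 s (rot Y b a T)"
  unfolding grows_def
proof (intro allI impI)
  fix i j assume ij: "i \<le> N" "j \<le> N" "passes s i j"
  note g = assms[unfolded grows_def, rule_format]
  show "region Y (rot Y b a T) i j = growth N Y T0 (N - i) j"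
  proof (cases "i = b - 1 \<and> j = a")
    case True
    have "growth N Y T0 (N - b) a = region Y T b a"
      "growth N Y T0 (N - (b - 1)) (a - 1) = region Y T (b - 1) (a - 1)"
      "growth N Y T0 (N - b) (a - 1) = region Y T b (a - 1)"
      using g[of b a] g[of "b - 1" "a - 1"] g[of b "a - 1"] passes_r ab_range by auto
    then have "growth N Y T0 (N - (b - 1)) a
      = region Y T b a - rotated (nx (mixed Y b a T)) (mixed Y b a T) (ubox Y b T)"
      using growth_square[of T0] unfolding Let_def mixed_eq_region ubox_eq_region by metis
    then show ?thesis using True region_rot_new by simp
  next
    case False
    then have "passes r i j" "b \<le> i \<longleftrightarrow> a \<le> j" using passes_s_cases[OF ij(3,1,2)] by auto
    then show ?thesis using region_rot g ij by simp
  qed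
qed

text \<open>The shape at \<open>(b, a - 1)\<close> has to be recovered from the one at
  \<open>(b - 1, a)\<close>. The \<open>b\<close>-boxes of \<open>T\<close> and those prescribed by
  the diagram have the same rotation, so they agree by \<open>rotated_inj\<close>.\<close>

lemma grows_down:
  assumes "grows N Y T0 s (rot Y b a T)"
  shows "grows N Y T0 r T"
  unfolding grows_def
proof (intro allI impI)
  fix i j assume ij: "i \<le> N" "j \<le> N" "passes r i j"
  note g = assms[unfolded grows_def, rule_format]
  let ?S = "mixed Y b a T"
  interpret chains ?S "nx ?S" content by (rule S_chains[OF Y T])
  show "region Y T i j = growth N Y T0 (N - i) j"
  proof (cases "i = b \<and> j = a - 1")
    case True
    let ?B = "growth N Y T0 (N - b) (a - 1)"
    have e: "region Y (rot Y b a T) b a = region Y T b a"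
      "region Y (rot Y b a T) (b - 1) (a - 1) = region Y T (b - 1) (a - 1)"
    proof -
      have "\<not> b \<le> b - 1" "\<not> a \<le> a - 1" using ab_range by auto
      then show "region Y (rot Y b a T) b a = region Y T b a"
        "region Y (rot Y b a T) (b - 1) (a - 1) = region Y T (b - 1) (a - 1)"
        using region_rot by blast+
    qed
    then have G: "growth N Y T0 (N - b) a = region Y T b a"
      "growth N Y T0 (N - (b - 1)) (a - 1) = region Y T (b - 1) (a - 1)"
      "growth N Y T0 (N - (b - 1)) a = region Y (rot Y b a T) (b - 1) a"
      using g[of b a] g[of "b - 1" "a - 1"] g[of "b - 1" a] passes_s passes_s' ab_range by auto
    have "region Y T b a - rotated (nx ?S) ?S (ubox Y b T) = region Y T b a - rotated (nx ?S) ?S (?B \<inter> ?S)"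
      using growth_square[of T0] G region_rot_new by (simp add: Let_def mixed_eq_region)
    moreover have "rotated (nx ?S) ?S B \<subseteq> region Y T b a" for B
      using rotated_subset[of "nx ?S" ?S B] mixed_eq_region by blast
    ultimately have "rotated (nx ?S) ?S (ubox Y b T) = rotated (nx ?S) ?S (?B \<inter> ?S)"
      by blast
    then have "ubox Y b T = ?B \<inter> ?S"
      by (rule rotated_inj[rotated 2]) (auto simp: ubox_def mixed_def)
    moreover have "growth N Y T0 (N - (b - 1)) (a - 1) \<subseteq> ?B"
      using growth_mono1[of N Y T0 "N - b"] ab_range by (simp add: Suc_diff_le Suc_diff_Suc)
    moreover have "?B \<subseteq> growth N Y T0 (N - b) a"
      using growth_mono2[of N Y T0 "N - b" "a - 1"] ab_range by simp
    ultimately have "region Y T b (a - 1) = ?B"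
      using G mixed_eq_region region_ubox by auto
    then show ?thesis using True by simp
  next
    case False
    then have p: "passes s i j" "b \<le> i \<longleftrightarrow> a \<le> j" using passes_r_cases[OF ij(3,1,2)] by auto
    show ?thesis using region_rot[OF p(2)] g[OF ij(1,2) p(1)] by simp
  qed
qed

end

end

text \<open>Everything obtainable from \<open>T0\<close> by swaps in either direction. The downward
  rule describes its result as a preimage under \<open>rot\<close>.\<close>

inductive reach :: "nat \<Rightarrow> box set \<Rightarrow> filling \<Rightarrow> letter rel \<Rightarrow> filling \<Rightarrow> bool"
  for N Y T0 where
  reach_base: "reach N Y T0 (big_bar_order N) T0"
| reach_up: "reach N Y T0 r T \<Longrightarrow> swap_up N b a r s \<Longrightarrow> tableau N Y r T \<Longrightarrow> reach N Y T0 s (rot Y b a T)"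
| reach_down: "reach N Y T0 s (rot Y b a T) \<Longrightarrow> swap_up N b a r s \<Longrightarrow> tableau N Y r T \<Longrightarrow> reach N Y T0 r T"

lemma grows_base: "grows N Y T0 (big_bar_order N) T0"
  unfolding grows_def
proof (intro allI impI)
  fix i j assume ij: "i \<le> N" "j \<le> N" "passes (big_bar_order N) i j"
  have "i = N \<or> j = 0"
  proof (rule ccontr)
    assume "\<not> (i = N \<or> j = 0)"
    then have "(Unbarred (Suc i), Barred j) \<in> big_bar_order N" using ij by (simp add: big_bar_order_def)
    then have "Unbarred (Suc i) \<in> low i j" using ij(3) unfolding passes_def by (metis low_iff(2) order_refl)
    then show False by simp
  qed
  then show "region Y T0 i j = growth N Y T0 (N - i) j"
  proof (cases "N - i")
    case 0
    then show ?thesis using ij by simp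
  next
    case (Suc k)
    then have "j = 0" "N - Suc k = i" using \<open>i = N \<or> j = 0\<close> ij by auto
    then show ?thesis using Suc by simp
  qed
qed

lemma reach_grows: "reach N Y T0 r T \<Longrightarrow> downset Y \<Longrightarrow> grows N Y T0 r T"
proof (induction rule: reach.induct)
  case reach_base
  show ?case by (rule grows_base)
next
  case (reach_up r T b a s)
  interpret letter_pair N r s b a using reach_up by unfold_locales
  show ?case using grows_up reach_up by blast
next
  case (reach_down s b a T r)
  interpret letter_pair N r s b a using reach_down by unfold_locales
  show ?case using grows_down reach_down by blast
qed

lemma passes_natural: "passes (natural_order N) i i" "passes (natural_order N) (Suc i) i"
proof -
  have *: "x \<in> low i j" if "natural_le x y" "y \<in> low i j" "i = j \<or> i = Suc j" for x y i j
    using that by (cases x; cases y) auto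
  show "passes (natural_order N) i i" "passes (natural_order N) (Suc i) i"
    unfolding passes_def natural_order_def using * by blast+
qed

text \<open>The natural order visits the vertices \<open>(i, i)\<close> and
  \<open>(i + 1, i)\<close> in turn, and an entry is determined by the first of them whose shape
  contains its box.\<close>

lemma natural_unique:
  assumes "reach N Y T0 (natural_order N) T" "reach N Y T0 (natural_order N) T'" "downset Y"
    and "tableau N Y r T" "tableau N Y r' T'" "T \<in> extensional Y" "T' \<in> extensional Y"
  shows "T = T'"
proof
  fix c show "T c = T' c"
  proof (cases "c \<in> Y")
    case False
    then show ?thesis using assms(6,7) extensional_arb[of _ Y c] by metis
  next
    case True
    note g = reach_grows[OF assms(1,3), unfolded grows_def, rule_format]
      and g' = reach_grows[OF assms(2,3), unfolded grows_def, rule_format]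
    have eq: "T c \<in> low i j \<longleftrightarrow> T' c \<in> low i j" if "i \<le> N" "j \<le> N" "i = j \<or> i = Suc j" for i j
    proof -
      have "passes (natural_order N) i j" using that(3) passes_natural by auto
      then have "region Y T i j = region Y T' i j" using g g' that by simp
      then show ?thesis using True by (auto simp: region_def)
    qed
    have T: "T c \<in> alphabet N" using tableau_alphabet[OF assms(4) True] .
    show ?thesis
    proof (cases "T c")
      case (Unbarred n)
      then have "1 \<le> n" "n \<le> N" using T by auto
      then have n: "n \<le> N" "n - 1 \<le> N" "n = Suc (n - 1)" "\<not> n \<le> n - 1" by auto
      then have "T' c \<in> low n (n - 1)" "T' c \<notin> low (n - 1) (n - 1)"
        using eq[OF n(1,2)] eq[OF n(2,2)] Unbarred by (metis low_iff(1) order_refl)+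
      then show ?thesis using Unbarred by (cases "T' c") auto
    next
      case (Barred n)
      then have "1 \<le> n" "n \<le> N" using T by auto
      then have n: "n \<le> N" "n - 1 \<le> N" "n = Suc (n - 1)" "\<not> n \<le> n - 1" by auto
      then have "T' c \<in> low n n" "T' c \<notin> low n (n - 1)"
        using eq[OF n(1,2)] eq[OF n(1,1)] Barred by (metis low_iff(2) order_refl)+
      then show ?thesis using Barred by (cases "T' c") auto
    qed
  qed
qed

lemma reach_conv_along:
  assumes "is_partition \<nu>"
  shows "rs \<noteq> [] \<Longrightarrow> successively (\<lambda>p q. \<exists>b a. letter_swap N b a p q) rs \<Longrightarrow>
    reach N (young_diagram \<nu>) T0 (hd rs) T \<Longrightarrow> T \<in> CT N (hd rs) \<nu> \<Longrightarrow>
    reach N (young_diagram \<nu>) T0 (last rs) (conv_along N \<nu> rs T) \<and> conv_along N \<nu> rs T \<in> CT N (last rs) \<nu>"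
proof (induction rs arbitrary: T rule: induct_list012)
  case (3 r s rs)
  then obtain b a where "letter_swap N b a r s" by auto
  then consider "swap_up N b a r s" | "swap_up N b a s r" by (auto simp: letter_swap_def)
  then have "reach N (young_diagram \<nu>) T0 s (elem_conv N \<nu> r s T) \<and> elem_conv N \<nu> r s T \<in> CT N s \<nu>"
  proof cases
    case 1
    interpret letter_pair N r s b a using 1 by unfold_locales
    have T: "T \<in> CT N r \<nu>" using "3.prems" by simp
    then show ?thesis
      using elem_conv_up[OF assms T] "3.prems" reach_up[OF _ 1, of "young_diagram \<nu>" T0 T]
      by (simp add: CT_iff)
  next
    case 2
    interpret letter_pair N s r b a using 2 by unfold_locales
    have T: "T \<in> CT N r \<nu>" using "3.prems" by simp
    then show ?thesis
      using elem_conv_down[OF assms T] "3.prems"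
        reach_down[OF _ 2, of "young_diagram \<nu>" T0 "elem_conv N \<nu> r s T"] by (simp add: CT_iff)
  qed
  then show ?case using "3.IH"(2) "3.prems" by simp
qed auto


section \<open>Effect of an elementary conversion on the unbarred word\<close>

definition diagset :: "box set \<Rightarrow> filling \<Rightarrow> int \<Rightarrow> nat set" where
  "diagset Y T d = {n. \<exists>c\<in>Y. content c = d \<and> T c = Unbarred n}"

definition ubword :: "box set \<Rightarrow> filling \<Rightarrow> int \<Rightarrow> int \<Rightarrow> nat list" where
  "ubword Y T lo hi = concat (map (\<lambda>d. desc (diagset Y T d)) [lo..hi])"

definition between :: "letter rel \<Rightarrow> nat \<Rightarrow> nat \<Rightarrow> bool" where
  "between r x c \<longleftrightarrow> (Unbarred x, Barred c) \<in> r \<and> (Barred c, Unbarred (Suc x)) \<in> r"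

text \<open>Swapping \<open>b\<close> with the next barred letter need not preserve the local plactic class without such a
  condition: for the natural order, moving 2 past 2 (barred) turns the tableau with rows
  1, 1 (barred), 2 (barred) and 1 (barred), 2, 2 (barred) into one with rows 1, 1 (barred), 2 (barred)
  and 1 (barred), 2 (barred), 2, and hence the unbarred word 21 into 12.\<close>

definition tame :: "letter rel \<Rightarrow> nat \<Rightarrow> bool" where
  "tame r b \<longleftrightarrow> (\<forall>x c c'. between r x c \<longrightarrow> between r x c' \<longrightarrow> c = c') \<and>
     (\<forall>x c. Suc x = b \<longrightarrow> \<not> between r x c)"

lemma finite_diagset: "downset Y \<Longrightarrow> finite (diagset Y T d)"
  by (rule finite_subset[of _ "(\<lambda>c. case T c of Unbarred n \<Rightarrow> n | _ \<Rightarrow> 0) ` Y"])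
     (auto simp: diagset_def downset_def intro!: rev_image_eqI)

lemma between_mono:
  assumes "shuffle_order N r" "(Unbarred x, v) \<in> r" "(v, Unbarred (Suc x)) \<in> r"
    "v \<noteq> Unbarred (Suc x)" "\<And>c. v = Barred c \<Longrightarrow> \<not> between r x c"
  shows "v = Unbarred x"
proof (cases v)
  case (Unbarred n)
  have al: "Unbarred x \<in> alphabet N" "v \<in> alphabet N" "Unbarred (Suc x) \<in> alphabet N"
    using assms shuffle_order_linear(1)[OF assms(1)] by blast+
  then have "x \<le> n" "n \<le> Suc x"
    using assms(2,3) shuffle_order_iff(1)[OF assms(1)] Unbarred by simp_all
  then show ?thesis using assms(4) Unbarred by auto
next
  case (Barred c)
  then show ?thesis using assms(2,3,5) by (auto simp: between_def)
qed

lemma between_mono':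
  assumes "shuffle_order N r" "(Unbarred x, v) \<in> r" "(v, Unbarred (Suc x)) \<in> r"
    "v \<noteq> Unbarred x" "\<And>c. v = Barred c \<Longrightarrow> \<not> between r x c"
  shows "v = Unbarred (Suc x)"
  using between_mono[OF assms(1-3) _ assms(5)] assms(4) by blast

lemma box_order:
  assumes "shuffle_order N r" "tableau N Y r T" "downset Y" "(i, j) \<in> Y" "(p, q) \<in> Y"
    "content (i, j) = content (p, q)" "(T (p, q), T (i, j)) \<in> r" "T (p, q) \<noteq> T (i, j)"
  shows "p < i" "q < j"
proof -
  have "p < i \<and> q < j"
  proof (rule ccontr)
    assume "\<not> (p < i \<and> q < j)"
    then have "i \<le> p" "j \<le> q" using assms(6) by (auto simp: content_def)
    then have "(T (i, j), T (p, q)) \<in> r" using tableau_mono[OF assms(1-5)] by blast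
    then show False using assms(7,8) shuffle_order_linear(4)[OF assms(1)] by blast
  qed
  then show "p < i" "q < j" by auto
qed

text \<open>The \<open>x\<close> on the diagonal lies northwest of \<open>(p, q)\<close>, so the box
  above \<open>(p, q)\<close> holds \<open>x\<close> or a barred letter between \<open>x\<close> and
  \<open>Suc x\<close>. In the latter case its right neighbour would be a second such
  letter.\<close>

lemma below_step:
  assumes r: "shuffle_order N r" and Y: "downset Y" and T: "tableau N Y r T"
    and pq: "(p, Suc q) \<in> Y" "T (p, q) = Unbarred (Suc x)" "content (p, q) = d"
    and x: "x \<in> diagset Y T d"
    and alt: "(\<forall>c. \<not> between r x c) \<or>
      T (p, Suc q) = Unbarred (Suc x) \<and> (\<forall>c c'. between r x c \<longrightarrow> between r x c' \<longrightarrow> c = c')"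
  obtains p' q' where "p = Suc p'" "q = Suc q'" "T (p', q') = Unbarred x" "T (p', Suc q') = Unbarred x"
proof -
  have pqY: "(p, q) \<in> Y" using pq(1) Y unfolding downset_def by (meson le_SucI order_refl)
  obtain i j where ij: "(i, j) \<in> Y" "content (i, j) = d" "T (i, j) = Unbarred x"
    using x by (auto simp: diagset_def)
  note al = tableau_alphabet[OF T pqY] tableau_alphabet[OF T ij(1)]
  have lt: "(Unbarred x, Unbarred (Suc x)) \<in> r" "Unbarred x \<noteq> Unbarred (Suc x)"
    using al pq(2) ij(3) shuffle_order_iff(1)[OF r, of x "Suc x"] by auto
  have "i < p" "j < q"
    using box_order[OF r T Y pqY ij(1)] pq(2,3) ij(2,3) lt by auto
  then obtain p' q' where p: "p = Suc p'" "q = Suc q'" "i \<le> p'" "j \<le> q'"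
    by (metis Suc_le_mono Suc_le_eq less_imp_Suc_add add.commute le_add1 lessE less_Suc_eq_le)
  have in_Y: "(k, l) \<in> Y" if "k \<le> p" "l \<le> Suc q" for k l
    using pq(1) Y that unfolding downset_def by blast
  have v: "(p', q') \<in> Y" "(p', q) \<in> Y" "(p', Suc q) \<in> Y" using in_Y p by auto
  note mono = tableau_mono[OF r T Y]
  have 1: "(Unbarred x, T (p', q')) \<in> r" using mono[OF ij(1) v(1) p(3,4)] ij(3) by simp
  have 2: "(T (p', q'), T (p', q)) \<in> r" using mono[OF v(1,2)] p by simp
  have 3: "(T (p', q), T (p', Suc q)) \<in> r" using mono[OF v(2,3)] by simp
  have 4: "(T (p', q), Unbarred (Suc x)) \<in> r" using mono[OF v(2) pqY] p pq(2) by simp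
  have 12: "(Unbarred x, T (p', q)) \<in> r" using shuffle_order_linear(3)[OF r 1 2] .
  have ne: "T (p', q) \<noteq> Unbarred (Suc x)"
    using tableau_col[OF T, of p' p q] v(2) pqY p pq(2) by auto
  have nb: "\<not> between r x c" if c: "T (p', q) = Barred c" for c
    using alt
  proof
    assume a: "T (p, Suc q) = Unbarred (Suc x) \<and> (\<forall>c c'. between r x c \<longrightarrow> between r x c' \<longrightarrow> c = c')"
    have 5: "(T (p', Suc q), Unbarred (Suc x)) \<in> r" using mono[OF v(3) pq(1)] p a by simp
    have ne': "T (p', Suc q) \<noteq> Unbarred (Suc x)"
      using tableau_col[OF T, of p' p "Suc q"] v(3) pq(1) p a by auto
    have ne2: "T (p', q) \<noteq> T (p', Suc q)"
      using tableau_row[OF T _ v(2,3)] c by auto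
    show "\<not> between r x c"
    proof
      assume b: "between r x c"
      have "T (p', Suc q) = Unbarred x"
      proof (rule between_mono[OF r shuffle_order_linear(3)[OF r 12 3] 5 ne'])
        fix c' assume "T (p', Suc q) = Barred c'"
        then show "\<not> between r x c'" using a b ne2 c by metis
      qed
      then have "T (p', q) = Unbarred x"
        using 12 3 shuffle_order_linear(4)[OF r] by auto
      then show False using c by simp
    qed
  qed blast
  have "T (p', q) = Unbarred x" by (rule between_mono[OF r 12 4 ne nb])
  moreover from this have "T (p', q') = Unbarred x"
    using 1 2 shuffle_order_linear(4)[OF r] by auto
  ultimately show ?thesis using that p by blast
qed

text \<open>The mirror argument: the box below \<open>(p, Suc q)\<close> is squeezed between
  \<open>x\<close> and \<open>Suc x\<close>, and a barred letter there would force a second one to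
  its left.\<close>

lemma above_step:
  assumes r: "shuffle_order N r" and Y: "downset Y" and T: "tableau N Y r T"
    and pq: "(p, Suc q) \<in> Y" "T (p, Suc q) = Unbarred x" "content (p, Suc q) = d"
    and x: "Suc x \<in> diagset Y T d"
    and alt: "(\<forall>c. \<not> between r x c) \<or>
      T (p, q) = Unbarred x \<and> (\<forall>c c'. between r x c \<longrightarrow> between r x c' \<longrightarrow> c = c')"
  shows "(Suc p, Suc (Suc q)) \<in> Y" "T (Suc p, Suc q) = Unbarred (Suc x)"
    "T (Suc p, Suc (Suc q)) = Unbarred (Suc x)"
proof -
  obtain i j where ij: "(i, j) \<in> Y" "content (i, j) = d" "T (i, j) = Unbarred (Suc x)"
    using x by (auto simp: diagset_def)
  note al = tableau_alphabet[OF T pq(1)] tableau_alphabet[OF T ij(1)]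
  have lt: "(Unbarred x, Unbarred (Suc x)) \<in> r" "Unbarred x \<noteq> Unbarred (Suc x)"
    using al pq(2) ij(3) shuffle_order_iff(1)[OF r, of x "Suc x"] by auto
  have less: "Suc p \<le> i" "Suc (Suc q) \<le> j"
    using box_order[OF r T Y ij(1) pq(1)] pq(2,3) ij(2,3) lt by auto
  have in_Y: "(k, l) \<in> Y" if "k \<le> i" "l \<le> j" for k l
    using ij(1) Y that unfolding downset_def by blast
  have v: "(Suc p, q) \<in> Y" "(Suc p, Suc q) \<in> Y" "(Suc p, Suc (Suc q)) \<in> Y" "(p, q) \<in> Y"
    using in_Y less by auto
  then show "(Suc p, Suc (Suc q)) \<in> Y" by simp
  note mono = tableau_mono[OF r T Y]
  have 1: "(T (Suc p, Suc (Suc q)), Unbarred (Suc x)) \<in> r" using mono[OF v(3) ij(1) less] ij(3) by simp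
  have 2: "(T (Suc p, Suc q), T (Suc p, Suc (Suc q))) \<in> r" using mono[OF v(2,3)] by simp
  have 3: "(T (Suc p, q), T (Suc p, Suc q)) \<in> r" using mono[OF v(1,2)] by simp
  have 4: "(Unbarred x, T (Suc p, Suc q)) \<in> r" using mono[OF pq(1) v(2)] pq(2) by simp
  have 12: "(T (Suc p, Suc q), Unbarred (Suc x)) \<in> r" using shuffle_order_linear(3)[OF r 2 1] .
  have ne: "T (Suc p, Suc q) \<noteq> Unbarred x"
    using tableau_col[OF T, of p "Suc p" "Suc q"] v(2) pq(1,2) by auto
  have nb: "\<not> between r x c" if c: "T (Suc p, Suc q) = Barred c" for c
    using alt
  proof
    assume a: "T (p, q) = Unbarred x \<and> (\<forall>c c'. between r x c \<longrightarrow> between r x c' \<longrightarrow> c = c')"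
    have 5: "(Unbarred x, T (Suc p, q)) \<in> r" using mono[OF v(4,1)] a by simp
    have ne': "T (Suc p, q) \<noteq> Unbarred x"
      using tableau_col[OF T, of p "Suc p" q] v(1,4) a by auto
    have ne2: "T (Suc p, q) \<noteq> T (Suc p, Suc q)"
      using tableau_row[OF T _ v(1,2)] c by auto
    show "\<not> between r x c"
    proof
      assume b: "between r x c"
      have "T (Suc p, q) = Unbarred (Suc x)"
      proof (rule between_mono'[OF r 5 shuffle_order_linear(3)[OF r 3 12] ne'])
        fix c' assume "T (Suc p, q) = Barred c'"
        then show "\<not> between r x c'" using a b ne2 c by metis
      qed
      then have "T (Suc p, Suc q) = Unbarred (Suc x)"
        using 12 3 shuffle_order_linear(4)[OF r] by auto
      then show False using c by simp
    qed
  qed blast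
  show "T (Suc p, Suc q) = Unbarred (Suc x)" by (rule between_mono'[OF r 4 12 ne nb])
  then show "T (Suc p, Suc (Suc q)) = Unbarred (Suc x)"
    using 1 2 shuffle_order_linear(4)[OF r] by auto
qed

context letter_pair
begin

lemma between_s_iff:
  assumes "x \<noteq> b" "Suc x \<noteq> b"
  shows "between s x c \<longleftrightarrow> between r x c"
  using s_iff_r[of "Unbarred x" "Barred c"] s_iff_r[of "Barred c" "Unbarred (Suc x)"] assms
  by (auto simp: between_def)

text \<open>If another barred letter stood in this gap, then in \<open>r\<close> it would share the
  gap with \<open>a\<close> (barred), against tameness; and \<open>a\<close> (barred) has left the
  gap by the swap.\<close>

lemma not_between_s:
  assumes "tame r b"
  shows "\<not> between s b c"
proof
  assume s: "between s b c"
  then have c: "c \<noteq> a" using UV by (auto simp: between_def)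
  have "between r b c"
    using s s_iff_r[of "Unbarred b" "Barred c"] s_iff_r[of "Barred c" "Unbarred (Suc b)"] c
    by (auto simp: between_def)
  moreover from this have "between r b a"
    using r_iff(2)[of "Unbarred (Suc b)"] UV shuffle_order_linear(3)[OF orders(1)]
    by (auto simp: between_def)
  ultimately show False using assms c unfolding tame_def by blast
qed

context
  fixes Y T lo hi
  assumes Y: "downset Y" and T: "tableau N Y r T" and tame: "tame r b"
    and range: "\<And>c. c \<in> Y \<Longrightarrow> lo \<le> content c \<and> content c \<le> hi"
begin

abbreviation (input) "T' \<equiv> rot Y b a T"
abbreviation (input) "M \<equiv> mixed Y b a T"

lemma T': "tableau N Y s T'" and mixed_T': "mixed Y b a T' = M"
  using rot_tableau[OF Y T] mixed_rot[OF Y T] by auto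

lemma diagset_T': "n \<noteq> b \<Longrightarrow> n \<in> diagset Y T' d \<longleftrightarrow> n \<in> diagset Y T d"
proof -
  assume n: "n \<noteq> b"
  have "T' c = Unbarred n \<longleftrightarrow> T c = Unbarred n" for c
  proof (cases "c \<in> M")
    case True
    then show ?thesis using rot_S[OF Y T True] S_values[OF Y T True] n by auto
  next
    case False
    then show ?thesis using rot_off[OF Y T False] by simp
  qed
  then show ?thesis by (simp add: diagset_def)
qed

text \<open>Going down from \<open>b\<close>, each letter of the run fills two adjacent boxes on
  diagonals \<open>d\<close> and \<open>d + 1\<close>, northwest of the previous two. The first step
  uses that the gap below \<open>b\<close> is empty; the later ones use the pair of boxes found
  before and the uniqueness of intermediate barred letters.\<close>

lemma row_below:
  assumes x: "x < b" and sub: "{x..<b} \<subseteq> diagset Y T d"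
    and ij: "(i, j) \<in> M" "(i, Suc j) \<in> M" "content (i, j) = d"
  shows "\<exists>p q. content (p, q) = d \<and> (p, Suc q) \<in> Y \<and> T (p, q) = Unbarred x \<and> T (p, Suc q) = Unbarred x"
  using x sub
proof (induction "b - x" arbitrary: x)
  case (Suc n)
  have x: "x \<in> diagset Y T d" using Suc.prems by auto
  show ?case
  proof (cases "Suc x = b")
    case True
    have none: "\<forall>c. \<not> between r x c" using tame True unfolding tame_def by blast
    obtain p' q' where p': "i = Suc p'" "j = Suc q'" "T (p', q') = Unbarred x" "T (p', Suc q') = Unbarred x"
      using below_step[OF orders(1) Y T S_Y[OF Y T ij(2)] _ ij(3) x] none T_right[OF Y T ij(1,2)] True by metis
    have "(p', Suc q') \<in> Y"
      using S_Y[OF Y T ij(1)] Y p' unfolding downset_def by (meson le_SucI order_refl)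
    then show ?thesis using p' ij(3) by (intro exI[of _ p'] exI[of _ q']) (auto simp: content_def)
  next
    case False
    have "\<exists>p q. content (p, q) = d \<and> (p, Suc q) \<in> Y \<and> T (p, q) = Unbarred (Suc x) \<and> T (p, Suc q) = Unbarred (Suc x)"
      by (rule Suc.hyps) (use Suc False in auto)
    then obtain p q where pq: "content (p, q) = d" "(p, Suc q) \<in> Y" "T (p, q) = Unbarred (Suc x)"
      "T (p, Suc q) = Unbarred (Suc x)" by blast
    have uniq: "\<forall>c c'. between r x c \<longrightarrow> between r x c' \<longrightarrow> c = c'" using tame unfolding tame_def by blast
    obtain p' q' where p': "p = Suc p'" "q = Suc q'" "T (p', q') = Unbarred x" "T (p', Suc q') = Unbarred x"
      using below_step[OF orders(1) Y T pq(2,3,1) x] uniq pq(4) by metis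
    have "(p', Suc q') \<in> Y"
      using pq(2) Y p' unfolding downset_def by (meson le_SucI order_refl)
    then show ?thesis using p' pq(1) by (intro exI[of _ p'] exI[of _ q']) (auto simp: content_def)
  qed
qed simp

text \<open>This is done in the new tableau: there the right ribbon box is known to contain
  \<open>b\<close>, and the gap above \<open>b\<close> is empty in \<open>s\<close>. Letters other
  than \<open>b\<close> stand on the same diagonals as before.\<close>

lemma row_above:
  assumes x: "b < x" and sub: "{b<..x} \<subseteq> diagset Y T (d + 1)"
    and ij: "(i, j) \<in> M" "(i, Suc j) \<in> M" "content (i, j) = d"
  shows "\<exists>p q. content (p, q) = d \<and> (p, Suc q) \<in> Y \<and> T' (p, q) = Unbarred x \<and> T' (p, Suc q) = Unbarred x"
  using x sub
proof (induction "x - b" arbitrary: x)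
  case (Suc n)
  then obtain y where y: "x = Suc y" by (cases x) auto
  have x: "Suc y \<in> diagset Y T' (d + 1)" using Suc.prems y diagset_T'[of x] by auto
  show ?case
  proof (cases "y = b")
    case True
    have none: "\<forall>c. \<not> between s y c" using not_between_s[OF tame] True by blast
    have "T' (i, Suc j) = Unbarred y"
      using tableau_s_right[OF Y T', unfolded mixed_T', OF ij(1,2)] True by simp
    from above_step[OF orders(2) Y T' S_Y[OF Y T ij(2)] this _ x] none ij(3)
    have "(Suc i, Suc (Suc j)) \<in> Y" "T' (Suc i, Suc j) = Unbarred x" "T' (Suc i, Suc (Suc j)) = Unbarred x"
      by (auto simp: content_def y)
    then show ?thesis using ij(3) by (intro exI[of _ "Suc i"] exI[of _ "Suc j"]) (auto simp: content_def)
  next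
    case False
    then have yb: "b < y" using Suc.prems y by simp
    have "\<exists>p q. content (p, q) = d \<and> (p, Suc q) \<in> Y \<and> T' (p, q) = Unbarred y \<and> T' (p, Suc q) = Unbarred y"
      by (rule Suc.hyps) (use Suc y yb in auto)
    then obtain p q where pq: "content (p, q) = d" "(p, Suc q) \<in> Y" "T' (p, q) = Unbarred y"
      "T' (p, Suc q) = Unbarred y" by blast
    have uniq: "\<forall>c c'. between s y c \<longrightarrow> between s y c' \<longrightarrow> c = c'"
      using tame between_s_iff[of y] yb unfolding tame_def by auto
    from above_step[OF orders(2) Y T' pq(2,4) _ x] uniq pq(1,3)
    have "(Suc p, Suc (Suc q)) \<in> Y" "T' (Suc p, Suc q) = Unbarred x" "T' (Suc p, Suc (Suc q)) = Unbarred x"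
      by (auto simp: content_def y)
    then show ?thesis using pq(1) by (intro exI[of _ "Suc p"] exI[of _ "Suc q"]) (auto simp: content_def)
  qed
qed simp

text \<open>The left neighbour is squeezed between \<open>b - 1\<close> and the ribbon letters. It
  cannot be \<open>b - 1\<close>, which would repeat in a column, nor a barred letter in the gap,
  which tameness excludes.\<close>

lemma left_neighbour:
  assumes ij: "(i, j) \<in> M" "content (i, j) = d" and x: "Suc x = b" "x \<in> diagset Y T d"
  obtains j' where "j = Suc j'" "(i, j') \<in> M"
proof -
  obtain p q where pq: "(p, q) \<in> Y" "content (p, q) = d" "T (p, q) = Unbarred x"
    using x by (auto simp: diagset_def)
  note ijY = S_Y[OF Y T ij(1)]
  have lt: "(Unbarred x, Unbarred b) \<in> r"
    using tableau_alphabet[OF T pq(1)] pq(3) UV_alphabet x(1) shuffle_order_iff(1)[OF orders(1), of x b] by auto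
  moreover have "(Unbarred x, Barred a) \<in> r"
    using lt UV(1) by (rule shuffle_order_linear(3)[OF orders(1)])
  ultimately have "(T (p, q), T (i, j)) \<in> r" "T (p, q) \<noteq> T (i, j)"
    using S_values[OF Y T ij(1)] pq(3) x(1) by auto
  then have "p < i" "q < j" using box_order[OF orders(1) T Y ijY pq(1)] ij(2) pq(2) by auto
  then obtain j' where j: "j = Suc j'" "q \<le> j'" by (cases j) auto
  have Y': "(i, j') \<in> Y" "(p, j') \<in> Y" using ijY Y j \<open>p < i\<close> unfolding downset_def by (meson le_SucI order_refl less_imp_le)+
  note mono = tableau_mono[OF orders(1) T Y]
  have 1: "(Unbarred x, T (p, j')) \<in> r" using mono[OF pq(1) Y'(2)] j(2) pq(3) by simp
  have 2: "(T (p, j'), T (i, j')) \<in> r" using mono[OF Y'(2,1)] \<open>p < i\<close> by simp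
  have 3: "(T (i, j'), T (i, j)) \<in> r" using mono[OF Y'(1) ijY] j by simp
  have ne: "T (i, j') \<noteq> Unbarred x"
  proof
    assume e: "T (i, j') = Unbarred x"
    then have "T (p, j') = Unbarred x" using 1 2 shuffle_order_linear(4)[OF orders(1)] by auto
    then show False using tableau_col[OF T \<open>p < i\<close> Y'(2,1)] e by simp
  qed
  have "T (i, j') \<in> {Unbarred b, Barred a}"
  proof (rule ccontr)
    assume n: "T (i, j') \<notin> {Unbarred b, Barred a}"
    then have "(T (i, j'), Unbarred b) \<in> r" using 3 S_values[OF Y T ij(1)] r_iff(1)[of "T (i, j')"] by auto
    then have "T (i, j') = Unbarred (Suc x)"
      using between_mono'[OF orders(1) shuffle_order_linear(3)[OF orders(1) 1 2]] ne x(1) tame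
      unfolding tame_def by metis
    then show False using n x(1) by simp
  qed
  then have "(i, j') \<in> M" using Y' by (auto simp: mixed_def)
  then show ?thesis using that j(1) by blast
qed

text \<open>As for \<open>left_neighbour\<close>, but in the new tableau, where
  \<open>not_between_s\<close> keeps the gap above \<open>b\<close> empty.\<close>

lemma right_neighbour:
  assumes ij: "(i, j) \<in> M" "content (i, j) = d" and x: "Suc b \<in> diagset Y T d"
  shows "(i, Suc j) \<in> M"
proof -
  have "Suc b \<in> diagset Y T' d" using x diagset_T'[of "Suc b"] by simp
  then obtain p q where pq: "(p, q) \<in> Y" "content (p, q) = d" "T' (p, q) = Unbarred (Suc b)"
    by (auto simp: diagset_def)
  note ijY = S_Y[OF Y T ij(1)]
  have vals: "T' (i, j) \<in> {Unbarred b, Barred a}" using rot_S[OF Y T ij(1)] by auto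
  have lt: "(Unbarred b, Unbarred (Suc b)) \<in> s"
    using tableau_alphabet[OF T' pq(1)] pq(3) UV_alphabet shuffle_order_iff(1)[OF orders(2), of b "Suc b"] by auto
  moreover have "(Barred a, Unbarred (Suc b)) \<in> s"
    using UV(2) lt by (rule shuffle_order_linear(3)[OF orders(2)])
  ultimately have "(T' (i, j), T' (p, q)) \<in> s" "T' (i, j) \<noteq> T' (p, q)"
    using vals pq(3) by auto
  then have "i < p" "j < q" using box_order[OF orders(2) T' Y pq(1) ijY] ij(2) pq(2) by auto
  have Y': "(i, Suc j) \<in> Y" "(p, Suc j) \<in> Y"
    using pq(1) Y \<open>i < p\<close> \<open>j < q\<close> unfolding downset_def by (meson Suc_leI order_refl less_imp_le)+
  note mono = tableau_mono[OF orders(2) T' Y]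
  have 1: "(T' (p, Suc j), Unbarred (Suc b)) \<in> s" using mono[OF Y'(2) pq(1)] \<open>j < q\<close> pq(3) by simp
  have 2: "(T' (i, Suc j), T' (p, Suc j)) \<in> s" using mono[OF Y'(1,2)] \<open>i < p\<close> by simp
  have 3: "(T' (i, j), T' (i, Suc j)) \<in> s" using mono[OF ijY Y'(1)] by simp
  have ne: "T' (i, Suc j) \<noteq> Unbarred (Suc b)"
  proof
    assume e: "T' (i, Suc j) = Unbarred (Suc b)"
    then have "T' (p, Suc j) = Unbarred (Suc b)" using 1 2 shuffle_order_linear(4)[OF orders(2)] by auto
    then show False using tableau_col[OF T' \<open>i < p\<close> Y'(1,2)] e by simp
  qed
  have "T' (i, Suc j) \<in> {Unbarred b, Barred a}"
  proof (rule ccontr)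
    assume n: "T' (i, Suc j) \<notin> {Unbarred b, Barred a}"
    then have "(Unbarred b, T' (i, Suc j)) \<in> s"
      using 3 vals r_iff(2)[of "T' (i, Suc j)"] s_iff_r[of "Unbarred b" "T' (i, Suc j)"]
        s_iff_r[of "Barred a" "T' (i, Suc j)"] by auto
    then have "T' (i, Suc j) = Unbarred b"
      using between_mono[OF orders(2) _ shuffle_order_linear(3)[OF orders(2) 2 1]] ne not_between_s[OF tame]
      by blast
    then show False using n by simp
  qed
  then have "(i, Suc j) \<in> mixed Y b a T'" using Y' by (auto simp: mixed_def)
  then show ?thesis unfolding mixed_T' .
qed

lemma ubword_rot: "ubword Y T lo hi \<approx> ubword Y T' lo hi"
proof -
  interpret chains M "nx M" content by (rule S_chains[OF Y T])
  \<comment> \<open>\<open>content\<close> is injective on the ribbon, so a property of a ribbon box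
    can be treated as a property of its diagonal.\<close>
  define K where "K d \<longleftrightarrow> (\<exists>c\<in>M. content c = d)" for d
  define R where "R d \<longleftrightarrow> (\<exists>i j. (i, j) \<in> M \<and> (i, Suc j) \<in> M \<and> content (i, j) = d)" for d
  define U where "U d \<longleftrightarrow> (\<exists>i j. (Suc i, j) \<in> M \<and> (i, j) \<in> M \<and> content (Suc i, j) = d)" for d
  define X where "X d \<longleftrightarrow> b \<in> diagset Y T d" for d
  define X' where "X' d \<longleftrightarrow> b \<in> diagset Y T' d" for d
  define y where "y d \<longleftrightarrow> (\<exists>c\<in>M. content c = d \<and>
    (\<exists>e. (c, e) \<in> (nx M)\<^sup>* \<and> e \<notin> Domain (nx M) \<and> T e = Unbarred b))" for d
  have inj: "c = c'" if "c \<in> M" "c' \<in> M" "content c = content c'" for c c'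
    using inj_content that by (auto dest: inj_onD)
  have X_box: "X (content c) \<longleftrightarrow> T c = Unbarred b" if "c \<in> M" for c
  proof
    assume "X (content c)"
    then obtain c' where c': "c' \<in> Y" "content c' = content c" "T c' = Unbarred b"
      by (auto simp: X_def diagset_def)
    then have "c' \<in> M" by (simp add: mixed_def)
    from inj[OF that this c'(2)[symmetric]] show "T c = Unbarred b" using c' by simp
  next
    assume "T c = Unbarred b"
    then show "X (content c)" using S_Y[OF Y T that] by (auto simp: X_def diagset_def)
  qed
  have X'_box: "X' (content c) \<longleftrightarrow> T' c = Unbarred b" if "c \<in> M" for c
  proof
    assume "X' (content c)"
    then obtain c' where c': "c' \<in> Y" "content c' = content c" "T' c' = Unbarred b"
      by (auto simp: X'_def diagset_def)
    then have "c' \<in> mixed Y b a T'" by (simp add: mixed_def)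
    then have "c' \<in> M" unfolding mixed_T' .
    from inj[OF that this c'(2)[symmetric]] show "T' c = Unbarred b" using c' by simp
  next
    assume "T' c = Unbarred b"
    then show "X' (content c)" using S_Y[OF Y T that] by (auto simp: X'_def diagset_def)
  qed
  have y_box: "y (content c) \<longleftrightarrow> T e = Unbarred b"
    if "c \<in> M" "(c, e) \<in> (nx M)\<^sup>*" "e \<notin> Domain (nx M)" for c e
  proof
    assume "y (content c)"
    then obtain c' e' where c': "c' \<in> M" "content c' = content c" "(c', e') \<in> (nx M)\<^sup>*"
      "e' \<notin> Domain (nx M)" "T e' = Unbarred b" by (auto simp: y_def)
    then have "c' = c" using inj that(1) by blast
    then show "T e = Unbarred b" using end_unique[of c e e'] c' that by simp
  next
    assume "T e = Unbarred b"
    then show "y (content c)" using that unfolding y_def by blast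
  qed
  have X_K: "K d" if "X d" for d
    using that by (auto simp: K_def X_def diagset_def mixed_def)
  have X'_K: "K d" if X: "X' d" for d
  proof -
    obtain c where "c \<in> Y" "content c = d" "T' c = Unbarred b"
      using X by (auto simp: X'_def diagset_def)
    then have "c \<in> mixed Y b a T'" by (simp add: mixed_def)
    then show ?thesis unfolding mixed_T' K_def using \<open>content c = d\<close> by blast
  qed
  have y_K: "K d" if "y d" for d
    using that by (auto simp: K_def y_def)
  have step_RU: "R (content c) \<or> U (content c)" if "(c, d) \<in> nx M" for c d
    using that
  proof (cases rule: nx_cases)
    case (right i j)
    then show ?thesis using nx_in[OF that] unfolding R_def by blast
  next
    case (up i j)
    then show ?thesis using nx_in[OF that] unfolding U_def by blast
  qed
  have RU_step: "\<exists>c e. (c, e) \<in> nx M \<and> content c = d \<and> content e = d + 1" if "R d \<or> U d" for d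
    using that
  proof
    assume "R d"
    then obtain i j where "(i, j) \<in> M" "(i, Suc j) \<in> M" "content (i, j) = d" unfolding R_def by blast
    then show ?thesis by (intro exI[of _ "(i, j)"] exI[of _ "(i, Suc j)"]) (auto simp: nx_def content_def)
  next
    assume "U d"
    then obtain i j where "(Suc i, j) \<in> M" "(i, j) \<in> M" "content (Suc i, j) = d" unfolding U_def by blast
    then show ?thesis by (intro exI[of _ "(Suc i, j)"] exI[of _ "(i, j)"]) (auto simp: nx_def content_def)
  qed
  have rotation: "block_rotation b lo hi (diagset Y T) K R U X X' y"
  proof
    show "finite (diagset Y T d)" for d by (rule finite_diagset[OF Y])
    show "lo \<le> d \<and> d \<le> hi" if "K d" for d
      using that range S_Y[OF Y T] by (auto simp: K_def)
    have RU_K: "K d \<and> K (d + 1)" if "R d \<or> U d" for d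
      using RU_step[OF that] nx_in unfolding K_def by blast
    then show "K d \<and> K (d + 1)" if "R d" for d using that by blast
    show "K d \<and> K (d + 1)" if "U d" for d using RU_K that by blast
    show "X d \<and> X' (d + 1)" if "R d" for d
    proof -
      obtain i j where ij: "(i, j) \<in> M" "(i, Suc j) \<in> M" "content (i, j) = d"
        using \<open>R d\<close> unfolding R_def by blast
      have "content (i, Suc j) = d + 1" using ij by (simp add: content_def)
      then show ?thesis
        using X_box[OF ij(1)] X'_box[OF ij(2)] T_right[OF Y T ij(1,2)]
          tableau_s_right[OF Y T', unfolded mixed_T', OF ij(1,2)] ij(3) by simp
    qed
    show "\<not> X d \<and> \<not> X' (d + 1)" if "U d" for d
    proof -
      obtain i j where ij: "(Suc i, j) \<in> M" "(i, j) \<in> M" "content (Suc i, j) = d"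
        using \<open>U d\<close> unfolding U_def by blast
      have "content (i, j) = d + 1" using ij by (simp add: content_def)
      then show ?thesis
        using X_box[OF ij(1)] X'_box[OF ij(2)] T_up[OF Y T ij(2,1)]
          tableau_s_up[OF Y T', unfolded mixed_T', OF ij(2,1)] ij(3) by simp
    qed
    show "x \<in> diagset Y T (d + 1)" if "R d" "x < b" "{x..<b} \<subseteq> diagset Y T d" for d x
    proof -
      obtain i j where ij: "(i, j) \<in> M" "(i, Suc j) \<in> M" "content (i, j) = d"
        using \<open>R d\<close> unfolding R_def by blast
      obtain p q where "content (p, q) = d" "(p, Suc q) \<in> Y" "T (p, Suc q) = Unbarred x"
        using row_below[OF \<open>x < b\<close> \<open>{x..<b} \<subseteq> diagset Y T d\<close> ij] by blast
      moreover from this have "content (p, Suc q) = d + 1" by (simp add: content_def)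
      ultimately show ?thesis unfolding diagset_def by blast
    qed
    show "x \<in> diagset Y T d" if "R d" "b < x" "{b<..x} \<subseteq> diagset Y T (d + 1)" for d x
    proof -
      obtain i j where ij: "(i, j) \<in> M" "(i, Suc j) \<in> M" "content (i, j) = d"
        using \<open>R d\<close> unfolding R_def by blast
      obtain p q where pq: "content (p, q) = d" "(p, Suc q) \<in> Y" "T' (p, q) = Unbarred x"
        using row_above[OF \<open>b < x\<close> \<open>{b<..x} \<subseteq> diagset Y T (d + 1)\<close> ij] by blast
      have "(p, q) \<in> Y" using pq(2) Y unfolding downset_def by (meson le_SucI order_refl)
      then have "x \<in> diagset Y T' d" using pq unfolding diagset_def by blast
      then show ?thesis using diagset_T'[of x] that(2) by simp
    qed
    show "R (d - 1)" if "K d" "Suc x = b" "x \<in> diagset Y T d" for d x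
    proof -
      obtain i j where ij: "(i, j) \<in> M" "content (i, j) = d" using \<open>K d\<close> by (auto simp: K_def)
      obtain j' where "j = Suc j'" "(i, j') \<in> M" using left_neighbour[OF ij \<open>Suc x = b\<close> \<open>x \<in> diagset Y T d\<close>] .
      then show ?thesis using ij unfolding R_def by (intro exI[of _ i] exI[of _ j']) (auto simp: content_def)
    qed
    show "R d" if "K d" "Suc b \<in> diagset Y T d" for d
    proof -
      obtain i j where ij: "(i, j) \<in> M" "content (i, j) = d" using \<open>K d\<close> by (auto simp: K_def)
      then show ?thesis using right_neighbour[OF ij that(2)] unfolding R_def by blast
    qed
    show "y d = y (d + 1)" if "R d \<or> U d" for d
    proof -
      obtain c e where ce: "(c, e) \<in> nx M" "content c = d" "content e = d + 1"
        using RU_step[OF \<open>R d \<or> U d\<close>] by blast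
      have M: "c \<in> M" "e \<in> M" using nx_in[OF ce(1)] by auto
      obtain z where z: "(e, z) \<in> (nx M)\<^sup>*" "z \<notin> Domain (nx M)" "z \<in> M"
        using end_exists[OF M(2)] .
      have "(c, z) \<in> (nx M)\<^sup>*" using ce(1) z(1) by (rule converse_rtrancl_into_rtrancl)
      then show ?thesis using y_box[OF M(1) _ z(2)] y_box[OF M(2) z(1,2)] ce by simp
    qed
    show "y d = X d \<and> X' (d + 1) = y (d + 1)" if "\<not> R d" "\<not> U d" for d
    proof
      show "y d = X d"
      proof (cases "K d")
        case True
        then obtain c where c: "c \<in> M" "content c = d" by (auto simp: K_def)
        then have "c \<notin> Domain (nx M)" using step_RU that by (metis DomainE)
        then show ?thesis using y_box[OF c(1), of c] X_box[OF c(1)] c(2) by simp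
      next
        case False
        then show ?thesis using X_K y_K by blast
      qed
      show "X' (d + 1) = y (d + 1)"
      proof (cases "K (d + 1)")
        case True
        then obtain c where c: "c \<in> M" "content c = d + 1" by (auto simp: K_def)
        have nr: "c \<notin> Range (nx M)"
        proof
          assume "c \<in> Range (nx M)"
          then obtain p where p: "(p, c) \<in> nx M" by blast
          then have "content p = d" using nx_content[OF p] c(2) by simp
          then show False using step_RU[OF p] that by simp
        qed
        obtain z where z: "(c, z) \<in> (nx M)\<^sup>*" "z \<notin> Domain (nx M)" "z \<in> M"
          using end_exists[OF c(1)] .
        then show ?thesis
          using y_box[OF c(1) z(1,2)] X'_box[OF c(1)] c(2) rot_start[OF Y T c(1) nr z(1,2)] by simp
      next
        case False
        then show ?thesis using X'_K y_K by blast
      qed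
    qed
  qed
  have "ubword Y T lo hi = concat (map (\<lambda>d. block b (diagset Y T d) (X d)) [lo..hi])"
    unfolding ubword_def X_def using desc_eq_block[OF finite_diagset[OF Y]] by metis
  moreover have "ubword Y T' lo hi = concat (map (\<lambda>d. block b (diagset Y T d) (X' d)) [lo..hi])"
  proof -
    have "{x \<in> diagset Y T' d. b < x} = {x \<in> diagset Y T d. b < x}"
      "{x \<in> diagset Y T' d. x < b} = {x \<in> diagset Y T d. x < b}" for d
      using diagset_T' by auto
    then have "block b (diagset Y T' d) p = block b (diagset Y T d) p" for d p
      by (simp add: block_def)
    then show ?thesis unfolding ubword_def X'_def using desc_eq_block[OF finite_diagset[OF Y]] by metis
  qed
  ultimately show ?thesis using block_rotation.word_rotation[OF rotation] by simp
qed

end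

end


section \<open>Two sequences of swaps\<close>

text \<open>A pair \<open>(b, a)\<close> in \<open>D\<close> means that \<open>a\<close> (barred) precedes \<open>b\<close>.\<close>

fun cut_le :: "(nat \<times> nat) set \<Rightarrow> letter \<Rightarrow> letter \<Rightarrow> bool" where
  "cut_le D (Unbarred x) (Unbarred y) \<longleftrightarrow> x \<le> y"
| "cut_le D (Barred x) (Barred y) \<longleftrightarrow> x \<le> y"
| "cut_le D (Unbarred x) (Barred y) \<longleftrightarrow> (x, y) \<notin> D"
| "cut_le D (Barred y) (Unbarred x) \<longleftrightarrow> (x, y) \<in> D"

definition cut_order :: "nat \<Rightarrow> (nat \<times> nat) set \<Rightarrow> letter rel" where
  "cut_order N D = {(x, y). x \<in> alphabet N \<and> y \<in> alphabet N \<and> cut_le D x y}"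

text \<open>Inversions form a staircase: if \<open>a\<close> (barred) precedes \<open>b\<close>,
  every smaller barred letter precedes every larger unbarred one. This is what makes
  \<open>cut_order\<close> transitive.\<close>

definition cut :: "nat \<Rightarrow> (nat \<times> nat) set \<Rightarrow> bool" where
  "cut N D \<longleftrightarrow> (\<forall>b a b' a'. (b, a) \<in> D \<longrightarrow> b \<le> b' \<longrightarrow> b' \<le> N \<longrightarrow> 1 \<le> a' \<longrightarrow> a' \<le> a \<longrightarrow> (b', a') \<in> D)"

lemma shuffle_order_cut_order:
  assumes "cut N D"
  shows "shuffle_order N (cut_order N D)"
proof (rule shuffle_orderI)
  have D: "(b', a') \<in> D" if "(b, a) \<in> D" "b \<le> b'" "b' \<le> N" "1 \<le> a'" "a' \<le> a" for b a b' a'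
    using assms that unfolding cut_def by blast
  show "(x, z) \<in> cut_order N D" if "(x, y) \<in> cut_order N D" "(y, z) \<in> cut_order N D" for x y z
  proof -
    have al: "x \<in> alphabet N" "y \<in> alphabet N" "z \<in> alphabet N"
      and le: "cut_le D x y" "cut_le D y z"
      using that by (auto simp: cut_order_def)
    have "cut_le D x z"
      using al le D by (cases x; cases y; cases z) (simp_all, (metis nat_le_linear)+)
    then show ?thesis using al by (simp add: cut_order_def)
  qed
  show "x = y" if "(x, y) \<in> cut_order N D" "(y, x) \<in> cut_order N D" for x y
    using that by (cases x; cases y) (auto simp: cut_order_def)
  show "(x, y) \<in> cut_order N D \<or> (y, x) \<in> cut_order N D"
    if "x \<in> alphabet N" "y \<in> alphabet N" for x y
    using that by (cases x; cases y) (auto simp: cut_order_def)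
  show "(x, x) \<in> cut_order N D" if "x \<in> alphabet N" for x
    using that by (cases x) (auto simp: cut_order_def)
qed (auto simp: cut_order_def)

lemma swap_up_cut_order:
  assumes "cut N D" "cut N (insert (b, a) D)" "(b, a) \<notin> D" "1 \<le> b" "b \<le> N" "1 \<le> a" "a \<le> N"
  shows "swap_up N b a (cut_order N D) (cut_order N (insert (b, a) D))"
proof -
  have D: "(b', a') \<in> D" if "b \<le> b'" "b' \<le> N" "1 \<le> a'" "a' \<le> a" "(b', a') \<noteq> (b, a)" for b' a'
    using assms(2) that unfolding cut_def by blast
  have "\<not> (lt (cut_order N D) (Unbarred b) c \<and> lt (cut_order N D) c (Barred a))" for c
  proof (cases c)
    case (Unbarred n)
    then show ?thesis using D[of n a] assms(6) by (auto simp: lt_def cut_order_def)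
  next
    case (Barred n)
    then show ?thesis using D[of b n] assms(5) by (auto simp: lt_def cut_order_def)
  qed
  moreover have "p \<in> cut_order N (insert (b, a) D) \<longleftrightarrow>
      p \<in> insert (Barred a, Unbarred b) (cut_order N D - {(Unbarred b, Barred a)})" for p
  proof -
    obtain x y where "p = (x, y)" by (cases p)
    then show ?thesis using assms(3-) by (cases x; cases y) (auto simp: cut_order_def)
  qed
  ultimately show ?thesis
    unfolding swap_up_def using shuffle_order_cut_order[OF assms(1)] shuffle_order_cut_order[OF assms(2)] assms(3-)
    by (auto simp: lt_def cut_order_def)
qed

lemma cut_order_empty: "cut_order N {} = big_bar_order N"
proof -
  have "cut_le {} x y = big_bar_le x y" for x y by (cases x; cases y) auto
  then show ?thesis by (simp add: cut_order_def big_bar_order_def)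
qed

text \<open>The inversions of the natural order relative to the big bar order.\<close>

definition cells :: "nat \<Rightarrow> (nat \<times> nat) set" where
  "cells N = {(b, a). 1 \<le> a \<and> a < b \<and> b \<le> N}"

lemma cut_order_cells: "cut_order N (cells N) = natural_order N"
proof -
  have "cut_le (cells N) x y = natural_le x y" if "x \<in> alphabet N" "y \<in> alphabet N" for x y
    using that by (cases x; cases y) (auto simp: cells_def)
  then show ?thesis by (auto simp: cut_order_def natural_order_def)
qed

text \<open>A \<open>key\<close> lists the cells so that every initial part is a cut; the cells can
  then be swapped one at a time.\<close>

locale sweep =
  fixes N :: nat and key :: "nat \<Rightarrow> nat \<Rightarrow> nat"
  assumes key_inj: "(b, a) \<in> cells N \<Longrightarrow> (b', a') \<in> cells N \<Longrightarrow> key b a = key b' a' \<Longrightarrow> b = b' \<and> a = a'"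
    and key_mono: "(b, a) \<in> cells N \<Longrightarrow> (b', a') \<in> cells N \<Longrightarrow> b \<le> b' \<Longrightarrow> a' \<le> a \<Longrightarrow> key b' a' \<le> key b a"
begin

definition swept :: "nat \<Rightarrow> (nat \<times> nat) set" where
  "swept k = {(b, a). (b, a) \<in> cells N \<and> key b a < k}"

lemma cut_swept: "cut N (swept k)"
  unfolding cut_def
proof (intro allI impI)
  fix b a b' a' assume *: "(b, a) \<in> swept k" "b \<le> b'" "b' \<le> N" "1 \<le> a'" "a' \<le> a"
  then have "(b', a') \<in> cells N" by (auto simp: swept_def cells_def)
  then show "(b', a') \<in> swept k" using key_mono[of b a b' a'] * by (auto simp: swept_def)
qed

text \<open>The values of \<open>key\<close> may have gaps, at which the order stays put.\<close>

lemma swept_Suc_cases: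
  obtains "swept (Suc k) = swept k"
  | b a where "(b, a) \<in> cells N" "key b a = k" "swept (Suc k) = insert (b, a) (swept k)"
      "swap_up N b a (cut_order N (swept k)) (cut_order N (swept (Suc k)))"
proof (cases "\<exists>b a. (b, a) \<in> cells N \<and> key b a = k")
  case True
  then obtain b a where ba: "(b, a) \<in> cells N" "key b a = k" by blast
  have e: "swept (Suc k) = insert (b, a) (swept k)"
    using ba key_inj by (auto simp: swept_def less_Suc_eq)
  have "swap_up N b a (cut_order N (swept k)) (cut_order N (insert (b, a) (swept k)))"
    by (rule swap_up_cut_order) (use cut_swept[of k] cut_swept[of "Suc k"] e ba in \<open>auto simp: swept_def cells_def\<close>)
  then show ?thesis using that(2) ba e by simp
next
  case False
  then have "swept (Suc k) = swept k" by (auto simp: swept_def less_Suc_eq)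
  then show ?thesis using that(1) by blast
qed

lemma swept_0: "cut_order N (swept 0) = big_bar_order N"
  using cut_order_empty by (simp add: swept_def)

lemma swept_all: "\<exists>k. cut_order N (swept k) = natural_order N"
proof -
  have "finite (cells N)"
    by (rule finite_subset[of _ "{..N} \<times> {..N}"]) (auto simp: cells_def)
  then have "finite ((\<lambda>(b, a). key b a) ` cells N)" by simp
  then obtain k where "\<forall>n\<in>(\<lambda>(b, a). key b a) ` cells N. n < k"
    using finite_nat_set_iff_bounded by metis
  then have "swept k = cells N" by (auto simp: swept_def)
  then show ?thesis using cut_order_cells by metis
qed

lemma sweep_sequence: "\<exists>rs. swap_sequence N (big_bar_order N) (cut_order N (swept k)) rs"
proof (induction k)
  case 0
  show ?case by (intro exI[of _ "[big_bar_order N]"]) (simp add: swap_sequence_def swept_0)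
next
  case (Suc k)
  then obtain rs where rs: "swap_sequence N (big_bar_order N) (cut_order N (swept k)) rs" by blast
  show ?case
  proof (cases rule: swept_Suc_cases[of k])
    case 1
    then show ?thesis using rs by auto
  next
    case (2 b a)
    then have "letter_swap N b a (cut_order N (swept k)) (cut_order N (swept (Suc k)))"
      by (simp add: letter_swap_def)
    then have "swap_sequence N (big_bar_order N) (cut_order N (swept (Suc k))) (rs @ [cut_order N (swept (Suc k))])"
      using rs by (auto simp: swap_sequence_def successively_append_iff)
    then show ?thesis by blast
  qed
qed

text \<open>\<open>Q\<close> stands for whatever the swaps of this sweep preserve: later the local
  plactic class of the unbarred or of the barred word.\<close>

lemma sweep_up:
  assumes Y: "downset Y" and T0: "tableau N Y (big_bar_order N) T0" "T0 \<in> extensional Y"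
    and Q: "Q T0 T0" "\<And>k b a T. (b, a) \<in> cells N \<Longrightarrow> key b a = k \<Longrightarrow>
      swap_up N b a (cut_order N (swept k)) (cut_order N (insert (b, a) (swept k))) \<Longrightarrow>
      tableau N Y (cut_order N (swept k)) T \<Longrightarrow> Q T0 T \<Longrightarrow> Q T0 (rot Y b a T)"
  shows "\<exists>T. reach N Y T0 (cut_order N (swept k)) T \<and> tableau N Y (cut_order N (swept k)) T \<and>
    T \<in> extensional Y \<and> Q T0 T"
proof (induction k)
  case 0
  show ?case using T0 Q(1) reach_base unfolding swept_0 by blast
next
  case (Suc k)
  then obtain T where T: "reach N Y T0 (cut_order N (swept k)) T" "tableau N Y (cut_order N (swept k)) T"
    "T \<in> extensional Y" "Q T0 T" by blast
  show ?case
  proof (cases rule: swept_Suc_cases[of k])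
    case 1
    then show ?thesis using T by auto
  next
    case (2 b a)
    interpret letter_pair N "cut_order N (swept k)" "cut_order N (swept (Suc k))" b a
      using 2 by unfold_locales
    have "Q T0 (rot Y b a T)" using Q(2)[OF 2(1,2)] 2(3,4) T by simp
    then show ?thesis
      using reach_up[OF T(1) 2(4) T(2)] rot_tableau[OF Y T(2)] rot_extensional[OF Y T(2)] T(3) by blast
  qed
qed

lemma sweep_down:
  assumes Y: "downset Y"
  shows "tableau N Y (cut_order N (swept k)) T \<Longrightarrow> T \<in> extensional Y \<Longrightarrow>
    \<exists>T0. tableau N Y (big_bar_order N) T0 \<and> T0 \<in> extensional Y \<and> reach N Y T0 (cut_order N (swept k)) T"
proof (induction k arbitrary: T)
  case 0
  then show ?case using reach_base unfolding swept_0 by blast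
next
  case (Suc k)
  show ?case
  proof (cases rule: swept_Suc_cases[of k])
    case 1
    then show ?thesis using Suc by auto
  next
    case (2 b a)
    interpret letter_pair N "cut_order N (swept k)" "cut_order N (swept (Suc k))" b a
      using 2 by unfold_locales
    obtain T1 where T1: "tableau N Y (cut_order N (swept k)) T1" "rot Y b a T1 = T"
      using rot_surj[OF Y Suc.prems(1)] .
    then have "T1 \<in> extensional Y" using rot_extensional[OF Y T1(1)] Suc.prems(2) by simp
    then obtain T0 where "tableau N Y (big_bar_order N) T0" "T0 \<in> extensional Y"
      "reach N Y T0 (cut_order N (swept k)) T1" using Suc.IH[OF T1(1)] by blast
    then show ?thesis using reach_up[OF _ 2(4) T1(1)] T1(2) by blast
  qed
qed

end

lemma lex_less:
  fixes x y u v n :: nat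
  assumes "u \<le> n" "v \<le> n"
  shows "x * Suc n + u < y * Suc n + v \<longleftrightarrow> x < y \<or> x = y \<and> u < v"
proof (cases x y rule: linorder_cases)
  case less
  then have "Suc x * Suc n \<le> y * Suc n" by (intro mult_le_mono1) simp
  then show ?thesis using assms less by simp
next
  case greater
  then have "Suc y * Suc n \<le> x * Suc n" by (intro mult_le_mono1) simp
  then show ?thesis using assms greater by simp
qed simp

lemma lex_eq:
  fixes x y u v n :: nat
  assumes "u \<le> n" "v \<le> n" "x * Suc n + u = y * Suc n + v"
  shows "x = y \<and> u = v"
  using lex_less[OF assms(1,2), of x y] lex_less[OF assms(2,1), of y x] assms(3)
  by (metis add_left_cancel linorder_neqE_nat less_irrefl)

text \<open>A two-digit number in base \<open>Suc N\<close>. The barred letters are treated in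
  increasing order, each descending past \<open>N\<close>, \<open>N - 1\<close> and so on until it
  directly follows its unbarred namesake.\<close>

definition column_key :: "nat \<Rightarrow> nat \<Rightarrow> nat \<Rightarrow> nat" where
  "column_key N b a = a * Suc N + (N - b)"

text \<open>The unbarred letters are treated from \<open>N\<close> downwards, each climbing past the
  barred \<open>1\<close>, \<open>2\<close> and so on.\<close>

definition row_key :: "nat \<Rightarrow> nat \<Rightarrow> nat \<Rightarrow> nat" where
  "row_key N b a = (N - b) * Suc N + a"

lemma column_key_less:
  "column_key N b a < column_key N b' a' \<longleftrightarrow> a < a' \<or> a = a' \<and> N - b < N - b'"
  unfolding column_key_def by (rule lex_less) auto

lemma row_key_less:
  "a \<le> N \<Longrightarrow> a' \<le> N \<Longrightarrow> row_key N b a < row_key N b' a' \<longleftrightarrow> N - b < N - b' \<or> N - b = N - b' \<and> a < a'"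
  unfolding row_key_def by (rule lex_less) auto

lemma sweep_column: "sweep N (column_key N)"
proof
  fix b a b' a' assume c: "(b, a) \<in> cells N" "(b', a') \<in> cells N"
  show "b = b' \<and> a = a'" if "column_key N b a = column_key N b' a'"
    using lex_eq[of "N - b" N "N - b'" a a'] that c unfolding column_key_def cells_def by auto
  show "column_key N b' a' \<le> column_key N b a" if "b \<le> b'" "a' \<le> a"
    using column_key_less[of N b a b' a'] that c by (auto simp: cells_def)
qed

lemma sweep_row: "sweep N (row_key N)"
proof
  fix b a b' a' assume c: "(b, a) \<in> cells N" "(b', a') \<in> cells N"
  show "b = b' \<and> a = a'" if "row_key N b a = row_key N b' a'"
    using lex_eq[of a N a' "N - b" "N - b'"] that c unfolding row_key_def cells_def by auto
  show "row_key N b' a' \<le> row_key N b a" if "b \<le> b'" "a' \<le> a"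
    using row_key_less[of a N a' b b'] that c by (auto simp: cells_def)
qed

interpretation col: sweep N "column_key N" for N by (rule sweep_column)
interpretation row: sweep N "row_key N" for N by (rule sweep_row)

text \<open>Just before this swap the smaller barred letters stand directly above their namesakes,
  \<open>a\<close> (barred) directly above \<open>b\<close>, and the larger ones after all unbarred
  letters. As \<open>a < b\<close>, no gap holds two of them and the gap below \<open>b\<close> is
  empty.\<close>

lemma tame_column:
  assumes "(b, a) \<in> cells N"
  shows "tame (cut_order N (col.swept N (column_key N b a))) b"
proof -
  have btw: "c = x \<and> c < a \<or> x = b \<and> c = a \<or> c = x \<and> c = a \<and> b < Suc x"
    if "between (cut_order N (col.swept N (column_key N b a))) x c" for x c
    using that assms
    by (auto simp: between_def cut_order_def col.swept_def column_key_less cells_def)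
  show ?thesis unfolding tame_def
    using btw assms by (auto simp: cells_def) (metis less_Suc_eq less_asym less_irrefl)+
qed

text \<open>Just after this swap \<open>b\<close> stands directly above \<open>a\<close> (barred),
  each larger unbarred \<open>c\<close> between the barred \<open>c - 1\<close> and
  \<open>c\<close>, and the smaller ones before all barred letters. As \<open>a < b\<close>, no gap
  between barred letters holds two of them and the gap below \<open>a\<close> (barred) is
  empty.\<close>

lemma tame_row:
  assumes "(b, a) \<in> cells N"
  shows "tame (dual_order (cut_order N (insert (b, a) (row.swept N (row_key N b a))))) a"
proof -
  have btw: "c = Suc x \<and> (b < c \<or> c = b) \<or> x = a \<and> c = b"
    if "between (dual_order (cut_order N (insert (b, a) (row.swept N (row_key N b a))))) x c" for x c
    using that assms
    by (auto simp: between_def cut_order_def row.swept_def row_key_less cells_def)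
  show ?thesis unfolding tame_def
    using btw assms by (auto simp: cells_def) (metis less_Suc_eq less_asym less_irrefl)+
qed


section \<open>Reading words and the theorem\<close>

definition diag_step :: "box \<Rightarrow> box \<Rightarrow> bool" where
  "diag_step c d \<longleftrightarrow> fst c < fst d \<and> snd c < snd d"

lemma diagonal_row:
  "concat (map (\<lambda>j. if int j - int i = d then [(i, j)] else []) [0..<m])
    = (if 0 \<le> d + int i \<and> d + int i < int m then [(i, nat (d + int i))] else [])"
  by (induction m) auto

lemma diagonal_alt:
  "diagonal \<nu> d = concat (map (\<lambda>i. if 0 \<le> d + int i \<and> d + int i < int (\<nu> ! i)
     then [(i, nat (d + int i))] else []) [0..<length \<nu>])"
  unfolding diagonal_def by (simp add: diagonal_row)

lemma set_diagonal: "set (diagonal \<nu> d) = {c \<in> young_diagram \<nu>. content c = d}"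
  unfolding diagonal_def young_diagram_def content_def by (auto split: if_splits)

lemma sorted_diagonal: "sorted_wrt diag_step (diagonal \<nu> d)"
proof -
  let ?g = "\<lambda>i. if 0 \<le> d + int i \<and> d + int i < int (\<nu> ! i) then [(i, nat (d + int i))] else []"
  have "sorted_wrt diag_step (concat (map ?g [0..<n]))" for n
  proof (induction n)
    case (Suc n)
    have "sorted_wrt diag_step (?g n)" by simp
    moreover have "\<forall>c\<in>set (concat (map ?g [0..<n])). \<forall>c'\<in>set (?g n). diag_step c c'"
      by (auto simp: diag_step_def split: if_splits)
    ultimately show ?case using Suc by (simp add: sorted_wrt_append)
  qed simp
  then show ?thesis unfolding diagonal_alt by blast
qed

lemma filter_unbarred_eq:
  assumes "sorted_wrt (\<lambda>x y. \<forall>n m. x = Unbarred n \<longrightarrow> y = Unbarred m \<longrightarrow> m < n) xs"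
  shows "filter is_unbarred xs = map Unbarred (desc {n. Unbarred n \<in> set xs})"
proof -
  define us where "us = map (\<lambda>x. case x of Unbarred n \<Rightarrow> n | _ \<Rightarrow> 0) (filter is_unbarred xs)"
  have e: "filter is_unbarred xs = map Unbarred us"
    unfolding us_def map_map by (rule map_idI[symmetric]) (auto split: letter.splits)
  have s: "set us = {n. Unbarred n \<in> set xs}"
    using arg_cong[OF e, of set] by (auto simp: set_eq_iff image_iff)
  have "sorted_wrt (\<lambda>x y. \<forall>n m. x = Unbarred n \<longrightarrow> y = Unbarred m \<longrightarrow> m < n) (map Unbarred us)"
    unfolding e[symmetric] by (rule sorted_wrt_filter[OF assms])
  then have "sorted_wrt (>) us" by (simp add: sorted_wrt_map)
  then show ?thesis using e s desc_unique by metis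
qed

text \<open>The comparison goes through the corner \<open>(k, j)\<close>, and its column step is
  already strict for an unbarred letter.\<close>

lemma diag_unbarred_strict:
  assumes r: "shuffle_order N r" and Y: "downset Y" and T: "tableau N Y r T"
    and cd: "c \<in> Y" "d \<in> Y" "diag_step c d" "T c = Unbarred n" "T d = Unbarred m"
  shows "n < m"
proof -
  obtain i j k l where e: "c = (i, j)" "d = (k, l)" "i < k" "j < l"
    using cd(3) by (cases c; cases d) (auto simp: diag_step_def)
  have Y': "(k, j) \<in> Y" using cd(2) e Y unfolding downset_def by (meson less_imp_le order_refl)
  have 1: "(T c, T (k, j)) \<in> r" "(T (k, j), T d) \<in> r" "T c \<noteq> T (k, j)"
    using tableau_mono[OF r T Y, of i j k j] tableau_mono[OF r T Y, of k j k l]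
      tableau_col[OF T e(3), of j] cd e Y' by auto
  have "(T c, T d) \<in> r" by (rule shuffle_order_linear(3)[OF r 1(1,2)])
  moreover have "T c \<noteq> T d"
    using shuffle_order_linear(4)[OF r 1(1)] 1(2,3) by metis
  ultimately show ?thesis
    using cd(4,5) shuffle_order_iff(1)[OF r, of n m] tableau_alphabet[OF T cd(1)] tableau_alphabet[OF T cd(2)]
    by auto
qed

lemma rev_upto: "rev [i..j] = map uminus [- j..- i]"
proof (induction "nat (j - i + 1)" arbitrary: j)
  case (Suc n)
  then have "[i..j] = [i..j - 1] @ [j]" "[- j..- i] = - j # [- j + 1..- i]"
    by (intro upto_rec1 upto_rec2; simp)+
  moreover have "- (j - 1) = - j + 1" by simp
  ultimately show ?case using Suc.hyps(1)[of "j - 1"] Suc.hyps(2) by simp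
qed simp

lemma mem_image_iff: "y \<in> f ` A \<longleftrightarrow> (\<exists>x\<in>A. f x = y)"
  by blast

lemma not_unbarred_and_barred: "is_unbarred x \<Longrightarrow> \<not> is_barred x"
  by (cases x) auto

lemma content_swap [simp]: "content (prod.swap c) = - content c"
  by (simp add: content_def)

context
  fixes N r \<nu> T
  assumes r: "shuffle_order N r" and \<nu>: "is_partition \<nu>" and T: "tableau N (young_diagram \<nu>) r T"
begin

lemma unbarred_diagonal:
  "filter is_unbarred (map T (rev (diagonal \<nu> d))) = map Unbarred (desc (diagset (young_diagram \<nu>) T d))"
proof -
  note Y = downset_young_diagram[OF \<nu>]
  have "sorted_wrt (\<lambda>x y. \<forall>n m. x = Unbarred n \<longrightarrow> y = Unbarred m \<longrightarrow> m < n) (map T (rev (diagonal \<nu> d)))"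
    unfolding sorted_wrt_map sorted_wrt_rev
    by (rule sorted_wrt_mono_rel[OF _ sorted_diagonal])
       (use diag_unbarred_strict[OF r Y T] set_diagonal in auto)
  from filter_unbarred_eq[OF this]
  have "filter is_unbarred (map T (rev (diagonal \<nu> d)))
    = map Unbarred (desc {n. Unbarred n \<in> set (map T (rev (diagonal \<nu> d)))})" .
  moreover have "{n. Unbarred n \<in> set (map T (rev (diagonal \<nu> d)))} = diagset (young_diagram \<nu>) T d"
    unfolding set_map set_rev set_diagonal diagset_def mem_image_iff by blast
  ultimately show ?thesis by simp
qed

text \<open>Transposition negates contents. The barred letters increase southeastward, so they are
  the decreasing word of the dual diagonal \<open>- d\<close> read backwards.\<close>

lemma barred_diagonal:
  "filter is_barred (map T (diagonal \<nu> d))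
    = map Barred (rev (desc (diagset (prod.swap ` young_diagram \<nu>) (dual_filling T) (- d))))"
proof -
  note Y = downset_swap[OF downset_young_diagram[OF \<nu>]]
  let ?xs = "map (flip \<circ> T) (rev (diagonal \<nu> d))"
  have strict: "n < m" if "c \<in> young_diagram \<nu>" "c' \<in> young_diagram \<nu>" "diag_step c c'"
    "flip (T c) = Unbarred n" "flip (T c') = Unbarred m" for c c' n m
    using diag_unbarred_strict[OF shuffle_order_dual[OF r] Y tableau_dual[OF T],
        of "prod.swap c" "prod.swap c'" n m] that
    by (auto simp: dual_filling_def diag_step_def)
  have "sorted_wrt (\<lambda>x y. \<forall>n m. x = Unbarred n \<longrightarrow> y = Unbarred m \<longrightarrow> m < n) ?xs"
    unfolding sorted_wrt_map sorted_wrt_rev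
    by (rule sorted_wrt_mono_rel[OF _ sorted_diagonal]) (use strict set_diagonal in \<open>auto simp del: flip_eq\<close>)
  from filter_unbarred_eq[OF this]
  have 1: "filter is_unbarred ?xs = map Unbarred (desc {n. Unbarred n \<in> set ?xs})" .
  have 2: "{n. Unbarred n \<in> set ?xs} = diagset (prod.swap ` young_diagram \<nu>) (dual_filling T) (- d)"
    unfolding set_map set_rev set_diagonal diagset_def mem_image_iff bex_simps(7) dual_filling_def
    by auto
  have "filter is_barred (map T (diagonal \<nu> d)) = map flip (rev (filter is_unbarred ?xs))"
    by (simp add: filter_map rev_filter[symmetric] rev_map[symmetric] comp_def)
  then show ?thesis unfolding 1 2 by (simp add: rev_map)
qed

lemma unbarred_sqread:
  "filter is_unbarred (sqread \<nu> T)
    = map Unbarred (ubword (young_diagram \<nu>) T (1 - int (length \<nu>)) (int (hd \<nu>) - 1))"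
proof -
  have "filter is_unbarred (filter is_barred xs) = []" for xs
    by (auto simp: filter_empty_conv dest: not_unbarred_and_barred)
  then show ?thesis
    unfolding sqread_def ubword_def filter_concat map_map comp_def map_concat
    using unbarred_diagonal by simp
qed

text \<open>Negating contents also reverses the list of diagonals, so the whole barred word is a
  reversed dual word, the form that \<open>barred_swap\<close> works with.\<close>

lemma barred_sqread:
  "filter is_barred (sqread \<nu> T)
    = map Barred (rev (ubword (prod.swap ` young_diagram \<nu>) (dual_filling T)
        (1 - int (hd \<nu>)) (int (length \<nu>) - 1)))"
proof -
  have "filter is_barred (filter is_unbarred xs) = []" for xs
    by (auto simp: filter_empty_conv dest: not_unbarred_and_barred)
  then have "filter is_barred (sqread \<nu> T) = concat (map (\<lambda>d. map Barred (rev (desc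
      (diagset (prod.swap ` young_diagram \<nu>) (dual_filling T) (- d))))) [1 - int (length \<nu>)..int (hd \<nu>) - 1])"
    unfolding sqread_def filter_concat map_map comp_def using barred_diagonal by simp
  also have "\<dots> = map Barred (rev (ubword (prod.swap ` young_diagram \<nu>) (dual_filling T)
        (1 - int (hd \<nu>)) (int (length \<nu>) - 1)))"
    unfolding ubword_def rev_concat rev_map map_concat rev_upto
    by (simp add: comp_def)
  finally show ?thesis .
qed

end

lemma content_range:
  assumes "is_partition \<nu>" "c \<in> young_diagram \<nu>"
  shows "1 - int (length \<nu>) \<le> content c" "content c \<le> int (hd \<nu>) - 1"
proof -
  obtain i j where c: "c = (i, j)" by (cases c)
  have "(0, j) \<in> young_diagram \<nu>"
    using downset_young_diagram[OF assms(1)] assms(2) c unfolding downset_def by (meson le0 order_refl)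
  then have "j < hd \<nu>" by (auto simp: young_diagram_def hd_conv_nth)
  moreover have "i < length \<nu>" using assms(2) c by (simp add: young_diagram_def)
  ultimately show "1 - int (length \<nu>) \<le> content c" "content c \<le> int (hd \<nu>) - 1"
    by (auto simp: content_def c)
qed

lemma shuffle_order_big_bar: "shuffle_order N (big_bar_order N)"
  using shuffle_order_cut_order[OF col.cut_swept] col.swept_0 by metis

lemma shuffle_order_natural: "shuffle_order N (natural_order N)"
  using shuffle_order_cut_order[OF col.cut_swept] col.swept_all by metis

section \<open>The conversion from the big bar order to the natural order\<close>

context
  fixes N :: nat and \<nu> :: "nat list"
  assumes \<nu>: "is_partition \<nu>"
begin

abbreviation (input) "Y \<equiv> young_diagram \<nu>"
abbreviation (input) "conv' \<equiv> conv N \<nu> (big_bar_order N) (natural_order N)"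

lemma reach_conv:
  assumes "T \<in> CT N (big_bar_order N) \<nu>"
  shows "reach N Y T (natural_order N) (conv' T)" "conv' T \<in> CT N (natural_order N) \<nu>"
proof -
  let ?rs = "SOME rs. swap_sequence N (big_bar_order N) (natural_order N) rs"
  \<comment> \<open>The column sweep shows that the choice in \<open>conv\<close> has a
    witness.\<close>
  obtain k where "cut_order N (col.swept N k) = natural_order N" using col.swept_all by blast
  then have "\<exists>rs. swap_sequence N (big_bar_order N) (natural_order N) rs"
    using col.sweep_sequence by metis
  then have rs: "swap_sequence N (big_bar_order N) (natural_order N) ?rs" by (rule someI_ex)
  then have "hd ?rs = big_bar_order N" "last ?rs = natural_order N" by (simp_all add: swap_sequence_def)
  then show "reach N Y T (natural_order N) (conv' T)" "conv' T \<in> CT N (natural_order N) \<nu>"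
    using reach_conv_along[OF \<nu>, of ?rs N T T] reach_base[of N Y T] rs assms
    unfolding conv_def swap_sequence_def by auto
qed

text \<open>This permits computing \<open>conv'\<close> along one sweep for the unbarred word and
  along another for the barred word.\<close>

lemma conv_unique:
  assumes "T \<in> CT N (big_bar_order N) \<nu>" "reach N Y T (natural_order N) T'" "T' \<in> CT N (natural_order N) \<nu>"
  shows "conv' T = T'"
  using natural_unique[OF reach_conv(1)[OF assms(1)] assms(2) downset_young_diagram[OF \<nu>]]
    reach_conv(2)[OF assms(1)] assms(3) by (auto simp: CT_iff)

lemma ubword_conv:
  assumes T: "T \<in> CT N (big_bar_order N) \<nu>"
    and range: "\<And>c. c \<in> Y \<Longrightarrow> lo \<le> content c \<and> content c \<le> hi"
  shows "ubword Y T lo hi \<approx> ubword Y (conv' T) lo hi"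
proof -
  note Y = downset_young_diagram[OF \<nu>]
  obtain k where k: "cut_order N (col.swept N k) = natural_order N" using col.swept_all by blast
  have "\<exists>T1. reach N Y T (cut_order N (col.swept N k)) T1 \<and> tableau N Y (cut_order N (col.swept N k)) T1 \<and>
    T1 \<in> extensional Y \<and> ubword Y T lo hi \<approx> ubword Y T1 lo hi"
  proof (rule col.sweep_up[OF Y])
    fix k b a T1
    assume ba: "(b, a) \<in> cells N" "column_key N b a = k"
      and sw: "swap_up N b a (cut_order N (col.swept N k)) (cut_order N (insert (b, a) (col.swept N k)))"
      and T1: "tableau N Y (cut_order N (col.swept N k)) T1" "ubword Y T lo hi \<approx> ubword Y T1 lo hi"
    interpret letter_pair N "cut_order N (col.swept N k)" "cut_order N (insert (b, a) (col.swept N k))" b a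
      using sw by unfold_locales
    have "tame (cut_order N (col.swept N k)) b" using tame_column[OF ba(1)] ba(2) by simp
    from ubword_rot[OF Y T1(1) this range]
    show "ubword Y T lo hi \<approx> ubword Y (rot Y b a T1) lo hi" using T1(2) lpe_trans by blast
  qed (use T in \<open>auto simp: CT_iff\<close>)
  then show ?thesis using conv_unique[OF T] k by (auto simp: CT_iff)
qed

lemma dual_ubword_conv:
  assumes T: "T \<in> CT N (big_bar_order N) \<nu>"
    and range: "\<And>c. c \<in> Y \<Longrightarrow> lo \<le> - content c \<and> - content c \<le> hi"
  shows "ubword (prod.swap ` Y) (dual_filling T) lo hi \<approx> ubword (prod.swap ` Y) (dual_filling (conv' T)) lo hi"
proof -
  note Y = downset_young_diagram[OF \<nu>]
  let ?w = "\<lambda>T. ubword (prod.swap ` Y) (dual_filling T) lo hi"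
  obtain k where k: "cut_order N (row.swept N k) = natural_order N" using row.swept_all by blast
  have "\<exists>T1. reach N Y T (cut_order N (row.swept N k)) T1 \<and> tableau N Y (cut_order N (row.swept N k)) T1 \<and>
    T1 \<in> extensional Y \<and> ?w T \<approx> ?w T1"
  proof (rule row.sweep_up[OF Y])
    fix k b a T1
    assume ba: "(b, a) \<in> cells N" "row_key N b a = k"
      and sw: "swap_up N b a (cut_order N (row.swept N k)) (cut_order N (insert (b, a) (row.swept N k)))"
      and T1: "tableau N Y (cut_order N (row.swept N k)) T1" "?w T \<approx> ?w T1"
    interpret letter_pair N "cut_order N (row.swept N k)" "cut_order N (insert (b, a) (row.swept N k))" b a
      using sw by unfold_locales
    interpret d: letter_pair N "dual_order (cut_order N (insert (b, a) (row.swept N k)))"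
      "dual_order (cut_order N (row.swept N k))" a b by (rule dual_pair)
    have tame: "tame (dual_order (cut_order N (insert (b, a) (row.swept N k)))) a"
      using tame_row[OF ba(1)] ba(2) by simp
    have rng: "lo \<le> content c \<and> content c \<le> hi" if "c \<in> prod.swap ` Y" for c
      using that range by (elim imageE) simp
    \<comment> \<open>The dual conversion leads from the new tableau back to the old one.\<close>
    have "?w (rot Y b a T1) \<approx> ubword (prod.swap ` Y) (rot (prod.swap ` Y) a b (dual_filling (rot Y b a T1))) lo hi"
      by (rule d.ubword_rot[OF downset_swap[OF Y] tableau_dual[OF rot_tableau[OF Y T1(1)]] tame rng])
    then have "?w (rot Y b a T1) \<approx> ?w T1" unfolding rot_dual[OF Y T1(1)] .
    then show "?w T \<approx> ?w (rot Y b a T1)" using T1(2) lpe_trans lpe_sym by blast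
  qed (use T in \<open>auto simp: CT_iff\<close>)
  then show ?thesis using conv_unique[OF T] k by (auto simp: CT_iff)
qed

text \<open>The column sweep is run backwards, each swap being inverted by
  \<open>rot_surj\<close>.\<close>

lemma conv_surj:
  assumes "T' \<in> CT N (natural_order N) \<nu>"
  obtains T where "T \<in> CT N (big_bar_order N) \<nu>" "conv' T = T'"
proof -
  obtain k where k: "cut_order N (col.swept N k) = natural_order N" using col.swept_all by blast
  obtain T where "tableau N Y (big_bar_order N) T" "T \<in> extensional Y" "reach N Y T (natural_order N) T'"
    using col.sweep_down[OF downset_young_diagram[OF \<nu>], of N k T'] assms unfolding k CT_iff by blast
  then show ?thesis using that conv_unique[of T T'] assms by (simp add: CT_iff)
qed

end

context kron_set
begin

text \<open>The equivalence serves both inclusions: for the second it is applied to the preimage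
  supplied by \<open>conv_surj\<close>.\<close>

lemma sqread_conv:
  assumes \<nu>: "is_partition \<nu>" and T: "T \<in> CT N (big_bar_order N) \<nu>"
  shows "sqread \<nu> (conv N \<nu> (big_bar_order N) (natural_order N) T) \<in> W \<longleftrightarrow> sqread \<nu> T \<in> W"
proof -
  let ?T = "conv N \<nu> (big_bar_order N) (natural_order N) T"
  have t: "tableau N (young_diagram \<nu>) (big_bar_order N) T" "tableau N (young_diagram \<nu>) (natural_order N) ?T"
    using T reach_conv(2)[OF \<nu> T] by (auto simp: CT_iff)
  note b = shuffle_order_big_bar[of N] and n = shuffle_order_natural[of N]
  note range = content_range[OF \<nu>]
  have u: "ubword (young_diagram \<nu>) T (1 - int (length \<nu>)) (int (hd \<nu>) - 1)
      \<approx> ubword (young_diagram \<nu>) ?T (1 - int (length \<nu>)) (int (hd \<nu>) - 1)"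
    by (rule ubword_conv[OF \<nu> T]) (use range in auto)
  have v: "ubword (prod.swap ` young_diagram \<nu>) (dual_filling T) (1 - int (hd \<nu>)) (int (length \<nu>) - 1)
      \<approx> ubword (prod.swap ` young_diagram \<nu>) (dual_filling ?T) (1 - int (hd \<nu>)) (int (length \<nu>) - 1)"
    by (rule dual_ubword_conv[OF \<nu> T]) (use range in force)
  show ?thesis
    using mem_W_cong[OF unbarred_sqread[OF b \<nu> t(1)] unbarred_sqread[OF n \<nu> t(2)] u
        barred_sqread[OF b \<nu> t(1)] barred_sqread[OF n \<nu> t(2)] v] by blast
qed

end

theorem theorem3p18:
  fixes N :: nat and W :: "letter list set" and \<nu> :: "nat list"
  assumes "finite W" and "W \<subseteq> colored_words N" and "shuffle_closed W"
    and "(\<Sum>w\<in>W. word_monomial w) \<in> orth_compl N (I_kron N)"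
    and "is_partition \<nu>"
  shows "conv N \<nu> (big_bar_order N) (natural_order N) ` CT_in N (big_bar_order N) \<nu> W
         = CT_in N (natural_order N) \<nu> W"
proof -
  interpret kron_set N W using assms(1-4) by unfold_locales
  let ?conv = "conv N \<nu> (big_bar_order N) (natural_order N)"
  show ?thesis
  proof (intro subset_antisym subsetI)
    fix T' assume "T' \<in> ?conv ` CT_in N (big_bar_order N) \<nu> W"
    then show "T' \<in> CT_in N (natural_order N) \<nu> W"
      using reach_conv(2)[OF assms(5)] sqread_conv[OF assms(5)] by (auto simp: CT_in_def)
  next
    fix T' assume T': "T' \<in> CT_in N (natural_order N) \<nu> W"
    then obtain T where T: "T \<in> CT N (big_bar_order N) \<nu>" "?conv T = T'"
      using conv_surj[OF assms(5), of T'] by (auto simp: CT_in_def)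
    then have "T \<in> CT_in N (big_bar_order N) \<nu> W"
      using T' sqread_conv[OF assms(5) T(1)] by (simp add: CT_in_def)
    then show "T' \<in> ?conv ` CT_in N (big_bar_order N) \<nu> W" using T(2) by blast
  qed
qed

end
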